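(* Let $\eta$ be a smooth unit vector field on $\mathbb{E}^3$, and let $\gamma$ be an $\eta$-principal cycle of length $L$ of the $\eta$-principal foliation $\mathcal{F}_1(\eta)$. Then, given $\varepsilon>0$ small, there is a smooth vector field $\eta_{\varepsilon}\in\mathfrak{X}_{\mathfrak{R}}^r(\mathbb{E}^3)$ such that $\eta_{\varepsilon}$ is $\varepsilon$-$C^r$ close to $\eta$ and $\gamma$ is a hyperbolic $\eta_{\varepsilon}$-principal cycle of $\mathcal{F}_1(\eta_{\varepsilon})$.
   Context: $\mathbb{E}^3$ is Euclidean 3-space with inner product $\langle\cdot,\cdot\rangle$; $r\ge 2$ is an integer. $\mathfrak{X}_{\mathfrak{R}}^r(\mathbb{E}^3)$ is the set of unit vector fields of class $C^r$ on $\mathbb{E}^3$, with the following $C^r$ Whitney topology (induced from the space of all $C^r$ vector fields). Fix an exhaustion $K_1\subset K_2\subset\cdots$ of $\mathbb{E}^3$ by compact sets with nonempty interiors and $K_i$ contained in the interior of $K_{i+1}$, $K_0=\emptyset$. For a vector field $X$ and a positive function $\delta$ on $\mathbb{E}^3$ put $\delta_i=\inf\{\delta(x): x\in K_i\setminus \mathrm{int}\,K_{i-1}\}$; the sets of all $Y$ with $d(X,Y,K_i\setminus\mathrm{int}\,K_{i-1})<\delta_i$ for all $i$, where $d(\cdot,\cdot,K)$ is the usual $C^r$ distance on a compact set $K$ (supremum over $K$ of the differences of all derivatives of order $\le r$), form a base of neighbourhoods of $X$. "$\varepsilon$-$C^r$ close" means lying in such a neighbourhood with $\delta\equiv\varepsilon$.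 For a unit vector field $\eta$, let $\Delta_\eta$ be the plane field orthogonal to $\eta$. Its normal curvature in a nonzero direction $X\in\Delta_\eta(p)$ is $$k_\eta(X)=-\frac{\langle D\eta\cdot X,X\rangle}{\langle X,X\rangle}.$$ The minimum and maximum $k_1(p)\le k_2(p)$ of $k_\eta$ restricted to $\Delta_\eta(p)$ are the $\eta$-principal curvatures; the set $\mathcal{P}(\eta)=\{p: k_1(p)=k_2(p)\}$ is the partially umbilic set. Outside $\mathcal{P}(\eta)$ the directions in $\Delta_\eta$ realizing $k_1$ and $k_2$ (the $\eta$-principal directions) define two mutually orthogonal line fields; their integral curves, the $\eta$-principal lines, form the one-dimensional $\eta$-principal foliations $\mathcal{F}_1(\eta)$ and $\mathcal{F}_2(\eta)$ of $\mathbb{E}^3\setminus\mathcal{P}(\eta)$, corresponding to $k_1$ and $k_2$ respectively. An $\eta$-principal cycle is a closed (periodic) integral curve, i.e. a compact leaf, of $\mathcal{F}_1(\eta)$ or $\mathcal{F}_2(\eta)$. It is hyperbolic if the derivative at the base point of its Poincaré first return map, defined by following leaves of the foliation along $\gamma$ on a two-dimensional section transversal to $\gamma$, has no eigenvalue on the unit circle $\mathbb{S}^1\subset\mathbb{C}$. *)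

theory Defs
  imports "HOL-Analysis.Analysis"
begin

type_synonym E3 = "real ^ 3"

section \<open>Functions and vector fields of class $C^k$\<close>

text \<open>Intended for open \<open>U\<close> in finite-dimensional spaces, where it is the usual notion: all
  iterated directional derivatives of order at most \<open>k\<close> exist and are continuous.\<close>

primrec Ck_on ::
  "nat \<Rightarrow> 'a::real_normed_vector set \<Rightarrow> ('a \<Rightarrow> 'b::real_normed_vector) \<Rightarrow> bool" where
  "Ck_on 0 U f \<longleftrightarrow> continuous_on U f"
| "Ck_on (Suc k) U f \<longleftrightarrow>
     (\<forall>x\<in>U. f differentiable (at x)) \<and> (\<forall>v. Ck_on k U (\<lambda>x. frechet_derivative f (at x) v))"

definition smooth_on ::
  "'a::real_normed_vector set \<Rightarrow> ('a \<Rightarrow> 'b::real_normed_vector) \<Rightarrow> bool" where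
  "smooth_on U f \<longleftrightarrow> (\<forall>k. Ck_on k U f)"

definition unit_fields :: "nat \<Rightarrow> (E3 \<Rightarrow> E3) set" where
  "unit_fields r = {X. Ck_on r UNIV X \<and> (\<forall>p. norm (X p) = 1)}"

section \<open>The Whitney topology\<close>

primrec iter_deriv ::
  "('a::real_normed_vector \<Rightarrow> 'b::real_normed_vector) \<Rightarrow> 'a list \<Rightarrow> 'a \<Rightarrow> 'b" where
  "iter_deriv f [] = f"
| "iter_deriv f (v # vs) = iter_deriv (\<lambda>x. frechet_derivative f (at x) v) vs"

text \<open>The lists of basis vectors enumerate the partial derivatives of order at most \<open>r\<close>. For
  \<open>C\<^sup>r\<close> fields and compact nonempty \<open>A\<close> the supremum is over a bounded nonempty set.\<close>

definition Cr_dist :: "nat \<Rightarrow> (E3 \<Rightarrow> E3) \<Rightarrow> (E3 \<Rightarrow> E3) \<Rightarrow> E3 set \<Rightarrow> real" where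
  "Cr_dist r X Y A =
     (SUP (vs, x) \<in> {vs. length vs \<le> r \<and> set vs \<subseteq> Basis} \<times> A.
        norm (iter_deriv X vs x - iter_deriv Y vs x))"

definition compact_exhaustion :: "(nat \<Rightarrow> E3 set) \<Rightarrow> bool" where
  "compact_exhaustion K \<longleftrightarrow>
     K 0 = {} \<and> (\<forall>i. compact (K i)) \<and> (\<forall>i\<ge>1. interior (K i) \<noteq> {}) \<and>
     (\<forall>i. K i \<subseteq> interior (K (Suc i))) \<and> (\<Union>i. K i) = UNIV"

definition shell :: "(nat \<Rightarrow> E3 set) \<Rightarrow> nat \<Rightarrow> E3 set" where
  "shell K i = K (Suc i) - interior (K i)"

definition whitney_nbhd ::
  "nat \<Rightarrow> (nat \<Rightarrow> E3 set) \<Rightarrow> (E3 \<Rightarrow> real) \<Rightarrow> (E3 \<Rightarrow> E3) \<Rightarrow> (E3 \<Rightarrow> E3) set" where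
  "whitney_nbhd r K \<delta> X =
     {Y. Ck_on r UNIV Y \<and> (\<forall>i. Cr_dist r X Y (shell K i) < (INF x\<in>shell K i. \<delta> x))}"

definition Cr_close ::
  "nat \<Rightarrow> (nat \<Rightarrow> E3 set) \<Rightarrow> real \<Rightarrow> (E3 \<Rightarrow> E3) \<Rightarrow> (E3 \<Rightarrow> E3) \<Rightarrow> bool" where
  "Cr_close r K \<epsilon> X Y \<longleftrightarrow> Y \<in> whitney_nbhd r K (\<lambda>_. \<epsilon>) X"

section \<open>Principal curvatures and principal lines of a unit vector field\<close>

definition orth_plane :: "(E3 \<Rightarrow> E3) \<Rightarrow> E3 \<Rightarrow> E3 set" where
  "orth_plane \<eta> p = {X. X \<bullet> \<eta> p = 0}"

definition normal_curvature :: "(E3 \<Rightarrow> E3) \<Rightarrow> E3 \<Rightarrow> E3 \<Rightarrow> real" where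
  "normal_curvature \<eta> p X = - (frechet_derivative \<eta> (at p) X \<bullet> X) / (X \<bullet> X)"

text \<open>By homogeneity and compactness of the unit circle, infimum and supremum are attained
  wherever \<open>\<eta>\<close> is differentiable, i.e. they are the minimum and the maximum.\<close>

definition k_min :: "(E3 \<Rightarrow> E3) \<Rightarrow> E3 \<Rightarrow> real" where
  "k_min \<eta> p = (INF X \<in> orth_plane \<eta> p - {0}. normal_curvature \<eta> p X)"

definition k_max :: "(E3 \<Rightarrow> E3) \<Rightarrow> E3 \<Rightarrow> real" where
  "k_max \<eta> p = (SUP X \<in> orth_plane \<eta> p - {0}. normal_curvature \<eta> p X)"

definition partially_umbilic :: "(E3 \<Rightarrow> E3) \<Rightarrow> E3 set" where
  "partially_umbilic \<eta> = {p. k_min \<eta> p = k_max \<eta> p}"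

text \<open>In what follows \<open>\<kappa>\<close> is \<open>k_min \<eta>\<close> for the foliation \<open>F\<^sub>1(\<eta>)\<close> and \<open>k_max \<eta>\<close> for
  \<open>F\<^sub>2(\<eta>)\<close>. Since these are foliations by unoriented lines, integral curves are
  parametrized by arc length, with either orientation.\<close>

definition principal_direction ::
  "(E3 \<Rightarrow> E3) \<Rightarrow> (E3 \<Rightarrow> real) \<Rightarrow> E3 \<Rightarrow> E3 \<Rightarrow> bool" where
  "principal_direction \<eta> \<kappa> p X \<longleftrightarrow>
     X \<in> orth_plane \<eta> p \<and> X \<noteq> 0 \<and> normal_curvature \<eta> p X = \<kappa> p"

definition principal_line ::
  "(E3 \<Rightarrow> E3) \<Rightarrow> (E3 \<Rightarrow> real) \<Rightarrow> real set \<Rightarrow> (real \<Rightarrow> E3) \<Rightarrow> bool" where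
  "principal_line \<eta> \<kappa> I c \<longleftrightarrow>
     (\<exists>c'. continuous_on I c' \<and>
        (\<forall>t\<in>I. (c has_vector_derivative c' t) (at t within I) \<and> norm (c' t) = 1 \<and>
           c t \<notin> partially_umbilic \<eta> \<and> principal_direction \<eta> \<kappa> (c t) (c' t)))"

text \<open>A compact leaf, parametrized by arc length over the real line with least period its
  length \<open>L\<close>.\<close>

definition principal_cycle ::
  "(E3 \<Rightarrow> E3) \<Rightarrow> (E3 \<Rightarrow> real) \<Rightarrow> (real \<Rightarrow> E3) \<Rightarrow> real \<Rightarrow> bool" where
  "principal_cycle \<eta> \<kappa> \<gamma> L \<longleftrightarrow>
     0 < L \<and> principal_line \<eta> \<kappa> UNIV \<gamma> \<and> (\<forall>s. \<gamma> (s + L) = \<gamma> s) \<and> inj_on \<gamma> {0..<L}"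

section \<open>Poincare map and hyperbolicity\<close>

text \<open>The section is the embedded surface \<open>\<sigma> ` U\<close>, the base point is \<open>\<gamma> 0\<close>.\<close>

definition transversal_section ::
  "(real \<Rightarrow> E3) \<Rightarrow> (real ^ 2) set \<Rightarrow> (real ^ 2 \<Rightarrow> E3) \<Rightarrow> bool" where
  "transversal_section \<gamma> U \<sigma> \<longleftrightarrow>
     open U \<and> 0 \<in> U \<and> Ck_on 1 U \<sigma> \<and> (\<exists>g. homeomorphism U (\<sigma> ` U) \<sigma> g) \<and>
     (\<forall>u\<in>U. inj (frechet_derivative \<sigma> (at u))) \<and>
     \<sigma> 0 = \<gamma> 0 \<and> \<sigma> ` U \<inter> range \<gamma> = {\<gamma> 0} \<and>
     vector_derivative \<gamma> (at 0) \<notin> range (frechet_derivative \<sigma> (at 0))"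

text \<open>The leaf through \<open>q\<close>, left in the direction in which \<open>\<gamma>\<close> leaves \<open>\<gamma> 0\<close>, meets \<open>S\<close> again
  for the first time at \<open>q'\<close>. The condition on the initial velocities selects the
  orientation of the leaf when \<open>q\<close> is near \<open>\<gamma> 0\<close>.\<close>

definition first_return ::
  "(E3 \<Rightarrow> E3) \<Rightarrow> (E3 \<Rightarrow> real) \<Rightarrow> (real \<Rightarrow> E3) \<Rightarrow> E3 set \<Rightarrow> E3 \<Rightarrow> E3 \<Rightarrow> bool" where
  "first_return \<eta> \<kappa> \<gamma> S q q' \<longleftrightarrow>
     (\<exists>c T. 0 < T \<and> principal_line \<eta> \<kappa> {0..T} c \<and>
        vector_derivative c (at 0 within {0..T}) \<bullet> vector_derivative \<gamma> (at 0) > 0 \<and>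
        c 0 = q \<and> c T = q' \<and> q' \<in> S \<and> (\<forall>t\<in>{0<..<T}. c t \<notin> S))"

text \<open>The first return map, read in the coordinates \<open>\<sigma>\<close> of the section, near the base point.\<close>

definition poincare_map ::
  "(E3 \<Rightarrow> E3) \<Rightarrow> (E3 \<Rightarrow> real) \<Rightarrow> (real \<Rightarrow> E3) \<Rightarrow>
   (real ^ 2) set \<Rightarrow> (real ^ 2 \<Rightarrow> E3) \<Rightarrow> (real ^ 2 \<Rightarrow> real ^ 2) \<Rightarrow> bool" where
  "poincare_map \<eta> \<kappa> \<gamma> U \<sigma> P \<longleftrightarrow>
     (\<exists>V\<subseteq>U. open V \<and> 0 \<in> V \<and>
        (\<forall>u\<in>V. P u \<in> U \<and> first_return \<eta> \<kappa> \<gamma> (\<sigma> ` U) (\<sigma> u) (\<sigma> (P u))))"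

definition complex_eigenvalue :: "real ^ 'n ^ 'n \<Rightarrow> complex \<Rightarrow> bool" where
  "complex_eigenvalue A z \<longleftrightarrow>
     (\<exists>v :: complex ^ 'n. v \<noteq> 0 \<and> (\<chi> i j. complex_of_real (A $ i $ j)) *v v = z *s v)"

text \<open>Changing the section conjugates the return map, so the choice of section does not
  matter.\<close>

definition hyperbolic_principal_cycle ::
  "(E3 \<Rightarrow> E3) \<Rightarrow> (E3 \<Rightarrow> real) \<Rightarrow> (real \<Rightarrow> E3) \<Rightarrow> real \<Rightarrow> bool" where
  "hyperbolic_principal_cycle \<eta> \<kappa> \<gamma> L \<longleftrightarrow>
     principal_cycle \<eta> \<kappa> \<gamma> L \<and>
     (\<exists>U \<sigma> P P'. transversal_section \<gamma> U \<sigma> \<and> poincare_map \<eta> \<kappa> \<gamma> U \<sigma> P \<and>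
        (P has_derivative P') (at 0) \<and>
        (\<forall>z. complex_eigenvalue (matrix P') z \<longrightarrow> z \<notin> sphere 0 1))"

end

(* The k_min-direction field of eta is a smooth function of a reference direction and the point, so
   the leaves near gamma solve x' = f(t, x), where f(t, x) is the principal direction at x closest to
   gamma'(t), and the derivative of the return map is read off the variational equation
   v' = D_x f(t, gamma(t)) v along gamma.

   Near one point of gamma let xi be the unit principal direction field and rotate the pair:
   eta_s = cos(s theta) eta + sin(s theta) xi, with theta of compact support and zero on gamma.
   The 2-jet of theta along gamma can be chosen so that the variational equation of eta_s is
   v' = D_x f v + s mu (v - <v, gamma'> gamma') with a bump function mu: the linear part of theta
   produces the component along eta, the quadratic part the one along eta x xi.  Hence the
   derivative of the return map is multiplied by exp(s * int mu), and all but finitely many small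
   s > 0 give a hyperbolic cycle. *)
theory Submission
  imports Defs "HOL-Real_Asymp.Real_Asymp"
begin

text \<open>Principal directions form an unoriented line field, and no frame is chosen on a tube
  around the cycle: the reference direction \<open>\<gamma>' t\<close> only selects a sign, so
  \<open>f\<close> is locally independent of \<open>t\<close> and its solutions are genuine leaves.

  Rotation by \<open>s * \<theta>\<close> keeps the field of unit length. On \<gamma>, \<theta>
  vanishes and its derivative sees only the component along \<eta>, so the quadratic form on the
  orthogonal plane is unchanged there and \<gamma> stays a principal cycle for every
  \<open>s\<close>. What changes is how the principal direction varies off \<gamma>. Its angle in
  the rotated plane is governed by the off-diagonal entry of the form: differentiating the
  eigenvector equation on \<gamma> divides the derivative of that entry by twice the gap between the
  diagonal entries. Away from partially umbilic points the gap is positive, so second derivatives of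
  \<theta> can realise any wanted normal derivative of the angle.

  The resulting perturbation acts on the normal plane as a multiple of the identity, so nothing has
  to be known about the original return map.\<close>

section \<open>Calculus of functions of class $C^k$\<close>

lemma frechet_derivativeI:
  "(f has_derivative f') (at x) \<Longrightarrow> frechet_derivative f (at x) = f'"
  by (rule frechet_derivative_at[symmetric])

lemma has_derivative_frechet:
  "f differentiable (at x) \<Longrightarrow> (f has_derivative frechet_derivative f (at x)) (at x)"
  by (simp add: frechet_derivative_works)

lemma frechet_derivative_cong_open:
  assumes "open U" "x \<in> U" "\<And>y. y \<in> U \<Longrightarrow> f y = g y"
  shows "frechet_derivative f (at x) = frechet_derivative g (at x)"
    and "f differentiable (at x) \<longleftrightarrow> g differentiable (at x)"
proof -
  have *: "(f has_derivative D) (at x) \<longleftrightarrow> (g has_derivative D) (at x)" for D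
    using assms by (metis has_derivative_transform_within_open)
  show "frechet_derivative f (at x) = frechet_derivative g (at x)"
    unfolding frechet_derivative_def * ..
  show "f differentiable (at x) \<longleftrightarrow> g differentiable (at x)"
    unfolding differentiable_def * ..
qed

lemma Ck_on_differentiable: "Ck_on (Suc k) U f \<Longrightarrow> x \<in> U \<Longrightarrow> f differentiable (at x)"
  by simp

lemma Ck_on_Suc_imp: "Ck_on (Suc k) U f \<Longrightarrow> Ck_on k U f"
proof (induction k arbitrary: f)
  case 0
  then show ?case
    by (auto intro!: continuous_at_imp_continuous_on differentiable_imp_continuous_within)
next
  case (Suc k)
  from Suc.prems have d: "\<forall>x\<in>U. f differentiable (at x)"
    and "\<And>v. Ck_on (Suc k) U (\<lambda>x. frechet_derivative f (at x) v)"
    by (subst (asm) Ck_on.simps(2), blast)+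
  then show ?case using Suc.IH by (subst Ck_on.simps(2)) blast
qed

lemma Ck_on_subset: "Ck_on k U f \<Longrightarrow> V \<subseteq> U \<Longrightarrow> Ck_on k V f"
  by (induction k arbitrary: f) (auto intro: continuous_on_subset)

lemma Ck_on_cong:
  assumes "open U" "\<And>y. y \<in> U \<Longrightarrow> f y = g y" "Ck_on k U f"
  shows "Ck_on k U g"
  using assms(2,3)
proof (induction k arbitrary: f g)
  case 0
  then show ?case by (metis Ck_on.simps(1) continuous_on_cong)
next
  case (Suc k)
  have "frechet_derivative f (at x) = frechet_derivative g (at x)" "g differentiable (at x)" if "x \<in> U" for x
    using frechet_derivative_cong_open[OF assms(1) that Suc.prems(1)] Suc.prems(2) that by auto
  then show ?case using Suc.prems(2) Suc.IH[of "\<lambda>x. frechet_derivative f (at x) v" "\<lambda>x. frechet_derivative g (at x) v" for v]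
    by auto
qed

lemma Ck_on_local:
  assumes "\<And>x. x \<in> U \<Longrightarrow> \<exists>V. open V \<and> x \<in> V \<and> Ck_on k V f"
  shows "Ck_on k U f"
  using assms
proof (induction k arbitrary: f)
  case 0
  then have "isCont f x" if "x \<in> U" for x
    using that by (metis Ck_on.simps(1) continuous_on_eq_continuous_at)
  then show ?case by (auto intro: continuous_at_imp_continuous_on)
next
  case (Suc k)
  have "f differentiable (at x)" if "x \<in> U" for x
    using Suc.prems[OF that] by auto
  moreover have "Ck_on k U (\<lambda>x. frechet_derivative f (at x) v)" for v
    by (rule Suc.IH) (use Suc.prems in fastforce)
  ultimately show ?case by simp
qed

lemma Ck_on_const: "Ck_on k U (\<lambda>x. c)"
  by (induction k arbitrary: c) (auto simp: frechet_derivative_const)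

lemma Ck_on_bounded_linear:
  assumes "bounded_linear f"
  shows "Ck_on k U f"
proof (cases k)
  case 0
  then show ?thesis by (simp add: assms linear_continuous_on)
next
  case (Suc j)
  have "(f has_derivative f) (at x)" for x
    using assms by (rule bounded_linear_imp_has_derivative)
  then have "f differentiable (at x)" "frechet_derivative f (at x) = f" for x
    by (auto simp: differentiable_def intro: frechet_derivativeI)
  with Suc show ?thesis by (simp add: Ck_on_const)
qed

lemma Ck_on_add:
  assumes "open U" "Ck_on k U f" "Ck_on k U g"
  shows "Ck_on k U (\<lambda>x. f x + g x)"
  using assms(2,3)
proof (induction k arbitrary: f g)
  case 0
  then show ?case by (simp add: continuous_on_add)
next
  case (Suc k)
  have D: "((\<lambda>x. f x + g x) has_derivative (\<lambda>v. frechet_derivative f (at x) v + frechet_derivative g (at x) v)) (at x)"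
    if "x \<in> U" for x
    using Suc.prems that by (intro has_derivative_add has_derivative_frechet) auto
  have "Ck_on k U (\<lambda>x. frechet_derivative (\<lambda>x. f x + g x) (at x) v)" for v
    by (rule Ck_on_cong[OF assms(1) _ Suc.IH[of "\<lambda>x. frechet_derivative f (at x) v" "\<lambda>x. frechet_derivative g (at x) v"]])
       (use Suc.prems frechet_derivativeI[OF D] in auto)
  with D show ?case by (auto simp: differentiable_def)
qed

text \<open>Stated for arbitrary bounded bilinear maps so that scaling, multiplication,
  \<open>inner\<close> and \<open>cross3\<close> share one product rule.\<close>

lemma (in bounded_bilinear) Ck_on_prod:
  assumes "open U" "Ck_on k U f" "Ck_on k U g"
  shows "Ck_on k U (\<lambda>x. prod (f x) (g x))"
  using assms(2,3)
proof (induction k arbitrary: f g)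
  case 0
  then show ?case by (simp add: continuous_on)
next
  case (Suc k)
  have D: "((\<lambda>x. prod (f x) (g x)) has_derivative
      (\<lambda>v. prod (f x) (frechet_derivative g (at x) v) + prod (frechet_derivative f (at x) v) (g x))) (at x)"
    if "x \<in> U" for x
    using Suc.prems that by (intro FDERIV has_derivative_frechet) auto
  have "Ck_on k U f" "Ck_on k U g" using Suc.prems by (auto dest!: Ck_on_Suc_imp simp del: Ck_on.simps)
  then have "Ck_on k U (\<lambda>x. prod (f x) (frechet_derivative g (at x) v) + prod (frechet_derivative f (at x) v) (g x))" for v
    using Suc.prems by (intro Ck_on_add assms(1) Suc.IH) auto
  then have "Ck_on k U (\<lambda>x. frechet_derivative (\<lambda>x. prod (f x) (g x)) (at x) v)" for v
    by (rule Ck_on_cong[OF assms(1), rotated]) (use frechet_derivativeI[OF D] in auto)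
  with D show ?case by (auto simp: differentiable_def)
qed

lemma Ck_on_sum:
  assumes "open U" "\<And>i. i \<in> I \<Longrightarrow> Ck_on k U (f i)"
  shows "Ck_on k U (\<lambda>x. \<Sum>i\<in>I. f i x)"
  using assms(2)
  by (induction I rule: infinite_finite_induct) (auto intro!: Ck_on_const Ck_on_add assms(1))

lemma linear_eq_sum_Basis:
  fixes A :: "'a::euclidean_space \<Rightarrow> 'b::real_vector"
  assumes "linear A"
  shows "A w = (\<Sum>b\<in>Basis. (w \<bullet> b) *\<^sub>R A b)"
proof -
  have "A w = A (\<Sum>b\<in>Basis. (w \<bullet> b) *\<^sub>R b)" by (simp add: euclidean_representation)
  also have "\<dots> = (\<Sum>b\<in>Basis. (w \<bullet> b) *\<^sub>R A b)"
    by (simp add: linear_sum[OF assms] linear_cmul[OF assms])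
  finally show ?thesis .
qed

lemma norm_linear_le_sum_Basis:
  fixes A :: "'a::euclidean_space \<Rightarrow> 'b::real_normed_vector"
  assumes "linear A"
  shows "norm (A w) \<le> (\<Sum>b\<in>Basis. norm (A b)) * norm w"
proof -
  have "norm (A w) \<le> (\<Sum>b\<in>Basis. norm ((w \<bullet> b) *\<^sub>R A b))"
    by (subst linear_eq_sum_Basis[OF assms]) (rule norm_sum)
  also have "\<dots> \<le> (\<Sum>b\<in>Basis. norm (A b) * norm w)"
  proof (rule sum_mono)
    fix b :: 'a assume "b \<in> Basis"
    from mult_left_mono[OF Basis_le_norm[OF this, of w] norm_ge_zero[of "A b"]]
    show "norm ((w \<bullet> b) *\<^sub>R A b) \<le> norm (A b) * norm w" by (simp add: mult.commute)
  qed
  finally show ?thesis by (simp add: sum_distrib_right)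
qed

text \<open>The chain rule applies the derivative of \<open>f\<close> in a direction that varies
  with \<open>x\<close>. Expanding that direction in \<open>Basis\<close> leaves derivatives of
  \<open>f\<close> in fixed directions, to which the induction hypothesis applies; this is why the
  middle space is Euclidean.\<close>

lemma Ck_on_compose:
  fixes g :: "'a::real_normed_vector \<Rightarrow> 'b::euclidean_space"
  assumes "open U" "Ck_on k V f" "Ck_on k U g" "g ` U \<subseteq> V"
  shows "Ck_on k U (\<lambda>x. f (g x))"
  using assms(2,3)
proof (induction k arbitrary: f)
  case 0
  then show ?case using assms(4) by (auto intro: continuous_on_compose2)
next
  case (Suc k)
  have D: "((\<lambda>x. f (g x)) has_derivative (\<lambda>v. frechet_derivative f (at (g x)) (frechet_derivative g (at x) v))) (at x)"
    if "x \<in> U" for x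
  proof (rule has_derivative_compose[where f = g and g = f])
    show "(g has_derivative frechet_derivative g (at x)) (at x)"
      using Suc.prems that by (intro has_derivative_frechet) auto
    show "(f has_derivative frechet_derivative f (at (g x))) (at (g x))"
      using Suc.prems that assms(4) by (intro has_derivative_frechet) auto
  qed
  have lin: "linear (frechet_derivative f (at (g x)))" if "x \<in> U" for x
    using Suc.prems that assms(4) by (auto intro!: linear_frechet_derivative)
  have "Ck_on k U g" using Suc.prems by (auto dest!: Ck_on_Suc_imp simp del: Ck_on.simps)
  then have "Ck_on k U (\<lambda>x. \<Sum>b\<in>Basis. (frechet_derivative g (at x) v \<bullet> b) *\<^sub>R frechet_derivative f (at (g x)) b)" for v
    using Suc.prems
    by (intro Ck_on_sum assms(1) bounded_bilinear.Ck_on_prod[OF bounded_bilinear_scaleR]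
        bounded_bilinear.Ck_on_prod[OF bounded_bilinear_inner] Ck_on_const Suc.IH) auto
  then have "Ck_on k U (\<lambda>x. frechet_derivative (\<lambda>x. f (g x)) (at x) v)" for v
    by (rule Ck_on_cong[OF assms(1), rotated])
       (simp add: frechet_derivativeI[OF D] linear_eq_sum_Basis[OF lin, symmetric])
  with D show ?case by (auto simp: differentiable_def)
qed

lemma Ck_on_Suc_real:
  fixes f :: "real \<Rightarrow> 'b::real_normed_vector"
  assumes "open U" "\<And>x. x \<in> U \<Longrightarrow> (f has_vector_derivative f' x) (at x)" "Ck_on k U f'"
  shows "Ck_on (Suc k) U f"
proof -
  have D: "(f has_derivative (\<lambda>v. v *\<^sub>R f' x)) (at x)" if "x \<in> U" for x
    using assms(2)[OF that] by (simp add: has_vector_derivative_def)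
  have "Ck_on k U (\<lambda>x. v *\<^sub>R f' x)" for v
    by (intro bounded_bilinear.Ck_on_prod[OF bounded_bilinear_scaleR] Ck_on_const assms)
  then have "Ck_on k U (\<lambda>x. frechet_derivative f (at x) v)" for v
    by (rule Ck_on_cong[OF assms(1), rotated]) (use frechet_derivativeI[OF D] in auto)
  with D show ?thesis by (auto simp: differentiable_def)
qed

section \<open>Smooth functions\<close>

lemma smooth_on_Ck: "smooth_on U f \<Longrightarrow> Ck_on k U f"
  by (simp add: smooth_on_def)

lemma smooth_on_subset: "smooth_on U f \<Longrightarrow> V \<subseteq> U \<Longrightarrow> smooth_on V f"
  by (auto simp: smooth_on_def intro: Ck_on_subset)

lemma smooth_on_cong:
  "open U \<Longrightarrow> (\<And>y. y \<in> U \<Longrightarrow> f y = g y) \<Longrightarrow> smooth_on U f \<Longrightarrow> smooth_on U g"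
  unfolding smooth_on_def using Ck_on_cong by blast

lemma smooth_on_local:
  "(\<And>x. x \<in> U \<Longrightarrow> \<exists>V. open V \<and> x \<in> V \<and> smooth_on V f) \<Longrightarrow> smooth_on U f"
  unfolding smooth_on_def by (intro allI Ck_on_local) meson

lemma smooth_on_differentiable: "smooth_on U f \<Longrightarrow> x \<in> U \<Longrightarrow> f differentiable (at x)"
  unfolding smooth_on_def by (metis Ck_on_differentiable)

lemma smooth_on_has_derivative:
  "smooth_on U f \<Longrightarrow> x \<in> U \<Longrightarrow> (f has_derivative frechet_derivative f (at x)) (at x)"
  by (simp add: has_derivative_frechet smooth_on_differentiable)

lemma smooth_on_continuous_on: "smooth_on U f \<Longrightarrow> continuous_on U f"
  unfolding smooth_on_def by (metis Ck_on.simps(1))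

lemma smooth_on_frechet: "smooth_on U f \<Longrightarrow> smooth_on U (\<lambda>x. frechet_derivative f (at x) v)"
  unfolding smooth_on_def
proof
  fix k
  assume "\<forall>k. Ck_on k U f"
  then have "Ck_on (Suc k) U f" by blast
  then show "Ck_on k U (\<lambda>x. frechet_derivative f (at x) v)" by simp
qed

named_theorems smooth_intros

lemma smooth_on_const [smooth_intros]: "smooth_on U (\<lambda>x. c)"
  by (simp add: smooth_on_def Ck_on_const)

lemma smooth_on_bounded_linear: "bounded_linear f \<Longrightarrow> smooth_on U f"
  by (simp add: smooth_on_def Ck_on_bounded_linear)

lemma smooth_on_ident [smooth_intros]: "smooth_on U (\<lambda>x. x)"
  by (simp add: smooth_on_bounded_linear bounded_linear_ident)

lemma smooth_on_fst [smooth_intros]: "smooth_on U fst"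
  and smooth_on_snd [smooth_intros]: "smooth_on U snd"
  by (simp_all add: smooth_on_bounded_linear bounded_linear_fst bounded_linear_snd)

lemma smooth_on_add [smooth_intros]:
  "open U \<Longrightarrow> smooth_on U f \<Longrightarrow> smooth_on U g \<Longrightarrow> smooth_on U (\<lambda>x. f x + g x)"
  by (simp add: smooth_on_def Ck_on_add)

lemma (in bounded_bilinear) smooth_on_prod:
  "open U \<Longrightarrow> smooth_on U f \<Longrightarrow> smooth_on U g \<Longrightarrow> smooth_on U (\<lambda>x. prod (f x) (g x))"
  by (simp add: smooth_on_def Ck_on_prod)

lemmas smooth_on_scaleR [smooth_intros] = bounded_bilinear.smooth_on_prod[OF bounded_bilinear_scaleR]
lemmas smooth_on_mult [smooth_intros] = bounded_bilinear.smooth_on_prod[OF bounded_bilinear_mult]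
lemmas smooth_on_inner [smooth_intros] = bounded_bilinear.smooth_on_prod[OF bounded_bilinear_inner]

lemma bounded_bilinear_cross3: "bounded_bilinear cross3"
  using bilinear_conv_bounded_bilinear bilinear_cross by blast

lemmas smooth_on_cross3 [smooth_intros] = bounded_bilinear.smooth_on_prod[OF bounded_bilinear_cross3]

lemma smooth_on_minus [smooth_intros]:
  "open U \<Longrightarrow> smooth_on U f \<Longrightarrow> smooth_on U (\<lambda>x. - f x)"
  using smooth_on_scaleR[of U "\<lambda>_. -1" f] by (simp add: smooth_on_const)

lemma smooth_on_diff [smooth_intros]:
  "open U \<Longrightarrow> smooth_on U f \<Longrightarrow> smooth_on U g \<Longrightarrow> smooth_on U (\<lambda>x. f x - g x)"
  using smooth_on_add[of U f "\<lambda>x. - g x"] by (simp add: smooth_on_minus)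

lemma smooth_on_sum [smooth_intros]:
  "open U \<Longrightarrow> (\<And>i. i \<in> I \<Longrightarrow> smooth_on U (f i)) \<Longrightarrow> smooth_on U (\<lambda>x. \<Sum>i\<in>I. f i x)"
  by (simp add: smooth_on_def Ck_on_sum)

lemma smooth_on_power [smooth_intros]:
  fixes f :: "_ \<Rightarrow> 'b::real_normed_algebra_1"
  shows "open U \<Longrightarrow> smooth_on U f \<Longrightarrow> smooth_on U (\<lambda>x. f x ^ n)"
  by (induction n) (auto intro!: smooth_intros)

lemma smooth_on_compose:
  fixes g :: "'a::real_normed_vector \<Rightarrow> 'b::euclidean_space"
  assumes "open U" "smooth_on V f" "smooth_on U g" "g ` U \<subseteq> V"
  shows "smooth_on U (\<lambda>x. f (g x))"
  using assms unfolding smooth_on_def by (blast intro: Ck_on_compose)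

text \<open>Reading \<open>l (f x)\<close> as the bilinear expression \<open>r *\<^sub>R l a\<close>
  at the constant \<open>r = 1\<close> reduces the claim to the product rule, where the middle space
  may be any normed space.\<close>

lemma smooth_on_bounded_linear_compose:
  assumes "bounded_linear l" "open U" "smooth_on U f"
  shows "smooth_on U (\<lambda>x. l (f x))"
proof -
  interpret l: bounded_linear l by fact
  have "bounded_bilinear (\<lambda>(r::real) a. r *\<^sub>R l a)"
    by (rule bounded_bilinear.comp[OF bounded_bilinear_scaleR bounded_linear_ident assms(1)])
  from bounded_bilinear.smooth_on_prod[OF this assms(2) smooth_on_const[of U 1] assms(3)]
  show ?thesis by simp
qed

lemma smooth_on_Pair [smooth_intros]:
  assumes "open U" "smooth_on U f" "smooth_on U g"
  shows "smooth_on U (\<lambda>x. (f x, g x))"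
proof -
  have l: "bounded_linear (\<lambda>a::'b. (a, 0::'c))" "bounded_linear (\<lambda>a::'c. (0::'b, a))"
    by (auto intro!: bounded_linear_Pair bounded_linear_ident bounded_linear_zero)
  have "smooth_on U (\<lambda>x. (f x, 0::'c) + (0::'b, g x))"
    by (intro smooth_on_add assms smooth_on_bounded_linear_compose[OF l(1)] smooth_on_bounded_linear_compose[OF l(2)])
  then show ?thesis by simp
qed

lemma smooth_on_frechet_along [smooth_intros]:
  fixes f :: "'a::euclidean_space \<Rightarrow> 'b::real_normed_vector"
  assumes "open U" "smooth_on U f" "smooth_on U w"
  shows "smooth_on U (\<lambda>x. frechet_derivative f (at x) (w x))"
proof -
  have "smooth_on U (\<lambda>x. \<Sum>b\<in>Basis. (w x \<bullet> b) *\<^sub>R frechet_derivative f (at x) b)"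
    by (intro smooth_intros assms smooth_on_frechet)
  then show ?thesis
    by (rule smooth_on_cong[OF assms(1), rotated])
       (metis assms(2) linear_eq_sum_Basis linear_frechet_derivative smooth_on_differentiable)
qed

text \<open>Bootstrapping: if \<open>f'\<close> is as regular as \<open>f\<close>, each round gains
  one derivative. Applied where the derivative is an expression in the function itself:
  \<open>inverse\<close>, \<open>sqrt\<close>, and integral curves of smooth fields.\<close>

lemma smooth_on_realI:
  fixes f :: "real \<Rightarrow> 'b::real_normed_vector"
  assumes "open U" "\<And>x. x \<in> U \<Longrightarrow> (f has_vector_derivative f' x) (at x)"
    and "\<And>k. Ck_on k U f \<Longrightarrow> Ck_on k U f'"
  shows "smooth_on U f"
  unfolding smooth_on_def
proof
  fix k
  show "Ck_on k U f"
  proof (induction k)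
    case 0
    show ?case using assms(2) by (auto intro!: continuous_at_imp_continuous_on has_vector_derivative_continuous)
  next
    case (Suc k)
    then show ?case by (intro Ck_on_Suc_real[where f' = f'] assms)
  qed
qed

lemma smooth_on_real_inverse: "smooth_on {x::real. x \<noteq> 0} inverse"
proof (rule smooth_on_realI[where f' = "\<lambda>x. - (inverse x * inverse x)"])
  show o: "open {x::real. x \<noteq> 0}" by (intro open_Collect_neq continuous_intros)
  show "(inverse has_vector_derivative - (inverse x * inverse x)) (at x)" if "x \<in> {x::real. x \<noteq> 0}" for x
    using that by (auto intro!: derivative_eq_intros simp: has_real_derivative_iff_has_vector_derivative[symmetric] field_simps power2_eq_square)
  show "Ck_on k {x::real. x \<noteq> 0} (\<lambda>x. - (inverse x * inverse x))" if "Ck_on k {x::real. x \<noteq> 0} inverse" for k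
    using bounded_bilinear.Ck_on_prod[OF bounded_bilinear_mult o
        bounded_bilinear.Ck_on_prod[OF bounded_bilinear_mult o that that] Ck_on_const[of _ _ "-1"]] by simp
qed

lemma smooth_on_inverse [smooth_intros]:
  fixes f :: "_ \<Rightarrow> real"
  assumes "open U" "smooth_on U f" "\<And>x. x \<in> U \<Longrightarrow> f x \<noteq> 0"
  shows "smooth_on U (\<lambda>x. inverse (f x))"
  using assms by (intro smooth_on_compose[OF _ smooth_on_real_inverse]) auto

lemma smooth_on_divide [smooth_intros]:
  fixes f g :: "_ \<Rightarrow> real"
  assumes "open U" "smooth_on U f" "smooth_on U g" "\<And>x. x \<in> U \<Longrightarrow> g x \<noteq> 0"
  shows "smooth_on U (\<lambda>x. f x / g x)"
  unfolding divide_inverse using assms by (intro smooth_intros)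

lemma smooth_on_real_sqrt: "smooth_on {0<..} sqrt"
proof (rule smooth_on_realI[where f' = "\<lambda>x. inverse (sqrt x) * (1/2)"])
  show "(sqrt has_vector_derivative inverse (sqrt x) * (1/2)) (at x)" if "x \<in> {0<..}" for x
    using that by (auto intro!: derivative_eq_intros simp: has_real_derivative_iff_has_vector_derivative[symmetric])
  show "Ck_on k {0<..} (\<lambda>x. inverse (sqrt x) * (1/2))" if "Ck_on k {0<..} sqrt" for k
    using that by (intro bounded_bilinear.Ck_on_prod[OF bounded_bilinear_mult] Ck_on_const
        Ck_on_compose[OF _ smooth_on_Ck[OF smooth_on_real_inverse]]) auto
qed auto

lemma smooth_on_sqrt [smooth_intros]:
  fixes f :: "_ \<Rightarrow> real"
  assumes "open U" "smooth_on U f" "\<And>x. x \<in> U \<Longrightarrow> f x > 0"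
  shows "smooth_on U (\<lambda>x. sqrt (f x))"
  using assms by (intro smooth_on_compose[OF _ smooth_on_real_sqrt]) auto

text \<open>The two claims are proved together because each function is, up to sign, the derivative
  of the other.\<close>

lemma Ck_on_sin_cos: "Ck_on k UNIV (sin :: real \<Rightarrow> real) \<and> Ck_on k UNIV (cos :: real \<Rightarrow> real)"
proof (induction k)
  case 0
  show ?case by (simp add: continuous_on_sin continuous_on_cos)
next
  case (Suc k)
  have "Ck_on k UNIV (\<lambda>x::real. - sin x)"
    using bounded_bilinear.Ck_on_prod[OF bounded_bilinear_mult open_UNIV Ck_on_const[of _ _ "-1"], of k "sin::real\<Rightarrow>real"] Suc by simp
  with Suc show ?case
    by (auto simp del: Ck_on.simps intro!: Ck_on_Suc_real[where f' = cos] Ck_on_Suc_real[where f = cos and f' = "\<lambda>x. - sin x"]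
        derivative_eq_intros simp: has_real_derivative_iff_has_vector_derivative[symmetric])
qed

lemma smooth_on_sin [smooth_intros]:
  fixes f :: "_ \<Rightarrow> real"
  shows "open U \<Longrightarrow> smooth_on U f \<Longrightarrow> smooth_on U (\<lambda>x. sin (f x))"
  using smooth_on_compose[of U UNIV sin f] by (simp add: smooth_on_def Ck_on_sin_cos)

lemma smooth_on_cos [smooth_intros]:
  fixes f :: "_ \<Rightarrow> real"
  shows "open U \<Longrightarrow> smooth_on U f \<Longrightarrow> smooth_on U (\<lambda>x. cos (f x))"
  using smooth_on_compose[of U UNIV cos f] by (simp add: smooth_on_def Ck_on_sin_cos)

section \<open>A smooth bump function\<close>

text \<open>The powers of \<open>1 / t\<close> make the linear span of the family closed under
  differentiation, so smoothness of the classical \<open>exp (- (1 / t))\<close> follows by one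
  induction that treats all \<open>n\<close> at once.\<close>

definition flat :: "nat \<Rightarrow> real \<Rightarrow> real" where
  "flat n t = (if t > 0 then (1 / t) ^ n * exp (- (1 / t)) else 0)"

lemma flat_has_derivative:
  "(flat n has_real_derivative flat (n + 2) t - n * flat (n + 1) t) (at t)"
proof -
  consider "t > 0" | "t < 0" | "t = 0" by linarith
  then show ?thesis
  proof cases
    case 1
    have "((\<lambda>t. (1 / t) ^ n * exp (- (1 / t))) has_real_derivative flat (n + 2) t - n * flat (n + 1) t) (at t)"
      using 1
      by (cases n) (auto intro!: derivative_eq_intros simp: flat_def divide_simps power2_eq_square, auto simp: algebra_simps, metis One_nat_def mult.commute neq0_conv power_minus_mult)
    then show ?thesis
      by (rule has_field_derivative_transform_within_open[where S = "{0<..}"]) (use 1 in \<open>auto simp: flat_def\<close>)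
  next
    case 2
    have "((\<lambda>t. 0) has_real_derivative flat (n + 2) t - n * flat (n + 1) t) (at t)"
      using 2 by (simp add: flat_def)
    then show ?thesis
      by (rule has_field_derivative_transform_within_open[where S = "{..<0}"]) (use 2 in \<open>auto simp: flat_def\<close>)
  next
    case 3
    \<comment> \<open>At the origin the derivative is the limit of \<open>flat n h / h\<close>; from
      the right it vanishes because the exponential beats every power of
      \<open>1 / h\<close>.\<close>
    have "((\<lambda>h. flat n h / h) \<longlongrightarrow> 0) (at_right 0)"
    proof (rule Lim_transform_eventually)
      show "((\<lambda>h::real. (1 / h) ^ n * exp (- (1 / h)) / h) \<longlongrightarrow> 0) (at_right 0)"
        by real_asymp
      show "\<forall>\<^sub>F h in at_right 0. (1 / h) ^ n * exp (- (1 / h)) / h = flat n h / h"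
        using eventually_at_right_less[of "0::real"] by eventually_elim (simp add: flat_def)
    qed
    moreover have "((\<lambda>h. flat n h / h) \<longlongrightarrow> 0) (at_left 0)"
    proof (rule Lim_transform_eventually)
      show "\<forall>\<^sub>F h in at_left 0. 0 = flat n h / h"
        by (rule eventually_at_leftI[of "-1"]) (auto simp: flat_def)
    qed auto
    ultimately have "((\<lambda>h. flat n h / h) \<longlongrightarrow> 0) (at 0)"
      by (simp add: filterlim_split_at)
    then show ?thesis using 3 by (simp add: DERIV_def flat_def)
  qed
qed

lemma smooth_on_flat: "smooth_on UNIV (flat n)"
proof -
  have "Ck_on k UNIV (flat n)" for k
  proof (induction k arbitrary: n)
    case 0
    show ?case by (auto intro!: continuous_at_imp_continuous_on DERIV_isCont[OF flat_has_derivative])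
  next
    case (Suc k)
    have "Ck_on k UNIV (\<lambda>t. flat (n + 2) t + - real n * flat (n + 1) t)"
      by (intro Ck_on_add bounded_bilinear.Ck_on_prod[OF bounded_bilinear_mult] Ck_on_const Suc.IH) auto
    then show ?case
      by (intro Ck_on_Suc_real[where f' = "\<lambda>t. flat (n + 2) t + - real n * flat (n + 1) t"])
         (use flat_has_derivative[of n] in \<open>auto simp: has_real_derivative_iff_has_vector_derivative\<close>)
  qed
  then show ?thesis by (simp add: smooth_on_def)
qed

text \<open>The squared distance keeps the argument of \<open>flat 0\<close> polynomial, hence
  smooth also at the centre. The values are not normalised; sign, support and positivity at the
  centre are what is used later.\<close>

definition bump :: "'a::euclidean_space \<Rightarrow> real \<Rightarrow> 'a \<Rightarrow> real" where
  "bump c \<rho> p = flat 0 (\<rho>\<^sup>2 - (p - c) \<bullet> (p - c))"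

lemma smooth_on_bump: "open U \<Longrightarrow> smooth_on U (bump c \<rho>)"
  unfolding bump_def
  by (rule smooth_on_compose[OF _ smooth_on_flat]) (auto intro!: smooth_intros)

lemma bump_nonneg: "0 \<le> bump c \<rho> p"
  by (simp add: bump_def flat_def)

lemma bump_pos: "\<rho> > 0 \<Longrightarrow> 0 < bump c \<rho> c"
  by (simp add: bump_def flat_def)

lemma bump_eq_0: "\<rho> \<le> dist c p \<Longrightarrow> \<rho> > 0 \<Longrightarrow> bump c \<rho> p = 0"
  using power_mono[of \<rho> "norm (p - c)" 2]
  by (simp add: bump_def flat_def dist_norm norm_minus_commute[of c] power2_norm_eq_inner)

section \<open>Ordinary differential equations\<close>

lemma gronwall_real:
  fixes \<phi> \<phi>' :: "real \<Rightarrow> real"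
  assumes "continuous_on {0..T} \<phi>"
    and "\<And>t. 0 < t \<Longrightarrow> t < T \<Longrightarrow> (\<phi> has_real_derivative \<phi>' t) (at t)"
    and "\<And>t. 0 < t \<Longrightarrow> t < T \<Longrightarrow> \<phi>' t \<le> a * \<phi> t + b"
    and "a \<ge> 0" "b \<ge> 0" "t \<in> {0..T}"
  shows "\<phi> t \<le> (\<phi> 0 + b * t) * exp (a * t)"
proof -
  \<comment> \<open>The integrating factor gives
    \<open>\<psi>' \<le> b * (exp (- a * s) - 1) \<le> 0\<close>; subtracting \<open>b * s\<close>
    absorbs the inhomogeneity without a division by \<open>a\<close>.\<close>
  define \<psi> where "\<psi> s = \<phi> s * exp (- a * s) - b * s" for s
  have "\<psi> t \<le> \<psi> 0"
  proof (rule DERIV_nonpos_imp_decreasing_open[where f = \<psi> and a = 0 and b = t])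
    show "0 \<le> t" using assms by simp
    show "continuous_on {0..t} \<psi>"
      unfolding \<psi>_def using assms
      by (intro continuous_intros continuous_on_subset[OF assms(1)]) auto
    fix s assume s: "0 < s" "s < t"
    then have sT: "s < T" using assms by auto
    have "(\<psi> has_real_derivative ((\<phi>' s - a * \<phi> s) * exp (- a * s) - b)) (at s)"
      unfolding \<psi>_def by (auto intro!: derivative_eq_intros assms(2) s sT simp: algebra_simps)
    moreover have "(\<phi>' s - a * \<phi> s) * exp (- a * s) \<le> b * 1"
      using assms(3)[OF s(1) sT] assms(4,5) s by (intro mult_mono) auto
    ultimately show "\<exists>y. (\<psi> has_real_derivative y) (at s) \<and> y \<le> 0" by force
  qed
  then have "\<phi> t * exp (- a * t) \<le> \<phi> 0 + b * t" by (simp add: \<psi>_def)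
  then have "\<phi> t * exp (- a * t) * exp (a * t) \<le> (\<phi> 0 + b * t) * exp (a * t)"
    by (rule mult_right_mono) simp
  then show ?thesis by (simp add: mult.assoc flip: exp_add)
qed

lemma has_vector_derivative_continuous_on:
  "(\<And>t. t \<in> S \<Longrightarrow> (z has_vector_derivative z' t) (at t within S)) \<Longrightarrow> continuous_on S z"
  unfolding has_vector_derivative_def by (rule has_derivative_continuous_on)

text \<open>The squared norm is differentiable even where \<open>z\<close> vanishes. Splitting
  \<open>2 * norm (z s) * b\<close> into the sum of the two squares accounts for the extra 1 in the
  exponent.\<close>

lemma gronwall_norm:
  fixes z :: "real \<Rightarrow> 'a::real_inner"
  assumes z: "\<And>t. t \<in> {0..T} \<Longrightarrow> (z has_vector_derivative z' t) (at t within {0..T})"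
    and le: "\<And>t. t \<in> {0..T} \<Longrightarrow> norm (z' t) \<le> K * norm (z t) + b"
    and "K \<ge> 0" "b \<ge> 0" "t \<in> {0..T}"
  shows "(norm (z t))\<^sup>2 \<le> ((norm (z 0))\<^sup>2 + b\<^sup>2 * t) * exp ((2 * K + 1) * t)"
proof -
  have "z t \<bullet> z t \<le> (z 0 \<bullet> z 0 + b\<^sup>2 * t) * exp ((2 * K + 1) * t)"
  proof (rule gronwall_real[where T = T and \<phi>' = "\<lambda>t. 2 * (z t \<bullet> z' t)"])
    have "continuous_on {0..T} z"
      using z by (rule has_vector_derivative_continuous_on)
    then show "continuous_on {0..T} (\<lambda>t. z t \<bullet> z t)" by (intro continuous_intros)
    fix s assume s: "0 < s" "s < T"
    have "(z has_vector_derivative z' s) (at s)"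
      using z[of s] s at_within_interior[of s "{0..T}"] by auto
    then show "((\<lambda>t. z t \<bullet> z t) has_real_derivative 2 * (z s \<bullet> z' s)) (at s)"
      unfolding has_vector_derivative_def has_field_derivative_def
      by (auto intro!: derivative_eq_intros simp: inner_commute)
    have "z s \<bullet> z' s \<le> norm (z s) * norm (z' s)" by (rule norm_cauchy_schwarz)
    also have "\<dots> \<le> norm (z s) * (K * norm (z s) + b)" using le[of s] s by (intro mult_left_mono) auto
    finally have "2 * (z s \<bullet> z' s) \<le> 2 * K * (z s \<bullet> z s) + 2 * norm (z s) * b"
      by (simp add: algebra_simps power2_eq_square flip: power2_norm_eq_inner)
    also have "2 * norm (z s) * b \<le> z s \<bullet> z s + b\<^sup>2"
      using sum_squares_bound[of "norm (z s)" b] by (simp add: power2_norm_eq_inner)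
    finally show "2 * (z s \<bullet> z' s) \<le> (2 * K + 1) * (z s \<bullet> z s) + b\<^sup>2" by (simp add: algebra_simps)
  qed (use assms in auto)
  then show ?thesis by (simp add: power2_norm_eq_inner)
qed

text \<open>Picard's operator is a contraction in the supremum norm once the unknown is rescaled by
  \<open>exp (2 K t)\<close>, so no subdivision of the time interval is necessary.\<close>

lemma picard_global:
  fixes F :: "real \<Rightarrow> 'a::euclidean_space \<Rightarrow> 'a"
  assumes cont: "continuous_on ({0..T} \<times> UNIV) (\<lambda>(t, x). F t x)"
    and lip: "\<And>t x y. t \<in> {0..T} \<Longrightarrow> norm (F t x - F t y) \<le> K * norm (x - y)"
    and T: "T \<ge> 0"
  shows "\<exists>z. z 0 = z0 \<and> (\<forall>t\<in>{0..T}. (z has_vector_derivative F t (z t)) (at t within {0..T}))"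
proof -
  define k where "k = max K 1"
  have k: "k > 0" and lipk: "norm (F t x - F t y) \<le> k * norm (x - y)" if "t \<in> {0..T}" for t x y
    using lip[OF that, of x y] mult_right_mono[of K k "norm (x - y)"] by (auto simp: k_def)
  have k0: "k > 0" by (simp add: k_def)
  \<comment> \<open>Bounded continuous functions live on the whole real line, so time is clamped to
    \<open>{0..T}\<close>.\<close>
  define cl where "cl t = max 0 (min t T)" for t
  have cl: "cl t \<in> {0..T}" for t using T by (auto simp: cl_def)
  have ccl: "continuous_on UNIV cl" unfolding cl_def by (intro continuous_intros)
  \<comment> \<open>The fixed point \<open>g\<close> will be the solution divided by
    \<open>exp (2 * k * t)\<close>; \<open>H g\<close> is the velocity along the undivided
    curve.\<close>
  define H where "H g s = F s (exp (2 * k * s) *\<^sub>R g s)" for g s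
  define J where "J g t = exp (- (2 * k * t)) *\<^sub>R (z0 + integral {0..t} (H g))" for g t
  have cH: "continuous_on {0..T} (H g)" if "continuous_on {0..T} g" for g
    unfolding H_def
    by (rule continuous_on_compose2[OF cont, of _ "\<lambda>s. (s, exp (2 * k * s) *\<^sub>R g s)", simplified])
       (auto intro!: continuous_intros that)
  have cJ: "continuous_on {0..T} (J g)" if "continuous_on {0..T} g" for g
    unfolding J_def
    by (intro continuous_intros indefinite_integral_continuous_1 integrable_continuous_real cH that)
  have Jb: "(\<lambda>t. J g (cl t)) \<in> bcontfun" if "continuous_on {0..T} g" for g
  proof -
    have "bounded (J g ` {0..T})"
      by (intro compact_imp_bounded compact_continuous_image cJ that) simp
    moreover have "range (\<lambda>t. J g (cl t)) \<subseteq> J g ` {0..T}" using cl by auto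
    moreover have "continuous_on UNIV (\<lambda>t. J g (cl t))"
      by (rule continuous_on_compose2[OF cJ[OF that] ccl]) (use cl in auto)
    ultimately show ?thesis by (auto simp: bcontfun_def intro: bounded_subset)
  qed
  define \<Phi> where "\<Phi> g = Bcontfun (\<lambda>t. J (apply_bcontfun g) (cl t))" for g
  have \<Phi>: "apply_bcontfun (\<Phi> g) t = J (apply_bcontfun g) (cl t)" for g t
    unfolding \<Phi>_def by (subst Bcontfun_inverse) (auto intro: Jb)
  have "dist (\<Phi> g) (\<Phi> h) \<le> 1/2 * dist g h" for g h
  proof (rule dist_bound)
    fix t
    define d where "d = dist g h"
    define \<tau> where "\<tau> = cl t"
    have \<tau>: "\<tau> \<in> {0..T}" unfolding \<tau>_def by (rule cl)
    have ci: "H (apply_bcontfun g) integrable_on {0..\<tau>}" for g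
      by (intro integrable_continuous_real continuous_on_subset[OF cH]) (use \<tau> in auto)
    \<comment> \<open>The weight \<open>exp (- (2 * k * \<tau>))\<close> in \<open>J\<close> cancels
      the growth of this integral and leaves the contraction factor 1/2.\<close>
    have ex: "((\<lambda>s. k * exp (2 * k * s) * d) has_integral exp (2 * k * \<tau>) / 2 * d - exp (2 * k * 0) / 2 * d) {0..\<tau>}"
      by (rule fundamental_theorem_of_calculus)
         (use \<tau> k0 in \<open>auto intro!: derivative_eq_intros simp: has_real_derivative_iff_has_vector_derivative[symmetric]\<close>)
    have "norm (integral {0..\<tau>} (H g) - integral {0..\<tau>} (H h)) = norm (integral {0..\<tau>} (\<lambda>s. H g s - H h s))"
      by (simp add: integral_diff ci)
    also have "\<dots> \<le> integral {0..\<tau>} (\<lambda>s. k * exp (2 * k * s) * d)"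
    proof (rule integral_norm_bound_integral)
      show "(\<lambda>s. H g s - H h s) integrable_on {0..\<tau>}" by (intro integrable_diff ci)
      show "(\<lambda>s. k * exp (2 * k * s) * d) integrable_on {0..\<tau>}" using ex by blast
      fix s assume s: "s \<in> {0..\<tau>}"
      have "norm (H g s - H h s) \<le> k * norm (exp (2 * k * s) *\<^sub>R g s - exp (2 * k * s) *\<^sub>R h s)"
        unfolding H_def using s \<tau> by (intro lipk) auto
      also have "\<dots> = k * exp (2 * k * s) * dist (g s) (h s)"
        by (simp add: dist_norm flip: scaleR_diff_right)
      also have "\<dots> \<le> k * exp (2 * k * s) * d"
        unfolding d_def using k0 by (intro mult_left_mono dist_bounded) auto
      finally show "norm (H g s - H h s) \<le> k * exp (2 * k * s) * d" .
    qed
    also have "\<dots> \<le> exp (2 * k * \<tau>) / 2 * d"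
      using integral_unique[OF ex] by (simp add: d_def)
    finally have "exp (- (2 * k * \<tau>)) * norm (integral {0..\<tau>} (H g) - integral {0..\<tau>} (H h))
       \<le> exp (- (2 * k * \<tau>)) * (exp (2 * k * \<tau>) / 2 * d)" by (intro mult_left_mono) auto
    also have "\<dots> = 1/2 * d" by (simp flip: exp_add)
    finally show "dist (apply_bcontfun (\<Phi> g) t) (apply_bcontfun (\<Phi> h) t) \<le> 1/2 * dist g h"
      unfolding \<Phi> J_def d_def \<tau>_def[symmetric]
      by (simp add: dist_norm flip: scaleR_diff_right)
  qed
  then obtain g where g: "\<Phi> g = g"
    using banach_fix_type[of "1/2" \<Phi>] by auto
  define z where "z t = z0 + integral {0..t} (H g)" for t
  have z: "exp (2 * k * t) *\<^sub>R g t = z t" if "t \<in> {0..T}" for t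
  proof -
    have "g t = J g t" using \<Phi>[of g t] that by (simp add: g cl_def)
    then show ?thesis by (simp add: J_def z_def flip: exp_add)
  qed
  have "(z has_vector_derivative F t (z t)) (at t within {0..T})" if t: "t \<in> {0..T}" for t
  proof -
    have "((\<lambda>t. z0 + integral {0..t} (H g)) has_vector_derivative 0 + H g t) (at t within {0..T})"
      by (intro has_vector_derivative_add has_vector_derivative_const integral_has_vector_derivative cH t) auto
    then show ?thesis using z[OF t] by (simp add: z_def[abs_def] H_def)
  qed
  moreover have "z 0 = z0" by (simp add: z_def)
  ultimately show ?thesis by blast
qed

text \<open>Compactness makes the radius, the Lipschitz constant and the linearization error
  independent of the base point \<open>q\<close>. For the cycle, \<open>q\<close> runs through the
  pairs of velocity and position, so the estimates become uniform in time.\<close>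

lemma C1_uniform:
  fixes f :: "'a::euclidean_space \<Rightarrow> 'b::real_normed_vector"
  assumes f: "Ck_on 1 \<Omega> f" and "open \<Omega>" "compact C" "C \<subseteq> \<Omega>" "C \<noteq> {}"
  obtains \<rho> K where "\<rho> > 0" "K \<ge> 0" "\<And>q z. q \<in> C \<Longrightarrow> norm z \<le> \<rho> \<Longrightarrow> q + z \<in> \<Omega>"
    and "\<And>q z z'. q \<in> C \<Longrightarrow> norm z \<le> \<rho> \<Longrightarrow> norm z' \<le> \<rho> \<Longrightarrow>
           norm (f (q + z) - f (q + z')) \<le> K * norm (z - z')"
    and "\<And>q z. q \<in> C \<Longrightarrow> norm (frechet_derivative f (at q) z) \<le> K * norm z"
    and "\<And>\<omega>. \<omega> > 0 \<Longrightarrow> \<exists>r>0. \<forall>q\<in>C. \<forall>z. norm z \<le> r \<longrightarrow>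
           norm (f (q + z) - f q - frechet_derivative f (at q) z) \<le> \<omega> * norm z"
proof -
  define D where "D x = frechet_derivative f (at x)" for x
  have diff: "(f has_derivative D x) (at x)" if "x \<in> \<Omega>" for x
    using f that unfolding D_def by (intro has_derivative_frechet) auto
  have lin: "linear (D x)" if "x \<in> \<Omega>" for x
    using diff[OF that] has_derivative_linear by blast
  have cont: "continuous_on \<Omega> (\<lambda>x. D x b)" for b
    using f by (simp add: D_def)
  obtain \<rho> where \<rho>: "\<rho> > 0" and sub: "(\<Union>q\<in>C. cball q \<rho>) \<subseteq> \<Omega>"
    using compact_subset_open_imp_cball_epsilon_subset[OF \<open>compact C\<close> \<open>open \<Omega>\<close> \<open>C \<subseteq> \<Omega>\<close>] by blast
  \<comment> \<open>The closed neighbourhood of radius \<rho>, written as a sum of two compact sets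
    so that its compactness is immediate.\<close>
  define C' where "C' = {q + z |q z. q \<in> C \<and> z \<in> cball 0 \<rho>}"
  have C'\<Omega>: "C' \<subseteq> \<Omega>"
  proof
    fix x assume "x \<in> C'"
    then obtain q z where "x = q + z" "q \<in> C" "norm z \<le> \<rho>" by (auto simp: C'_def)
    then have "x \<in> cball q \<rho>" by (simp add: dist_norm)
    then show "x \<in> \<Omega>" using sub \<open>q \<in> C\<close> by blast
  qed
  have "compact C'" unfolding C'_def by (intro compact_sums \<open>compact C\<close> compact_cball)
  have CC': "C \<subseteq> C'" using \<rho> by (force simp: C'_def)
  have bound: "norm ((D x - D y) w) \<le> (\<Sum>b\<in>Basis. norm (D x b - D y b)) * norm w"
    if "x \<in> \<Omega>" "y \<in> \<Omega>" for x y w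
  proof -
    have "linear (D x - D y)" using lin that by (simp add: linear_compose_sub fun_diff_def)
    from norm_linear_le_sum_Basis[OF this] show ?thesis by simp
  qed
  note bound0 = norm_linear_le_sum_Basis[OF lin]
  have "continuous_on C' (\<lambda>x. \<Sum>b\<in>Basis. norm (D x b))"
    by (intro continuous_intros continuous_on_subset[OF cont C'\<Omega>])
  then have "bounded ((\<lambda>x. \<Sum>b\<in>Basis. norm (D x b)) ` C')"
    by (intro compact_imp_bounded compact_continuous_image \<open>compact C'\<close>)
  then obtain K where "\<forall>x\<in>(\<lambda>x. \<Sum>b\<in>Basis. norm (D x b)) ` C'. \<bar>x\<bar> \<le> K"
    unfolding bounded_real by blast
  then have K: "(\<Sum>b\<in>Basis. norm (D x b)) \<le> K" if "x \<in> C'" for x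
    using that abs_le_D1 by blast
  have DK: "norm (D x w) \<le> K * norm w" if "x \<in> C'" for x w
    using bound0[of x w] K[OF that] C'\<Omega> that mult_right_mono[OF K[OF that], of "norm w"] by auto
  obtain q0 where "q0 \<in> C" using \<open>C \<noteq> {}\<close> by blast
  then have "K \<ge> 0" using K[of q0] CC' by (meson order_trans sum_nonneg norm_ge_zero subsetD)
  have cb: "cball q \<rho> \<subseteq> C'" if "q \<in> C" for q
  proof
    fix x assume "x \<in> cball q \<rho>"
    then show "x \<in> C'" using that unfolding C'_def
      by (intro CollectI exI[of _ q] exI[of _ "x - q"]) (auto simp: dist_norm norm_minus_commute)
  qed
  have lip: "norm (f (q + z) - f (q + z')) \<le> K * norm (z - z')"
    if "q \<in> C" "norm z \<le> \<rho>" "norm z' \<le> \<rho>" for q z z'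
  proof -
    have "norm (f (q + z) - f (q + z')) \<le> K * norm ((q + z) - (q + z'))"
    proof (rule differentiable_bound[where f' = D])
      show "convex (cball q \<rho>)" by simp
      fix x assume "x \<in> cball q \<rho>"
      then have "x \<in> C'" using cb that by blast
      then show "(f has_derivative D x) (at x within cball q \<rho>)"
        using diff C'\<Omega> has_derivative_at_withinI by blast
      show "onorm (D x) \<le> K"
        by (rule onorm_le) (rule DK[OF \<open>x \<in> C'\<close>])
    qed (use that in \<open>auto simp: dist_norm\<close>)
    then show ?thesis by simp
  qed
  have unif: "\<exists>r>0. \<forall>q\<in>C. \<forall>z. norm z \<le> r \<longrightarrow> norm (f (q + z) - f q - D q z) \<le> \<omega> * norm z"
    if "\<omega> > 0" for \<omega>
  proof -
    \<comment> \<open>\<open>M\<close> dominates the operator norm of \<open>D x - D y\<close> and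
      vanishes on the diagonal, so its uniform continuity provides a uniform modulus of continuity
      for the derivative.\<close>
    define M where "M = (\<lambda>(x, y). \<Sum>b\<in>Basis. norm (D x b - D y b))"
    have c1: "continuous_on (C' \<times> C') (\<lambda>p. D (fst p) b)" "continuous_on (C' \<times> C') (\<lambda>p. D (snd p) b)" for b
      by (intro continuous_on_compose2[OF cont] continuous_intros, use C'\<Omega> in force)+
    have "continuous_on (C' \<times> C') M"
      unfolding M_def case_prod_unfold by (intro continuous_intros c1)
    then have "uniformly_continuous_on (C' \<times> C') M"
      by (intro compact_uniformly_continuous compact_Times \<open>compact C'\<close>)
    then obtain \<delta> where \<delta>: "\<delta> > 0"
      "\<And>p p'. p \<in> C' \<times> C' \<Longrightarrow> p' \<in> C' \<times> C' \<Longrightarrow> dist p' p < \<delta> \<Longrightarrow> dist (M p') (M p) < \<omega>"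
      unfolding uniformly_continuous_on_def using \<open>\<omega> > 0\<close> by metis
    define r where "r = min \<rho> (\<delta> / 2)"
    show ?thesis
    proof (intro exI[of _ r] conjI ballI allI impI)
      show "r > 0" using \<rho> \<delta> by (simp add: r_def)
      fix q z :: 'a assume q: "q \<in> C" and z: "norm z \<le> r"
      have inC': "x \<in> C'" if "x \<in> cball q r" for x
        using cb[OF q] that by (auto simp: r_def)
      have "norm (f (q + z) - f q - D q ((q + z) - q)) \<le> norm ((q + z) - q) * \<omega>"
      proof (rule differentiable_bound_linearization[where S = "cball q r" and f' = D])
        show "q + t *\<^sub>R (q + z - q) \<in> cball q r" if "t \<in> {0..1}" for t
          using that z mult_left_le_one_le[of "norm z" t] by (auto simp: dist_norm)
        show "q \<in> cball q r" using \<open>r > 0\<close> by simp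
        fix x assume x: "x \<in> cball q r"
        show "(f has_derivative D x) (at x within cball q r)"
          using diff inC'[OF x] C'\<Omega> has_derivative_at_withinI by blast
        have "dist (M (x, q)) (M (q, q)) < \<omega>"
          by (rule \<delta>(2)) (use x q CC' inC' \<open>\<delta> > 0\<close> in \<open>auto simp: dist_Pair_Pair r_def dist_commute\<close>)
        then have "M (x, q) \<le> \<omega>" by (simp add: M_def dist_real_def)
        then have "norm ((D x - D q) w) \<le> \<omega> * norm w" for w
        proof -
          have "x \<in> \<Omega>" "q \<in> \<Omega>" using inC'[OF x] C'\<Omega> q CC' by auto
          from bound[OF this, of w] \<open>M (x, q) \<le> \<omega>\<close> show ?thesis
            using mult_right_mono[of "M (x, q)" \<omega> "norm w"] by (simp add: M_def)
        qed
        then show "onorm (D x - D q) \<le> \<omega>"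
          by (rule onorm_le)
      qed
      then show "norm (f (q + z) - f q - D q z) \<le> \<omega> * norm z" by (simp add: mult.commute)
    qed
  qed
  show ?thesis
  proof (rule that[OF \<rho> \<open>K \<ge> 0\<close>])
    show "q + z \<in> \<Omega>" if "q \<in> C" "norm z \<le> \<rho>" for q z
      using cb[OF that(1)] C'\<Omega> that by (force simp: dist_norm)
    show "norm (frechet_derivative f (at q) z) \<le> K * norm z" if "q \<in> C" for q z
      using DK CC' that unfolding D_def by blast
  qed (use lip unif in \<open>auto simp: D_def\<close>)
qed

text \<open>The difference \<open>z - y\<close> solves the linear equation up to the linearization
  error along \<open>z\<close>. The a priori bound with \<open>C\<close> makes this error small
  relative to \<open>norm (z 0)\<close>, and Gronwall finishes. The radius \<open>r\<close> is
  chosen before the two solutions.\<close>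

lemma solution_linearization:
  fixes F A :: "real \<Rightarrow> 'a::euclidean_space \<Rightarrow> 'a"
  assumes lin: "\<And>\<omega>. \<omega> > 0 \<Longrightarrow> \<exists>r>0. \<forall>t\<in>{0..T}. \<forall>x. norm x \<le> r \<longrightarrow> norm (F t x - A t x) \<le> \<omega> * norm x"
    and A: "\<And>t. t \<in> {0..T} \<Longrightarrow> linear (A t)" "\<And>t x. t \<in> {0..T} \<Longrightarrow> norm (A t x) \<le> K * norm x"
    and "K \<ge> 0" "T \<ge> 0" "C > 0" "\<omega> > 0"
  obtains r where "r > 0"
    "\<And>z y. \<lbrakk>\<And>t. t \<in> {0..T} \<Longrightarrow> (z has_vector_derivative F t (z t)) (at t within {0..T});
       \<And>t. t \<in> {0..T} \<Longrightarrow> norm (z t) \<le> C * norm (z 0);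
       \<And>t. t \<in> {0..T} \<Longrightarrow> (y has_vector_derivative A t (y t)) (at t within {0..T});
       y 0 = z 0; norm (z 0) \<le> r\<rbrakk> \<Longrightarrow> norm (z T - y T) \<le> \<omega> * norm (z 0)"
proof -
  define E where "E = exp ((2 * K + 1) * T)"
  \<comment> \<open>Chosen so that the Gronwall bound \<open>b * sqrt (T * E + 1)\<close> becomes
    \<open>\<omega> * norm (z 0)\<close>; the added 1 keeps the divisor positive when
    \<open>T = 0\<close>.\<close>
  define w where "w = \<omega> / (C * sqrt (T * E + 1))"
  have E: "E > 0" by (simp add: E_def)
  then have TE: "T * E \<ge> 0" using \<open>T \<ge> 0\<close> by simp
  have w: "w > 0" using TE assms by (simp add: w_def add_nonneg_pos)
  obtain r where r: "r > 0" "\<And>t x. t \<in> {0..T} \<Longrightarrow> norm x \<le> r \<Longrightarrow> norm (F t x - A t x) \<le> w * norm x"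
    using lin[OF w] by blast
  show ?thesis
  proof (rule that[of "r / C"])
    show "r / C > 0" using r assms by simp
    fix z y
    assume z: "\<And>t. t \<in> {0..T} \<Longrightarrow> (z has_vector_derivative F t (z t)) (at t within {0..T})"
      and zC: "\<And>t. t \<in> {0..T} \<Longrightarrow> norm (z t) \<le> C * norm (z 0)"
      and y: "\<And>t. t \<in> {0..T} \<Longrightarrow> (y has_vector_derivative A t (y t)) (at t within {0..T})"
      and "y 0 = z 0" and u: "norm (z 0) \<le> r / C"
    define b where "b = w * (C * norm (z 0))"
    have b: "b \<ge> 0" using w assms by (simp add: b_def)
    have "(norm (z T - y T))\<^sup>2 \<le> ((norm (z 0 - y 0))\<^sup>2 + b\<^sup>2 * T) * exp ((2 * K + 1) * T)"
    proof (rule gronwall_norm[where T = T and z' = "\<lambda>t. F t (z t) - A t (y t)" and t = T])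
      fix t assume t: "t \<in> {0..T}"
      show "((\<lambda>t. z t - y t) has_vector_derivative F t (z t) - A t (y t)) (at t within {0..T})"
        by (intro has_vector_derivative_diff z y t)
      have "norm (z t) \<le> r"
        using zC[OF t] u \<open>C > 0\<close> by (simp add: field_simps)
      then have "norm (F t (z t) - A t (z t)) \<le> w * norm (z t)" by (rule r(2)[OF t])
      also have "\<dots> \<le> b" unfolding b_def using w zC[OF t] by (intro mult_left_mono) auto
      finally have "norm (F t (z t) - A t (z t)) \<le> b" .
      moreover have "norm (F t (z t) - A t (y t)) \<le> norm (F t (z t) - A t (z t)) + norm (A t (z t - y t))"
      proof -
        have "F t (z t) - A t (y t) = (F t (z t) - A t (z t)) + A t (z t - y t)"
          using A(1)[OF t] by (simp add: linear_diff)
        then show ?thesis by (metis norm_triangle_ineq)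
      qed
      ultimately show "norm (F t (z t) - A t (y t)) \<le> K * norm (z t - y t) + b"
        using A(2)[OF t, of "z t - y t"] by linarith
    qed (use assms b in auto)
    also have "\<dots> = b\<^sup>2 * (T * E)" using \<open>y 0 = z 0\<close> by (simp add: E_def)
    also have "\<dots> \<le> b\<^sup>2 * (T * E + 1)" by (intro mult_left_mono) auto
    also have "\<dots> = (b * sqrt (T * E + 1))\<^sup>2" using TE by (simp add: power_mult_distrib)
    finally have "norm (z T - y T) \<le> b * sqrt (T * E + 1)"
      by (rule power2_le_imp_le) (simp add: b TE)
    also have "\<dots> = \<omega> * norm (z 0)"
    proof -
      have "sqrt (T * E + 1) > 0" using TE by (simp add: add_nonneg_pos)
      then show ?thesis using \<open>C > 0\<close> by (simp add: b_def w_def)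
    qed
    finally show "norm (z T - y T) \<le> \<omega> * norm (z 0)" .
  qed
qed

section \<open>First return maps\<close>

lemma orthonormal_expand3:
  fixes e1 e2 e3 x :: "real ^ 3"
  assumes "norm e1 = 1" "norm e2 = 1" "norm e3 = 1" "e1 \<bullet> e2 = 0" "e1 \<bullet> e3 = 0" "e2 \<bullet> e3 = 0"
  shows "x = (e1 \<bullet> x) *\<^sub>R e1 + (e2 \<bullet> x) *\<^sub>R e2 + (e3 \<bullet> x) *\<^sub>R e3"
proof -
  have n: "e1 \<bullet> e1 = 1" "e2 \<bullet> e2 = 1" "e3 \<bullet> e3 = 1"
    using assms by (auto simp: norm_eq_1)
  have ne: "e1 \<noteq> e2" "e1 \<noteq> e3" "e2 \<noteq> e3" using n assms by auto
  let ?B = "{e1, e2, e3}"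
  have "independent ?B"
  proof (rule pairwise_orthogonal_independent)
    show "pairwise orthogonal ?B"
      using assms by (auto simp: pairwise_def orthogonal_def inner_commute)
    show "0 \<notin> ?B" using assms by auto
  qed
  then have "UNIV \<subseteq> span ?B"
    by (intro card_ge_dim_independent) (use ne in auto)
  define w where "w = x - ((e1 \<bullet> x) *\<^sub>R e1 + (e2 \<bullet> x) *\<^sub>R e2 + (e3 \<bullet> x) *\<^sub>R e3)"
  have "orthogonal w b" if "b \<in> ?B" for b
    using that assms n by (auto simp: w_def orthogonal_def inner_simps inner_commute)
  moreover have "w \<in> span ?B" using \<open>UNIV \<subseteq> span ?B\<close> by blast
  ultimately have "orthogonal w w" by (meson orthogonal_to_span)
  then show ?thesis by (simp add: w_def orthogonal_def)
qed

text \<open>The velocity field is given in coordinates moving with the closed orbit: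
  \<open>F t z\<close> is the velocity at time \<open>t\<close> at the point \<open>\<gamma> t + z\<close>.\<close>

lemma return_map_derivative:
  fixes \<gamma> :: "real \<Rightarrow> real ^ 3" and F A :: "real \<Rightarrow> real ^ 3 \<Rightarrow> real ^ 3"
    and e1 e2 e3 :: "real ^ 3" and y2 y3 :: "real \<Rightarrow> real ^ 3"
  assumes pr_def: "pr = (\<lambda>x. vector [e2 \<bullet> x, e3 \<bullet> x] :: real ^ 2)"
    and \<sigma>_def: "\<sigma> = (\<lambda>u :: real ^ 2. \<gamma> 0 + (u $ 1 *\<^sub>R e2 + u $ 2 *\<^sub>R e3))"
    and L: "L > 0" "\<gamma> L = \<gamma> 0" "inj_on \<gamma> {0..<L}"
    and \<gamma>: "\<And>t. (\<gamma> has_vector_derivative F t 0) (at t)"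
    and e1: "F 0 0 = e1" "F L 0 = e1"
    and on: "norm e1 = 1" "norm e2 = 1" "norm e3 = 1" "e1 \<bullet> e2 = 0" "e1 \<bullet> e3 = 0" "e2 \<bullet> e3 = 0"
    and \<rho>: "\<rho> > 0" and K: "K \<ge> 0"
    and cont: "continuous_on ({0..L + 1} \<times> cball 0 \<rho>) (\<lambda>(t, z). F t z)"
    and lip: "\<And>t z z'. \<lbrakk>t \<in> {0..L + 1}; norm z \<le> \<rho>; norm z' \<le> \<rho>\<rbrakk> \<Longrightarrow>
          norm (F t z - F t z') \<le> K * norm (z - z')"
    and lin: "\<And>\<omega>. \<omega> > 0 \<Longrightarrow> \<exists>r>0. \<forall>t\<in>{0..L}. \<forall>x. norm x \<le> r \<longrightarrow>
          norm (F t x - F t 0 - A t x) \<le> \<omega> * norm x"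
    and A: "\<And>t. t \<in> {0..L} \<Longrightarrow> linear (A t)" "\<And>t x. t \<in> {0..L} \<Longrightarrow> norm (A t x) \<le> K * norm x"
    and y: "\<And>t. t \<in> {0..L} \<Longrightarrow> (y2 has_vector_derivative A t (y2 t)) (at t within {0..L})"
      "\<And>t. t \<in> {0..L} \<Longrightarrow> (y3 has_vector_derivative A t (y3 t)) (at t within {0..L})"
      "y2 0 = e2" "y3 0 = e3"
  obtains R V P where "R > 0" "open V" "0 \<in> V" "V \<subseteq> ball 0 R"
    "\<forall>t\<in>{0<..<L}. \<gamma> t \<notin> \<sigma> ` ball 0 R"
    "\<forall>u\<in>V. P u \<in> ball 0 R \<and> (\<exists>c T. 0 < T \<and> T \<le> L + 1 \<and> c 0 = \<sigma> u \<and> c T = \<sigma> (P u) \<and>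
        (\<forall>t\<in>{0<..<T}. c t \<notin> \<sigma> ` ball 0 R) \<and> F 0 (c 0 - \<gamma> 0) \<bullet> e1 > 0 \<and>
        (\<forall>t\<in>{0..T}. norm (c t - \<gamma> t) \<le> \<rho> \<and>
           (c has_vector_derivative F t (c t - \<gamma> t)) (at t within {0..T})))"
    "(P has_derivative (\<lambda>u. pr (u $ 1 *\<^sub>R y2 L + u $ 2 *\<^sub>R y3 L))) (at 0)"
proof -
  have n: "e1 \<bullet> e1 = 1" "e2 \<bullet> e2 = 1" "e3 \<bullet> e3 = 1"
    using on by (auto simp: norm_eq_1)
  define s where "s u = u $ 1 *\<^sub>R e2 + u $ 2 *\<^sub>R e3" for u :: "real ^ 2"
  have \<sigma>s: "\<sigma> u = \<gamma> 0 + s u" for u by (simp add: \<sigma>_def s_def)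
  have ns: "norm (s u) = norm u" for u
  proof -
    have "s u \<bullet> s u = u $ 1 * u $ 1 + u $ 2 * u $ 2"
      by (simp add: s_def inner_simps n on inner_commute)
    moreover have "u \<bullet> u = u $ 1 * u $ 1 + u $ 2 * u $ 2" by (simp add: inner_vec_def sum_2)
    ultimately show ?thesis by (simp add: norm_eq_sqrt_inner)
  qed
  have e1s: "e1 \<bullet> s u = 0" for u using on by (simp add: s_def inner_simps)
  have s_pr: "s (pr x) = x - (e1 \<bullet> x) *\<^sub>R e1" for x
    using orthonormal_expand3[OF on, of x] by (simp add: s_def pr_def algebra_simps)
  have pr_lin: "pr (x + y) = pr x + pr y" "pr (c *\<^sub>R x) = c *\<^sub>R pr x" "pr (x - y) = pr x - pr y" for x y c
    by (auto simp: pr_def vec_eq_iff forall_2 inner_simps)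
  have "bounded_linear pr" by (rule linear_conv_bounded_linear[THEN iffD1]) (auto intro: linearI pr_lin)
  have pr_e1: "pr e1 = 0" using on by (simp add: pr_def vec_eq_iff forall_2 inner_commute)
  have npr: "norm (pr x) \<le> norm x" for x
  proof -
    have "(norm (pr x))\<^sup>2 = (norm (s (pr x)))\<^sup>2" by (simp add: ns)
    also have "\<dots> = x \<bullet> x - (e1 \<bullet> x)\<^sup>2"
      unfolding s_pr power2_norm_eq_inner by (simp add: inner_simps n power2_eq_square inner_commute)
    also have "\<dots> \<le> (norm x)\<^sup>2" by (simp add: power2_norm_eq_inner)
    finally show ?thesis by (rule power2_le_imp_le) simp
  qed
  have c\<gamma>: "continuous_on X \<gamma>" for X
    by (rule has_vector_derivative_continuous_on) (rule has_vector_derivative_at_within[OF \<gamma>])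
  have cF0: "continuous_on {0..L + 1} (\<lambda>t. F t 0)"
  proof -
    have "continuous_on {0..L + 1} (\<lambda>t. (\<lambda>(t, z). F t z) (t, 0))"
      by (rule continuous_on_compose2[OF cont]) (use \<rho> in \<open>auto intro!: continuous_intros\<close>)
    then show ?thesis by simp
  qed

  \<comment> \<open>Composing with the nearest-point projection extends the field to a globally
    Lipschitz one, as global existence requires; solutions that stay in the ball solve the original
    equation.\<close>
  define cp where "cp = closest_point (cball (0::real^3) \<rho>)"
  have cp: "norm (cp z) \<le> \<rho>" and cp_lip: "norm (cp z - cp z') \<le> norm (z - z')" for z z'
    using closest_point_in_set[of "cball 0 \<rho>" z] closest_point_lipschitz[of "cball 0 \<rho>" z z'] \<rho>
    by (auto simp: cp_def dist_norm)
  have cp_id: "cp z = z" if "norm z \<le> \<rho>" for z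
    unfolding cp_def using that by (intro closest_point_self) simp
  \<comment> \<open>Growth factor up to time \<open>L + 1\<close>; the extra unit leaves room for
    returns later than the period.\<close>
  define C where "C = exp ((2 * K + 1) * (L + 1))"
  have C: "C \<ge> 1" using K L by (simp add: C_def)
  \<comment> \<open>The unknown is the deviation from \<gamma>. Zero is then a solution, and small
    initial deviations stay small.\<close>
  have "\<exists>z. z 0 = s u \<and> (\<forall>t\<in>{0..L + 1}. (z has_vector_derivative F t (cp (z t)) - F t 0) (at t within {0..L + 1}))" for u
  proof (rule picard_global)
    have ccp: "continuous_on UNIV cp"
      unfolding cp_def using \<rho> by (intro continuous_on_closest_point) auto
    have "continuous_on ({0..L + 1} \<times> UNIV) (\<lambda>p. (\<lambda>(t, z). F t z) (fst p, cp (snd p)))"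
      by (rule continuous_on_compose2[OF cont])
         (auto intro!: continuous_intros continuous_on_compose2[OF ccp] simp: cp)
    moreover have "continuous_on ({0..L + 1} \<times> UNIV) (\<lambda>p. F (fst p) 0)"
      by (rule continuous_on_compose2[OF cF0]) (auto intro!: continuous_intros)
    ultimately show "continuous_on ({0..L + 1} \<times> UNIV) (\<lambda>(t, z). F t (cp z) - F t 0)"
      unfolding case_prod_unfold by (auto intro!: continuous_intros)
    show "norm (F t (cp x) - F t 0 - (F t (cp y) - F t 0)) \<le> K * norm (x - y)" if "t \<in> {0..L + 1}" for t x y
      using lip[OF that cp cp, of x y] mult_left_mono[OF cp_lip[of x y] K] by simp
  qed (use L in auto)
  then obtain Z where Z0: "\<And>u. Z u 0 = s u"
    and Zd: "\<And>u t. t \<in> {0..L + 1} \<Longrightarrow> (Z u has_vector_derivative F t (cp (Z u t)) - F t 0) (at t within {0..L + 1})"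
    by metis
  have ZC: "norm (Z u t) \<le> C * norm u" if t: "t \<in> {0..L + 1}" for u t
  proof -
    have "(norm (Z u t))\<^sup>2 \<le> ((norm (Z u 0))\<^sup>2 + 0\<^sup>2 * t) * exp ((2 * K + 1) * t)"
    proof (rule gronwall_norm[OF Zd _ K _ t])
      fix t assume t: "t \<in> {0..L + 1}"
      have "norm (F t (cp (Z u t)) - F t (cp 0)) \<le> K * norm (cp (Z u t) - cp 0)" by (intro lip t cp)
      also have "\<dots> \<le> K * norm (Z u t - 0)" by (intro mult_left_mono cp_lip K)
      finally show "norm (F t (cp (Z u t)) - F t 0) \<le> K * norm (Z u t) + 0" using cp_id[of 0] \<rho> by simp
    qed auto
    also have "\<dots> \<le> (norm u)\<^sup>2 * C"
      using t K by (auto simp: Z0 ns C_def intro!: mult_left_mono)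
    \<comment> \<open>Gronwall bounds the square by a multiple with factor \<open>C\<close>; since
      \<open>C \<ge> 1\<close>, passing to the square of \<open>C\<close> permits taking
      roots.\<close>
    also have "\<dots> \<le> (norm u)\<^sup>2 * C\<^sup>2"
      using C by (intro mult_left_mono) (auto simp: power2_eq_square)
    also have "\<dots> = (C * norm u)\<^sup>2" by (simp add: power_mult_distrib)
    finally show ?thesis by (rule power2_le_imp_le) (use C in simp)
  qed
  define c where "c u t = \<gamma> t + Z u t" for u t
  have cd: "(c u has_vector_derivative F t (Z u t)) (at t within {0..L + 1})" "norm (Z u t) \<le> \<rho>"
    if t: "t \<in> {0..L + 1}" and u: "C * norm u \<le> \<rho>" for u t
  proof -
    show Z: "norm (Z u t) \<le> \<rho>" using ZC[OF t, of u] u by simp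
    have "(c u has_vector_derivative F t 0 + (F t (cp (Z u t)) - F t 0)) (at t within {0..L + 1})"
      unfolding c_def[abs_def] by (intro has_vector_derivative_add has_vector_derivative_at_within[OF \<gamma>] Zd t)
    then show "(c u has_vector_derivative F t (Z u t)) (at t within {0..L + 1})" by (simp add: cp_id[OF Z])
  qed

  \<comment> \<open>Used twice: with 1/2 to make orbits cross the section transversally, and with
    arbitrarily small \<omega> to show that a change of the return time moves the return point along
    \<open>e1\<close> up to higher order.\<close>
  have near: "\<exists>\<delta>>0. \<delta> \<le> 1 \<and> \<delta> < L / 2 \<and> \<delta> \<le> \<rho> \<and>
      (\<forall>t z. t \<in> {0..L + 1} \<longrightarrow> norm z \<le> \<delta> \<longrightarrow> t \<le> \<delta> \<or> \<bar>t - L\<bar> \<le> \<delta> \<longrightarrow> norm (F t z - e1) \<le> \<omega>)"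
    if "\<omega> > 0" for \<omega>
  proof -
    have ex: "\<exists>d>0. \<forall>t z. t \<in> {0..L + 1} \<longrightarrow> norm z \<le> \<rho> \<longrightarrow> dist (t, z) (t0, 0) < d \<longrightarrow> norm (F t z - e1) < \<omega>"
      if "t0 \<in> {0, L}" for t0
    proof -
      have "(t0, 0) \<in> {0..L + 1} \<times> cball (0::real^3) \<rho>" using that L \<rho> by auto
      then obtain d where "d > 0" "\<And>p. p \<in> {0..L + 1} \<times> cball 0 \<rho> \<Longrightarrow> dist p (t0, 0) < d \<Longrightarrow>
          dist (case p of (t, z) \<Rightarrow> F t z) (case (t0, 0) of (t, z) \<Rightarrow> F t z) < \<omega>"
        using cont \<open>\<omega> > 0\<close> unfolding continuous_on_iff by blast
      then have "dist (F t z) e1 < \<omega>" if "t \<in> {0..L + 1}" "norm z \<le> \<rho>" "dist (t, z) (t0, 0) < d" for t z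
      proof -
        have "dist (case (t, z) of (t, z) \<Rightarrow> F t z) (case (t0, 0) of (t, z) \<Rightarrow> F t z) < \<omega>"
          by (rule \<open>\<And>p. _ \<Longrightarrow> dist p (t0, 0) < d \<Longrightarrow> _\<close>) (use that in auto)
        then show ?thesis using e1 \<open>t0 \<in> {0, L}\<close> by auto
      qed
      then show ?thesis using \<open>d > 0\<close> unfolding dist_norm[of _ e1] by blast
    qed
    obtain d0 where d0: "d0 > 0" 
      "\<And>t z. t \<in> {0..L + 1} \<Longrightarrow> norm z \<le> \<rho> \<Longrightarrow> dist (t, z) (0, 0) < d0 \<Longrightarrow> norm (F t z - e1) < \<omega>"
      using ex[of 0] by blast
    obtain dL where dL: "dL > 0"
      "\<And>t z. t \<in> {0..L + 1} \<Longrightarrow> norm z \<le> \<rho> \<Longrightarrow> dist (t, z) (L, 0) < dL \<Longrightarrow> norm (F t z - e1) < \<omega>"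
      using ex[of L] by blast
    note d = d0(1) dL(1) d0(2) dL(2)
    \<comment> \<open>Quarters, because the distance in the product is at most the sum of the two
      components, each of which is at most \<delta>.\<close>
    define \<delta> where "\<delta> = Min {1, L / 4, \<rho>, d0 / 4, dL / 4}"
    have \<delta>: "\<delta> > 0" "\<delta> \<le> 1" "\<delta> \<le> L / 4" "\<delta> \<le> \<rho>" "\<delta> \<le> d0 / 4" "\<delta> \<le> dL / 4"
      using L \<rho> d by (auto simp: \<delta>_def)
    have ds: "dist (t, z) (t0, 0) \<le> \<bar>t - t0\<bar> + norm z" for t t0 and z :: "real^3"
      using sqrt_sum_squares_le_sum_abs[of "t - t0" "norm z"] by (simp add: dist_Pair_Pair dist_real_def)
    show ?thesis
    proof (intro exI[of _ \<delta>] conjI allI impI)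
      fix t and z :: "real ^ 3"
      assume t: "t \<in> {0..L + 1}" and z: "norm z \<le> \<delta>" and "t \<le> \<delta> \<or> \<bar>t - L\<bar> \<le> \<delta>"
      then show "norm (F t z - e1) \<le> \<omega>"
        using d(3)[OF t, of z] d(4)[OF t, of z] ds[of t z 0] ds[of t z L] \<delta> d(1,2) by force
    qed (use \<delta> L in auto)
  qed
  have increment: "norm (c u b - c u a - (b - a) *\<^sub>R e1) \<le> \<omega> * (b - a)"
    if ab: "0 \<le> a" "a \<le> b" "b \<le> L + 1" and u: "C * norm u \<le> \<rho>"
      and F: "\<And>t. t \<in> {a..b} \<Longrightarrow> norm (F t (Z u t) - e1) \<le> \<omega>" for u a b \<omega>
  proof -
    have "norm ((c u b - b *\<^sub>R e1) - (c u a - a *\<^sub>R e1)) \<le> \<omega> * norm (b - a)"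
    proof (rule differentiable_bound[where S = "{a..b}" and f' = "\<lambda>t h. h *\<^sub>R (F t (Z u t) - e1)"])
      fix t assume t: "t \<in> {a..b}"
      have "(c u has_vector_derivative F t (Z u t)) (at t within {a..b})"
        by (rule has_vector_derivative_within_subset[OF cd(1)]) (use t ab u in auto)
      then have "((\<lambda>t. c u t - t *\<^sub>R e1) has_vector_derivative F t (Z u t) - 1 *\<^sub>R e1) (at t within {a..b})"
        by (intro has_vector_derivative_diff) (auto intro!: derivative_eq_intros)
      then show "((\<lambda>t. c u t - t *\<^sub>R e1) has_derivative (\<lambda>h. h *\<^sub>R (F t (Z u t) - e1))) (at t within {a..b})"
        by (simp add: has_vector_derivative_def)
      show "onorm (\<lambda>h. h *\<^sub>R (F t (Z u t) - e1)) \<le> \<omega>"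
        by (intro onorm_le) (use mult_left_mono[OF F[OF t] abs_ge_zero] in \<open>simp add: mult.commute\<close>)
    qed (use ab in auto)
    then show ?thesis using ab by (simp add: algebra_simps)
  qed
  \<comment> \<open>The section lies at height zero for the height
    \<open>e1 \<bullet> (x - \<gamma> 0)\<close>. A velocity within 1/2 of \<open>e1\<close> makes
    the height grow at rate at least 1/2 and keeps the speed below 2.\<close>
  have slope: "e1 \<bullet> (c u b - c u a) \<ge> (b - a) / 2" "norm (c u b - c u a) \<le> 2 * (b - a)"
    if ab: "0 \<le> a" "a \<le> b" "b \<le> L + 1" and u: "C * norm u \<le> \<rho>"
      and F: "\<And>t. t \<in> {a..b} \<Longrightarrow> norm (F t (Z u t) - e1) \<le> 1/2" for u a b
  proof -
    define d where "d = c u b - c u a - (b - a) *\<^sub>R e1"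
    have d: "norm d \<le> 1/2 * (b - a)" unfolding d_def by (rule increment[OF that])
    have eq: "c u b - c u a = d + (b - a) *\<^sub>R e1" by (simp add: d_def)
    have "\<bar>e1 \<bullet> d\<bar> \<le> norm d" using Cauchy_Schwarz_ineq2[of e1 d] on by simp
    then show "e1 \<bullet> (c u b - c u a) \<ge> (b - a) / 2"
      unfolding eq using d by (simp add: inner_simps n)
    show "norm (c u b - c u a) \<le> 2 * (b - a)"
      unfolding eq using d norm_triangle_ineq[of d "(b - a) *\<^sub>R e1"] on ab by simp
  qed

  obtain \<delta> where \<delta>: "\<delta> > 0" "\<delta> \<le> 1" "\<delta> < L / 2" "\<delta> \<le> \<rho>"
    and near\<delta>: "\<And>t z. t \<in> {0..L + 1} \<Longrightarrow> norm z \<le> \<delta> \<Longrightarrow> t \<le> \<delta> \<or> \<bar>t - L\<bar> \<le> \<delta> \<Longrightarrow> norm (F t z - e1) \<le> 1/2"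
    using near[of "1/2"] by auto
  \<comment> \<open>Injectivity on the half-open period and compactness keep \<gamma> away from the
    base point between the two end windows.\<close>
  have "\<exists>d>0. \<forall>t\<in>{\<delta>..L - \<delta>}. d \<le> norm (\<gamma> t - \<gamma> 0)"
  proof -
    have "continuous_on {\<delta>..L - \<delta>} (\<lambda>t. norm (\<gamma> t - \<gamma> 0))" by (intro continuous_intros c\<gamma>)
    moreover have "{\<delta>..L - \<delta>} \<noteq> {}" using \<delta> by auto
    ultimately obtain t0 where t0: "t0 \<in> {\<delta>..L - \<delta>}" "\<And>t. t \<in> {\<delta>..L - \<delta>} \<Longrightarrow> norm (\<gamma> t0 - \<gamma> 0) \<le> norm (\<gamma> t - \<gamma> 0)"
      using continuous_attains_inf[OF compact_Icc] by meson
    have "\<gamma> t0 \<noteq> \<gamma> 0" using inj_onD[OF L(3), of t0 0] t0 \<delta> L by auto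
    then show ?thesis using t0 by (intro exI[of _ "norm (\<gamma> t0 - \<gamma> 0)"]) auto
  qed
  then obtain d where d: "d > 0" "\<And>t. t \<in> {\<delta>..L - \<delta>} \<Longrightarrow> d \<le> norm (\<gamma> t - \<gamma> 0)" by blast
  \<comment> \<open>Half the gap \<open>d\<close> for the disc and a quarter for the deviation leave
    no room for a return at intermediate times. The bound \<open>\<delta> / 4\<close> traps the
    return time near \<open>L\<close>, and \<open>R / 8\<close> keeps the return point in the disc,
    since it lies within \<open>5 * C * norm u\<close> of the base point.\<close>
  define R where "R = d / 2"
  define r where "r = Min {\<delta> / 4, d / 4, R / 8} / C"
  have r: "r > 0" "C * r \<le> \<delta> / 4" "C * r \<le> d / 4" "C * r \<le> R / 8"
    using \<delta> d C by (auto simp: r_def R_def)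
  have "1 * r \<le> C * r" using C r by (intro mult_right_mono) auto
  then have rR: "r \<le> R" using r(4) d by (simp add: R_def)
  have "\<exists>T. \<bar>T - L\<bar> \<le> 2 * C * norm u \<and> e1 \<bullet> (c u T - \<gamma> 0) = 0 \<and> norm (c u T - \<gamma> 0) < R \<and>
      \<bar>T - L\<bar> < \<delta> \<and> (\<forall>t\<in>{0<..<T}. c u t \<notin> \<sigma> ` ball 0 R)" if u: "norm u < r" for u
  proof -
    have Cu: "C * norm u \<le> C * r" using u C by simp
    have Cu\<rho>: "C * norm u \<le> \<rho>" using Cu r \<delta> by linarith
    have Z: "norm (Z u t) \<le> \<delta> / 4" if "t \<in> {0..L + 1}" for t
      using ZC[OF that, of u] Cu r by linarith
    define l where "l t = e1 \<bullet> (c u t - \<gamma> 0)" for t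
    have F0: "norm (F t (Z u t) - e1) \<le> 1/2" if "t \<in> {0..\<delta>}" for t
      by (rule near\<delta>) (use Z[of t] that \<delta> L in auto)
    have FL: "norm (F t (Z u t) - e1) \<le> 1/2" if "t \<in> {L - \<delta>..L + \<delta>}" for t
      by (rule near\<delta>) (use Z[of t] that \<delta> L in \<open>auto simp: abs_le_iff\<close>)
    have l0: "l 0 = 0" by (simp add: l_def c_def Z0 e1s)
    have lpos: "l t > 0" if "t \<in> {0<..\<delta>}" for t
    proof -
      have "(t - 0) / 2 \<le> e1 \<bullet> (c u t - c u 0)" by (rule slope) (use that F0 Cu\<rho> \<delta> in auto)
      then show ?thesis using l0 that by (simp add: l_def inner_diff_right)
    qed
    have linc: "(b - a) / 2 \<le> l b - l a" if "L - \<delta> \<le> a" "a \<le> b" "b \<le> L + \<delta>" for a b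
    proof -
      have "(b - a) / 2 \<le> e1 \<bullet> (c u b - c u a)" by (rule slope) (use that FL Cu\<rho> \<delta> in auto)
      then show ?thesis by (simp add: l_def inner_diff_right)
    qed
    have lL: "\<bar>l L\<bar> \<le> C * norm u"
      using Cauchy_Schwarz_ineq2[of e1 "Z u L"] ZC[of L u] L on by (simp add: l_def c_def)
    have "continuous_on {0..L + 1} (c u)"
      by (rule has_vector_derivative_continuous_on) (rule cd(1)[OF _ Cu\<rho>])
    then have cl: "continuous_on {0..L + 1} l" unfolding l_def by (intro continuous_intros)
    \<comment> \<open>At time \<open>L\<close> the height is at most \<open>\<delta> / 4\<close> in
      modulus, while each half of the window changes it by at least
      \<open>\<delta> / 2\<close>.\<close>
    have "\<exists>T. L - \<delta> \<le> T \<and> T \<le> L + \<delta> \<and> l T = 0"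
    proof (rule IVT')
      show "l (L - \<delta>) \<le> 0" using linc[of "L - \<delta>" L] lL Cu r \<delta> by simp
      show "0 \<le> l (L + \<delta>)" using linc[of L "L + \<delta>"] lL Cu r \<delta> by simp
      show "continuous_on {L - \<delta>..L + \<delta>} l"
        by (rule continuous_on_subset[OF cl]) (use \<delta> in auto)
    qed (use \<delta> in auto)
    then obtain T where T: "L - \<delta> \<le> T" "T \<le> L + \<delta>" "l T = 0" by blast
    have TL: "\<bar>T - L\<bar> \<le> 2 * C * norm u"
      using linc[of T L] linc[of L T] T lL \<delta> by (cases "T \<le> L") auto
    have "norm (c u T - c u L) \<le> 2 * \<bar>T - L\<bar>"
    proof (cases "T \<le> L")
      case True
      have "norm (c u L - c u T) \<le> 2 * (L - T)" by (rule slope(2)) (use True T FL Cu\<rho> \<delta> in auto)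
      then show ?thesis using True by (simp add: norm_minus_commute)
    next
      case False
      have "norm (c u T - c u L) \<le> 2 * (T - L)" by (rule slope(2)) (use False T FL Cu\<rho> \<delta> L in auto)
      then show ?thesis using False by simp
    qed
    moreover have "c u L - \<gamma> 0 = Z u L" using L by (simp add: c_def)
    ultimately have "norm (c u T - \<gamma> 0) \<le> 2 * \<bar>T - L\<bar> + C * norm u"
      using dist_triangle[of "c u T" "\<gamma> 0" "c u L"] ZC[of L u] L unfolding dist_norm by simp
    then have 1: "norm (c u T - \<gamma> 0) < R" using TL Cu r d by (simp add: R_def)
    \<comment> \<open>Three windows: just after the start the height is positive, in the last window
      it is negative before \<open>T\<close> by strict growth, and in between the orbit is too far
      from the base point.\<close>
    have 2: "c u t \<notin> \<sigma> ` ball 0 R" if t: "t \<in> {0<..<T}" for t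
    proof
      assume "c u t \<in> \<sigma> ` ball 0 R"
      then obtain v where v: "c u t - \<gamma> 0 = s v" "norm v < R" by (auto simp: \<sigma>s)
      then have lt: "l t = 0" and nt: "norm (c u t - \<gamma> 0) < R" by (auto simp: l_def e1s ns)
      consider "t \<le> \<delta>" | "L - \<delta> \<le> t" | "t \<in> {\<delta>..L - \<delta>}" by fastforce
      then show False
      proof cases
        case 1 then show ?thesis using lpos[of t] t lt by simp
      next
        case 2 then show ?thesis using linc[of t T] t T lt by simp
      next
        case 3
        have "norm (\<gamma> t - \<gamma> 0) \<le> norm (c u t - \<gamma> 0) + norm (Z u t)"
          using norm_triangle_ineq4[of "c u t - \<gamma> 0" "Z u t"] by (simp add: c_def)
        then show ?thesis
          using d(1) d(2)[OF 3] nt ZC[of t u] 3 \<delta> Cu r by (auto simp: R_def)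
      qed
    qed
    have 3: "\<bar>T - L\<bar> < \<delta>" using TL Cu r \<delta> by linarith
    show ?thesis using TL T 1 2 3 by (intro exI[of _ T]) (auto simp: l_def)
  qed
  then obtain T where T: "\<And>u. norm u < r \<Longrightarrow> \<bar>T u - L\<bar> \<le> 2 * C * norm u \<and> e1 \<bullet> (c u (T u) - \<gamma> 0) = 0 \<and>
      norm (c u (T u) - \<gamma> 0) < R \<and> \<bar>T u - L\<bar> < \<delta> \<and> (\<forall>t\<in>{0<..<T u}. c u t \<notin> \<sigma> ` ball 0 R)" by metis
  define P where "P u = pr (c u (T u) - \<gamma> 0)" for u
  have \<sigma>P: "\<sigma> (P u) = c u (T u)" if "norm u < r" for u
    using T[OF that] by (simp add: \<sigma>s P_def s_pr)
  have Cur: "C * norm u \<le> \<rho>" if "norm u < r" for u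
    using that C r \<delta> mult_left_mono[of "norm u" r C] by linarith
  have T01: "0 < T u" "T u \<le> L + 1" if "norm u < r" for u
    using T[OF that] \<delta> by auto

  have Z00: "Z 0 t = 0" if "t \<in> {0..L + 1}" for t using ZC[OF that, of 0] by simp
  \<comment> \<open>The orbit with \<open>u = 0\<close> is \<gamma> itself and returns at time
    \<open>L\<close>, so its first-return property says that \<gamma> avoids the disc in
    between.\<close>
  have sec: "\<gamma> t \<notin> \<sigma> ` ball 0 R" if "t \<in> {0<..<L}" for t
  proof -
    have "T 0 = L" and "c 0 t = \<gamma> t" using T[of 0] r that Z00[of t] by (auto simp: c_def)
    then show ?thesis using T[of 0] r that by (metis norm_zero)
  qed

  have der: "(P has_derivative (\<lambda>u. pr (u $ 1 *\<^sub>R y2 L + u $ 2 *\<^sub>R y3 L))) (at 0)"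
    unfolding has_derivative_at_alt
  proof (intro conjI allI impI)
    show "bounded_linear (\<lambda>u. pr (u $ 1 *\<^sub>R y2 L + u $ 2 *\<^sub>R y3 L))"
      by (intro bounded_linear_compose[OF \<open>bounded_linear pr\<close>] bounded_linear_add
          bounded_linear_compose[OF bounded_linear_scaleR_left] bounded_linear_vec_nth)
    fix e :: real assume "e > 0"
    \<comment> \<open>The return time differs from \<open>L\<close> by at most
      \<open>2 * C * norm u\<close>, so this \<omega> bounds the return-time error by
      \<open>e / 2 * norm u\<close>; the linearization error gets the other half.\<close>
    define \<omega> where "\<omega> = e / (4 * C)"
    have \<omega>: "\<omega> > 0" using \<open>e > 0\<close> C by (simp add: \<omega>_def)
    obtain \<delta>' where \<delta>': "\<delta>' > 0" "\<delta>' \<le> 1"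
      and near': "\<And>t z. t \<in> {0..L + 1} \<Longrightarrow> norm z \<le> \<delta>' \<Longrightarrow> t \<le> \<delta>' \<or> \<bar>t - L\<bar> \<le> \<delta>' \<Longrightarrow> norm (F t z - e1) \<le> \<omega>"
      using near[OF \<omega>] by auto
    obtain r' where r': "r' > 0"
      "\<And>z y. \<lbrakk>\<And>t. t \<in> {0..L} \<Longrightarrow> (z has_vector_derivative F t (z t) - F t 0) (at t within {0..L});
       \<And>t. t \<in> {0..L} \<Longrightarrow> norm (z t) \<le> C * norm (z 0);
       \<And>t. t \<in> {0..L} \<Longrightarrow> (y has_vector_derivative A t (y t)) (at t within {0..L});
       y 0 = z 0; norm (z 0) \<le> r'\<rbrakk> \<Longrightarrow> norm (z L - y L) \<le> e / 2 * norm (z 0)"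
    proof (rule solution_linearization[of L "\<lambda>t x. F t x - F t 0" A K C "e / 2"])
      show "\<exists>r>0. \<forall>t\<in>{0..L}. \<forall>x. norm x \<le> r \<longrightarrow> norm (F t x - F t 0 - A t x) \<le> \<omega> * norm x" if "\<omega> > 0" for \<omega>
        by (rule lin[OF that])
    qed (use A K L C \<open>e > 0\<close> in auto)
    define \<eta> where "\<eta> = Min {r, r', \<delta>' / (2 * C)}"
    have \<eta>: "\<eta> > 0" "\<eta> \<le> r" "\<eta> \<le> r'" "\<eta> \<le> \<delta>' / (2 * C)"
      using r r' \<delta>' C by (auto simp: \<eta>_def)
    show "\<exists>d>0. \<forall>u. norm (u - 0) < d \<longrightarrow>
        norm (P u - P 0 - pr ((u - 0) $ 1 *\<^sub>R y2 L + (u - 0) $ 2 *\<^sub>R y3 L)) \<le> e * norm (u - 0)"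
    proof (intro exI[of _ \<eta>] conjI allI impI)
      show "\<eta> > 0" by fact
      fix u :: "real ^ 2" assume "norm (u - 0) < \<eta>"
      then have u: "norm u < r" "norm u \<le> r'" and "norm u < \<delta>' / (2 * C)" using \<eta> by auto
      then have Cu: "2 * C * norm u < \<delta>'" using C by (simp add: field_simps)
      note Tu = T[OF u(1)]
      have P0: "P 0 = 0"
      proof -
        have "T 0 = L" using T[of 0] r by auto
        then have "c 0 (T 0) - \<gamma> 0 = 0" using Z00[of L] L by (simp add: c_def)
        then show ?thesis using pr_lin(3)[of 0 0] by (simp add: P_def)
      qed
      define y where "y t = u $ 1 *\<^sub>R y2 t + u $ 2 *\<^sub>R y3 t" for t
      have lin2: "norm (Z u L - y L) \<le> e / 2 * norm (Z u 0)"
      proof (rule r'(2))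
        fix t assume t: "t \<in> {0..L}"
        have "(Z u has_vector_derivative F t (cp (Z u t)) - F t 0) (at t within {0..L})"
          by (rule has_vector_derivative_within_subset[OF Zd]) (use t in auto)
        then show "(Z u has_vector_derivative F t (Z u t) - F t 0) (at t within {0..L})"
          using cd(2)[of t u] t Cur[OF u(1)] by (simp add: cp_id)
        show "norm (Z u t) \<le> C * norm (Z u 0)" using ZC[of t u] t by (simp add: Z0 ns)
        have "(y has_vector_derivative u $ 1 *\<^sub>R A t (y2 t) + u $ 2 *\<^sub>R A t (y3 t)) (at t within {0..L})"
          unfolding y_def[abs_def] using y(1,2)[OF t] by (auto intro!: derivative_eq_intros)
        then show "(y has_vector_derivative A t (y t)) (at t within {0..L})"
          using A(1)[OF t] by (simp add: y_def linear_add linear_cmul)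
      qed (use u y in \<open>auto simp: y_def Z0 s_def[symmetric] ns\<close>)
      \<comment> \<open>The return point is the deviation at time \<open>L\<close>, plus motion
        along \<open>e1\<close>, plus \<Delta>. The projection \<open>pr\<close> kills
        \<open>e1\<close>, so the variable return time enters only through \<Delta>.\<close>
      define \<Delta> where "\<Delta> = c u (T u) - c u L - (T u - L) *\<^sub>R e1"
      have \<Delta>: "norm \<Delta> \<le> \<omega> * \<bar>T u - L\<bar>"
      proof -
        have F: "norm (F t (Z u t) - e1) \<le> \<omega>" if "t \<in> {0..L+1}" "\<bar>t - L\<bar> \<le> \<bar>T u - L\<bar>" for t
          by (rule near'[OF that(1)])
             (use that Tu Cu ZC[OF that(1), of u] C \<open>\<delta>' > 0\<close> in \<open>auto intro: order_trans[of _ "C * norm u"]\<close>)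
        show ?thesis
        proof (cases "T u \<le> L")
          case True
          have "norm (c u L - c u (T u) - (L - T u) *\<^sub>R e1) \<le> \<omega> * (L - T u)"
            by (rule increment) (use True T01[OF u(1)] Cur[OF u(1)] L in \<open>auto intro!: F\<close>)
          moreover have "c u L - c u (T u) - (L - T u) *\<^sub>R e1 = - \<Delta>" by (simp add: \<Delta>_def algebra_simps)
          ultimately show ?thesis using True by (metis abs_minus_commute abs_of_nonneg diff_ge_0_iff_ge norm_minus_cancel)
        next
          case False
          have "norm (c u (T u) - c u L - (T u - L) *\<^sub>R e1) \<le> \<omega> * (T u - L)"
            by (rule increment) (use False T01[OF u(1)] Cur[OF u(1)] L in \<open>auto intro!: F\<close>)
          then show ?thesis using False by (simp add: \<Delta>_def)
        qed
      qed
      also have "\<dots> \<le> \<omega> * (2 * C * norm u)" using Tu \<omega> by (intro mult_left_mono) auto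
      also have "\<dots> = e / 2 * norm u" using C by (simp add: \<omega>_def)
      finally have \<Delta>e: "norm \<Delta> \<le> e / 2 * norm u" .
      have "c u (T u) - \<gamma> 0 = \<Delta> + (T u - L) *\<^sub>R e1 + Z u L"
        using L by (simp add: \<Delta>_def c_def)
      then have "P u = pr \<Delta> + pr (Z u L)" by (simp add: P_def pr_lin pr_e1)
      then have "P u - P 0 - pr (y L) = pr \<Delta> + pr (Z u L - y L)" by (simp add: P0 pr_lin)
      then have "norm (P u - P 0 - pr (y L)) \<le> norm \<Delta> + norm (Z u L - y L)"
        using norm_triangle_ineq[of "pr \<Delta>" "pr (Z u L - y L)"] npr[of \<Delta>] npr[of "Z u L - y L"] by simp
      also have "\<dots> \<le> e * norm u" using lin2 \<Delta>e by (simp add: Z0 ns)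
      finally show "norm (P u - P 0 - pr ((u - 0) $ 1 *\<^sub>R y2 L + (u - 0) $ 2 *\<^sub>R y3 L)) \<le> e * norm (u - 0)"
        by (simp add: y_def)
    qed
  qed
  show ?thesis
  proof (rule that[of R "ball 0 r" P])
    show "R > 0" using d by (simp add: R_def)
    show "ball 0 r \<subseteq> ball (0::real^2) R" using rR by auto
    show "\<forall>u\<in>ball 0 r. P u \<in> ball 0 R \<and> (\<exists>c T. 0 < T \<and> T \<le> L + 1 \<and> c 0 = \<sigma> u \<and> c T = \<sigma> (P u) \<and>
        (\<forall>t\<in>{0<..<T}. c t \<notin> \<sigma> ` ball 0 R) \<and> F 0 (c 0 - \<gamma> 0) \<bullet> e1 > 0 \<and>
        (\<forall>t\<in>{0..T}. norm (c t - \<gamma> t) \<le> \<rho> \<and>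
           (c has_vector_derivative F t (c t - \<gamma> t)) (at t within {0..T})))" (is "\<forall>u\<in>_. ?Q u")
    proof
      fix u :: "real^2" assume "u \<in> ball 0 r"
    then have u: "norm u < r" by simp
    have "s (P u) = c u (T u) - \<gamma> 0" using \<sigma>P[OF u] by (simp add: \<sigma>s algebra_simps)
    then have PR: "P u \<in> ball 0 R" using T[OF u] ns[of "P u"] by simp
    have "C * norm u \<le> C * r" using u C by simp
    then have Z\<delta>: "norm (Z u 0) \<le> \<delta>" using ZC[of 0 u] L r \<delta> by auto
    have "norm (F 0 (Z u 0) - e1) \<le> 1/2" by (rule near\<delta>) (use Z\<delta> L \<delta> in auto)
    moreover have "F 0 (Z u 0) \<bullet> e1 = 1 + (F 0 (Z u 0) - e1) \<bullet> e1" by (simp add: inner_simps n)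
    moreover have "\<bar>(F 0 (Z u 0) - e1) \<bullet> e1\<bar> \<le> norm (F 0 (Z u 0) - e1)"
      using Cauchy_Schwarz_ineq2[of "F 0 (Z u 0) - e1" e1] on by simp
    ultimately have pos: "F 0 (c u 0 - \<gamma> 0) \<bullet> e1 > 0" by (simp add: c_def)
    have vd: "(c u has_vector_derivative F t (c u t - \<gamma> t)) (at t within {0..T u})" "norm (c u t - \<gamma> t) \<le> \<rho>"
      if "t \<in> {0..T u}" for t
      using has_vector_derivative_within_subset[OF cd(1)[of t u], of "{0..T u}"] cd(2)[of t u] that T01[OF u] Cur[OF u]
      by (auto simp: c_def)
      show "?Q u"
        using PR pos vd T01[OF u] \<sigma>P[OF u] T[OF u]
      by (intro conjI exI[of _ "c u"] exI[of _ "T u"]) (auto simp: c_def Z0 \<sigma>s)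
    qed
  qed (use r sec der in auto)
qed

section \<open>Principal directions\<close>

lemma smooth_on_frechet_comp:
  fixes f :: "'a::euclidean_space \<Rightarrow> 'b::real_normed_vector"
  assumes "open U" "smooth_on V f" "smooth_on U g" "g ` U \<subseteq> V" "smooth_on U w"
  shows "smooth_on U (\<lambda>x. frechet_derivative f (at (g x)) (w x))"
proof -
  have "smooth_on U (\<lambda>x. \<Sum>b\<in>Basis. (w x \<bullet> b) *\<^sub>R frechet_derivative f (at (g x)) b)"
    by (intro smooth_intros assms smooth_on_compose[OF _ smooth_on_frechet[OF assms(2)]])
  then show ?thesis
  proof (rule smooth_on_cong[OF assms(1), rotated])
    fix x assume "x \<in> U"
    then have "linear (frechet_derivative f (at (g x)))"
      using assms by (intro linear_frechet_derivative smooth_on_differentiable[of V]) auto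
    from linear_eq_sum_Basis[OF this, of "w x"]
    show "(\<Sum>b\<in>Basis. (w x \<bullet> b) *\<^sub>R frechet_derivative f (at (g x)) b) = frechet_derivative f (at (g x)) (w x)" ..
  qed
qed

text \<open>Not symmetric in general, because the plane field orthogonal to \<eta> need not be
  integrable; normal curvature sees only the symmetric part.\<close>

definition shape :: "(E3 \<Rightarrow> E3) \<Rightarrow> E3 \<Rightarrow> E3 \<Rightarrow> E3 \<Rightarrow> real" where
  "shape \<eta> p X Y = frechet_derivative \<eta> (at p) X \<bullet> Y"

text \<open>\<open>X\<close> spans the eigenline of the larger eigenvalue of the symmetrized derivative, that is, of
  the smaller principal curvature.\<close>

definition principal_frame :: "(E3 \<Rightarrow> E3) \<Rightarrow> E3 \<Rightarrow> E3 \<Rightarrow> bool" where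
  "principal_frame \<eta> p X \<longleftrightarrow> norm X = 1 \<and> X \<bullet> \<eta> p = 0 \<and>
     shape \<eta> p X (cross3 (\<eta> p) X) + shape \<eta> p (cross3 (\<eta> p) X) X = 0 \<and>
     shape \<eta> p (cross3 (\<eta> p) X) (cross3 (\<eta> p) X) < shape \<eta> p X X"

lemma cross3_orthonormal:
  assumes "norm n = 1" "norm X = 1" "X \<bullet> n = 0"
  shows "norm (cross3 n X) = 1" "cross3 n X \<bullet> n = 0" "n \<bullet> cross3 n X = 0" "cross3 n X \<bullet> X = 0" "X \<bullet> cross3 n X = 0"
    "cross3 n (cross3 n X) = - X"
proof -
  have "(norm (cross3 n X))\<^sup>2 = 1"
    using assms norm_cross_dot[of n X] by (simp add: inner_commute)
  then show "norm (cross3 n X) = 1"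
    using norm_ge_zero[of "cross3 n X"] unfolding power2_eq_1_iff by linarith
  show "cross3 n X \<bullet> n = 0" "n \<bullet> cross3 n X = 0" "cross3 n X \<bullet> X = 0" "X \<bullet> cross3 n X = 0"
    by (simp_all add: dot_cross_self)
  show "cross3 n (cross3 n X) = - X"
    using assms by (simp add: Lagrange inner_commute norm_eq_1)
qed

lemma orthonormal_expand_frame:
  assumes "norm n = 1" "norm X = 1" "X \<bullet> n = 0"
  shows "Z = (Z \<bullet> X) *\<^sub>R X + (Z \<bullet> cross3 n X) *\<^sub>R cross3 n X + (Z \<bullet> n) *\<^sub>R n"
  using orthonormal_expand3[of X "cross3 n X" n Z] assms cross3_orthonormal[OF assms]
  by (simp add: inner_commute)

lemma shape_bilinear:
  assumes "\<eta> differentiable (at p)"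
  shows "shape \<eta> p (a *\<^sub>R X + b *\<^sub>R Y) (c *\<^sub>R X + d *\<^sub>R Y) =
     a * c * shape \<eta> p X X + a * d * shape \<eta> p X Y + b * c * shape \<eta> p Y X + b * d * shape \<eta> p Y Y"
proof -
  have "linear (frechet_derivative \<eta> (at p))" by (rule linear_frechet_derivative[OF assms])
  then show ?thesis
    by (simp add: shape_def linear_add linear_cmul inner_simps algebra_simps)
qed

text \<open>Clearing the denominator \<open>Z \<bullet> Z\<close> turns comparisons of curvatures
  into comparisons of quadratic forms in two coordinates.\<close>

lemma normal_curvature_frame:
  assumes d: "\<eta> differentiable (at p)" and n: "norm (\<eta> p) = 1" "norm X = 1" "X \<bullet> \<eta> p = 0"
    and Z: "Z \<in> orth_plane \<eta> p - {0}"
  defines "Y \<equiv> cross3 (\<eta> p) X"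
  shows "(Z \<bullet> X)\<^sup>2 + (Z \<bullet> Y)\<^sup>2 > 0"
    and "normal_curvature \<eta> p Z * ((Z \<bullet> X)\<^sup>2 + (Z \<bullet> Y)\<^sup>2) =
      - ((Z \<bullet> X)\<^sup>2 * shape \<eta> p X X + (Z \<bullet> X) * (Z \<bullet> Y) * (shape \<eta> p X Y + shape \<eta> p Y X)
         + (Z \<bullet> Y)\<^sup>2 * shape \<eta> p Y Y)"
proof -
  have Zeq: "Z = (Z \<bullet> X) *\<^sub>R X + (Z \<bullet> Y) *\<^sub>R Y"
    using orthonormal_expand_frame[OF n, of Z] Z by (simp add: Y_def orth_plane_def)
  have on: "X \<bullet> X = 1" "Y \<bullet> Y = 1" "X \<bullet> Y = 0"
    using n cross3_orthonormal[OF n] by (auto simp: Y_def norm_eq_1)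
  have "Z \<bullet> Z = Z \<bullet> ((Z \<bullet> X) *\<^sub>R X + (Z \<bullet> Y) *\<^sub>R Y)" using Zeq by simp
  then have ZZ: "Z \<bullet> Z = (Z \<bullet> X)\<^sup>2 + (Z \<bullet> Y)\<^sup>2"
    by (simp add: inner_simps power2_eq_square)
  show pos: "(Z \<bullet> X)\<^sup>2 + (Z \<bullet> Y)\<^sup>2 > 0" using Z ZZ by (metis Diff_iff inner_gt_zero_iff insertI1)
  have "shape \<eta> p Z Z = (Z \<bullet> X)\<^sup>2 * shape \<eta> p X X + (Z \<bullet> X) * (Z \<bullet> Y) * (shape \<eta> p X Y + shape \<eta> p Y X)
         + (Z \<bullet> Y)\<^sup>2 * shape \<eta> p Y Y"
    using shape_bilinear[OF d, of "Z \<bullet> X" X "Z \<bullet> Y" Y "Z \<bullet> X" "Z \<bullet> Y"] Zeq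
    by (simp add: power2_eq_square algebra_simps)
  then show "normal_curvature \<eta> p Z * ((Z \<bullet> X)\<^sup>2 + (Z \<bullet> Y)\<^sup>2) =
      - ((Z \<bullet> X)\<^sup>2 * shape \<eta> p X X + (Z \<bullet> X) * (Z \<bullet> Y) * (shape \<eta> p X Y + shape \<eta> p Y X)
         + (Z \<bullet> Y)\<^sup>2 * shape \<eta> p Y Y)"
    using pos unfolding normal_curvature_def ZZ shape_def by simp
qed

text \<open>Without an off-diagonal term the curvature is a weighted mean of its values at
  \<open>X\<close> and \<open>cross3 (\<eta> p) X\<close>, so these are its extreme values; the
  strict inequality between them excludes umbilics.\<close>

lemma principal_frame_direction:
  assumes d: "\<eta> differentiable (at p)" and n: "norm (\<eta> p) = 1" and X: "principal_frame \<eta> p X"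
  shows "k_min \<eta> p = - shape \<eta> p X X" "p \<notin> partially_umbilic \<eta>" "principal_direction \<eta> (k_min \<eta>) p X"
proof -
  define Y where "Y = cross3 (\<eta> p) X"
  have X1: "norm X = 1" "X \<bullet> \<eta> p = 0" and off: "shape \<eta> p X Y + shape \<eta> p Y X = 0"
    and lt: "shape \<eta> p Y Y < shape \<eta> p X X"
    using X by (auto simp: principal_frame_def Y_def)
  note on = cross3_orthonormal[OF n X1, folded Y_def]
  have Xin: "X \<in> orth_plane \<eta> p - {0}" and Yin: "Y \<in> orth_plane \<eta> p - {0}"
    using X1 on by (auto simp: orth_plane_def)
  have ncX: "normal_curvature \<eta> p X = - shape \<eta> p X X" and ncY: "normal_curvature \<eta> p Y = - shape \<eta> p Y Y"
    using X1 on by (auto simp: normal_curvature_def shape_def norm_eq_1)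
  have bounds: "- shape \<eta> p X X \<le> normal_curvature \<eta> p Z" "normal_curvature \<eta> p Z \<le> - shape \<eta> p Y Y"
    if Z: "Z \<in> orth_plane \<eta> p - {0}" for Z
  proof -
    note nc = normal_curvature_frame[OF d n X1 Z, folded Y_def]
    let ?s = "(Z \<bullet> X)\<^sup>2 + (Z \<bullet> Y)\<^sup>2"
    have "- shape \<eta> p X X * ?s \<le> normal_curvature \<eta> p Z * ?s"
      using mult_left_mono[of "shape \<eta> p Y Y" "shape \<eta> p X X" "(Z \<bullet> Y)\<^sup>2"] lt
      unfolding nc(2) off by (simp add: algebra_simps)
    then show "- shape \<eta> p X X \<le> normal_curvature \<eta> p Z" using nc(1) by (rule mult_right_le_imp_le)
    have "normal_curvature \<eta> p Z * ?s \<le> - shape \<eta> p Y Y * ?s"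
      using mult_left_mono[of "shape \<eta> p Y Y" "shape \<eta> p X X" "(Z \<bullet> X)\<^sup>2"] lt
      unfolding nc(2) off by (simp add: algebra_simps)
    then show "normal_curvature \<eta> p Z \<le> - shape \<eta> p Y Y" using nc(1) by (rule mult_right_le_imp_le)
  qed
  show kmin: "k_min \<eta> p = - shape \<eta> p X X"
    unfolding k_min_def
    by (rule cInf_eq_minimum) (use Xin ncX bounds in \<open>auto simp: image_iff intro!: bexI[of _ X]\<close>)
  have "k_max \<eta> p = - shape \<eta> p Y Y"
    unfolding k_max_def
    by (rule cSup_eq_maximum) (use Yin ncY bounds in \<open>auto simp: image_iff intro!: bexI[of _ Y]\<close>)
  then show "p \<notin> partially_umbilic \<eta>" using kmin lt by (simp add: partially_umbilic_def)
  show "principal_direction \<eta> (k_min \<eta>) p X"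
    using Xin ncX kmin by (simp add: principal_direction_def)
qed

text \<open>Both vectors realise the minimal curvature. The excess of the curvature at
  \<open>Z\<close> over that at \<open>X\<close> is the positive gap times the squared component of
  \<open>Z\<close> across \<open>X\<close>, which must therefore vanish.\<close>

lemma principal_frame_unique:
  assumes d: "\<eta> differentiable (at p)" and n: "norm (\<eta> p) = 1"
    and X: "principal_frame \<eta> p X" and Z: "principal_frame \<eta> p Z"
  shows "Z = X \<or> Z = - X"
proof -
  define Y where "Y = cross3 (\<eta> p) X"
  have X1: "norm X = 1" "X \<bullet> \<eta> p = 0" and off: "shape \<eta> p X Y + shape \<eta> p Y X = 0"
    and lt: "shape \<eta> p Y Y < shape \<eta> p X X"
    using X by (auto simp: principal_frame_def Y_def)
  have Z1: "norm Z = 1" "Z \<bullet> \<eta> p = 0" using Z by (auto simp: principal_frame_def)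
  then have Zin: "Z \<in> orth_plane \<eta> p - {0}" by (auto simp: orth_plane_def)
  have nc: "normal_curvature \<eta> p Z = - shape \<eta> p X X"
    using principal_frame_direction[OF d n X] principal_frame_direction[OF d n Z]
    by (simp add: principal_direction_def)
  have "(Z \<bullet> Y)\<^sup>2 * (shape \<eta> p X X - shape \<eta> p Y Y) = 0"
    using normal_curvature_frame(2)[OF d n X1 Zin, folded Y_def] off nc by (auto simp: algebra_simps)
  then have "Z \<bullet> Y = 0" using lt by simp
  then have Zeq: "Z = (Z \<bullet> X) *\<^sub>R X"
    using orthonormal_expand_frame[OF n X1, of Z] Z1 by (simp add: Y_def)
  then have "\<bar>Z \<bullet> X\<bar> = 1" using Z1 X1 by (metis mult.right_neutral norm_scaleR)
  then show ?thesis using Zeq by (metis abs_eq_iff' scaleR_minus_left scaleR_one abs_1)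
qed

text \<open>Minimality is tested on the combinations \<open>a *\<^sub>R X + b *\<^sub>R Y\<close>:
  terms linear in \<open>a\<close> force the off-diagonal sum to vanish, and equal diagonal entries
  would make the curvature constant, hence the point umbilic.\<close>

lemma principal_direction_frame:
  assumes d: "\<eta> differentiable (at p)" and n: "norm (\<eta> p) = 1"
    and X: "principal_direction \<eta> (k_min \<eta>) p X" "norm X = 1" and umb: "p \<notin> partially_umbilic \<eta>"
  shows "principal_frame \<eta> p X"
proof -
  define Y where "Y = cross3 (\<eta> p) X"
  have X1: "norm X = 1" "X \<bullet> \<eta> p = 0" and Xin: "X \<in> orth_plane \<eta> p - {0}"
    using X by (auto simp: principal_direction_def orth_plane_def)
  note on = cross3_orthonormal[OF n X1, folded Y_def]
  have k: "k_min \<eta> p = - shape \<eta> p X X"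
    using X X1 by (simp add: principal_direction_def normal_curvature_def shape_def norm_eq_1)
  have on': "X \<bullet> X = 1" "Y \<bullet> Y = 1" "X \<bullet> Y = 0" "Y \<bullet> X = 0"
    using X1 on by (auto simp: norm_eq_1)
  have "bounded_linear (frechet_derivative \<eta> (at p))"
    using d has_derivative_bounded_linear has_derivative_frechet by blast
  then obtain K where K: "\<And>Z. norm (frechet_derivative \<eta> (at p) Z) \<le> norm Z * K"
    using bounded_linear.bounded by blast
  \<comment> \<open>\<open>k_min\<close> is an infimum of reals, which is known to be a lower bound
    only once the values are bounded below.\<close>
  have "bdd_below (normal_curvature \<eta> p ` (orth_plane \<eta> p - {0}))"
  proof (rule bdd_belowI2)
    fix Z assume Z: "Z \<in> orth_plane \<eta> p - {0}"
    have "frechet_derivative \<eta> (at p) Z \<bullet> Z \<le> norm Z * K * norm Z"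
      using norm_cauchy_schwarz[of "frechet_derivative \<eta> (at p) Z" Z] mult_right_mono[OF K[of Z], of "norm Z"] by simp
    also have "\<dots> = K * (Z \<bullet> Z)" by (simp add: power2_eq_square flip: power2_norm_eq_inner)
    finally show "- K \<le> normal_curvature \<eta> p Z"
      using Z by (simp add: normal_curvature_def field_simps)
  qed
  then have le: "- shape \<eta> p X X \<le> normal_curvature \<eta> p Z" if "Z \<in> orth_plane \<eta> p - {0}" for Z
    using cINF_lower[OF _ that] k unfolding k_min_def by metis
  let ?h = "shape \<eta> p X Y + shape \<eta> p Y X"
  have quad: "b\<^sup>2 * shape \<eta> p Y Y + a * b * ?h \<le> b\<^sup>2 * shape \<eta> p X X" if "b \<noteq> 0" for a b
  proof -
    define Z where "Z = a *\<^sub>R X + b *\<^sub>R Y"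
    have ZX: "Z \<bullet> X = a" "Z \<bullet> Y = b" by (auto simp: Z_def inner_simps on')
    have "Z \<noteq> 0" using ZX that by auto
    moreover have "Z \<bullet> \<eta> p = 0" using X1 on by (simp add: Z_def inner_simps)
    ultimately have Z: "Z \<in> orth_plane \<eta> p - {0}" by (simp add: orth_plane_def)
    note nc = normal_curvature_frame[OF d n X1 Z, folded Y_def, unfolded ZX]
    have "- shape \<eta> p X X * (a\<^sup>2 + b\<^sup>2) \<le> normal_curvature \<eta> p Z * (a\<^sup>2 + b\<^sup>2)"
      by (intro mult_right_mono le Z) simp
    then show ?thesis unfolding nc(2) by (simp add: algebra_simps)
  qed
  have h0: "?h = 0"
  proof (rule ccontr)
    assume "?h \<noteq> 0"
    moreover have "shape \<eta> p Y Y + a * ?h \<le> shape \<eta> p X X" for a using quad[of 1 a] by simp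
    \<comment> \<open>An affine function of \<open>a\<close> that is bounded above has slope zero;
      this \<open>a\<close> exceeds the bound by exactly 1.\<close>
    from this[of "(shape \<eta> p X X - shape \<eta> p Y Y + 1) / ?h"] \<open>?h \<noteq> 0\<close> show False by simp
  qed
  have "shape \<eta> p Y Y \<noteq> shape \<eta> p X X"
  proof
    assume eq: "shape \<eta> p Y Y = shape \<eta> p X X"
    have "normal_curvature \<eta> p Z = - shape \<eta> p X X" if Z: "Z \<in> orth_plane \<eta> p - {0}" for Z
    proof -
      note nc = normal_curvature_frame[OF d n X1 Z, folded Y_def]
      have "normal_curvature \<eta> p Z * ((Z \<bullet> X)\<^sup>2 + (Z \<bullet> Y)\<^sup>2) = - shape \<eta> p X X * ((Z \<bullet> X)\<^sup>2 + (Z \<bullet> Y)\<^sup>2)"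
        unfolding nc(2) h0 eq by (simp add: algebra_simps)
      then show ?thesis
        by (rule mult_right_cancel[THEN iffD1, rotated]) (use nc(1) in linarith)
    qed
    then have "normal_curvature \<eta> p ` (orth_plane \<eta> p - {0}) = {- shape \<eta> p X X}" using Xin by auto
    then have "k_max \<eta> p = k_min \<eta> p" by (simp add: k_max_def k_min_def)
    then show False using umb by (simp add: partially_umbilic_def)
  qed
  moreover have "shape \<eta> p Y Y \<le> shape \<eta> p X X" using quad[of 1 0] by simp
  ultimately show ?thesis using X1 h0 by (simp add: principal_frame_def Y_def)
qed

section \<open>Smooth choice of an oriented principal direction\<close>

text \<open>The principal direction field that makes an acute angle with a reference vector \<open>d\<close>, as a
  function of \<open>d\<close> and the point. In the orthogonal frame \<open>a\<close>, \<open>b\<close> obtained from the projection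
  of \<open>d\<close>, the eigenvector of a symmetric matrix with off-diagonal entry \<open>h / 2\<close> and difference
  \<open>D > 0\<close> of the diagonal entries is \<open>(D + sqrt (D\<^sup>2 + h\<^sup>2), h)\<close>.\<close>

definition dproj :: "(E3 \<Rightarrow> E3) \<Rightarrow> E3 \<times> E3 \<Rightarrow> E3" where
  "dproj \<eta> q = fst q - (fst q \<bullet> \<eta> (snd q)) *\<^sub>R \<eta> (snd q)"

definition dcross :: "(E3 \<Rightarrow> E3) \<Rightarrow> E3 \<times> E3 \<Rightarrow> E3" where
  "dcross \<eta> q = cross3 (\<eta> (snd q)) (dproj \<eta> q)"

definition ddiag :: "(E3 \<Rightarrow> E3) \<Rightarrow> E3 \<times> E3 \<Rightarrow> real" where
  "ddiag \<eta> q = shape \<eta> (snd q) (dproj \<eta> q) (dproj \<eta> q) - shape \<eta> (snd q) (dcross \<eta> q) (dcross \<eta> q)"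

definition doff :: "(E3 \<Rightarrow> E3) \<Rightarrow> E3 \<times> E3 \<Rightarrow> real" where
  "doff \<eta> q = shape \<eta> (snd q) (dproj \<eta> q) (dcross \<eta> q) + shape \<eta> (snd q) (dcross \<eta> q) (dproj \<eta> q)"

definition pvec :: "(E3 \<Rightarrow> E3) \<Rightarrow> E3 \<times> E3 \<Rightarrow> E3" where
  "pvec \<eta> q = (ddiag \<eta> q + sqrt ((ddiag \<eta> q)\<^sup>2 + (doff \<eta> q)\<^sup>2)) *\<^sub>R dproj \<eta> q + doff \<eta> q *\<^sub>R dcross \<eta> q"

definition pdir :: "(E3 \<Rightarrow> E3) \<Rightarrow> E3 \<times> E3 \<Rightarrow> E3" where
  "pdir \<eta> q = (1 / sqrt (pvec \<eta> q \<bullet> pvec \<eta> q)) *\<^sub>R pvec \<eta> q"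

text \<open>Geometrically, the projection of the reference vector is nonzero and makes an angle
  below 45 degrees with the principal line of \<open>k_min\<close>. This open condition also keeps
  the radicand in \<open>pvec\<close> positive.\<close>

definition pdom :: "(E3 \<Rightarrow> E3) \<Rightarrow> (E3 \<times> E3) set" where
  "pdom \<eta> = {q. ddiag \<eta> q > 0}"

lemma pdir_frame:
  assumes d: "\<eta> differentiable (at (snd q))" and n: "norm (\<eta> (snd q)) = 1" and q: "q \<in> pdom \<eta>"
  shows "principal_frame \<eta> (snd q) (pdir \<eta> q)" "pdir \<eta> q \<bullet> fst q > 0" "pvec \<eta> q \<bullet> pvec \<eta> q > 0"
proof -
  let ?n = "\<eta> (snd q)"
  define a b D h R X where "a = dproj \<eta> q" and "b = dcross \<eta> q" and "D = ddiag \<eta> q" and "h = doff \<eta> q"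
    and "R = sqrt (D\<^sup>2 + h\<^sup>2)" and "X = pvec \<eta> q"
  let ?B = "shape \<eta> (snd q)"
  have D: "D > 0" using q by (simp add: pdom_def D_def)
  have D2: "D = ?B a a - ?B b b" and h2: "h = ?B a b + ?B b a"
    by (simp_all add: D_def h_def ddiag_def doff_def a_def b_def)
  have nn: "?n \<bullet> ?n = 1" using n by (simp add: norm_eq_1)
  have an: "a \<bullet> ?n = 0" "?n \<bullet> a = 0" by (simp_all add: a_def dproj_def inner_simps nn inner_commute)
  have b: "b = cross3 ?n a" by (simp add: a_def b_def dcross_def)
  have bn: "b \<bullet> ?n = 0" "?n \<bullet> b = 0" "a \<bullet> b = 0" "b \<bullet> a = 0" by (simp_all add: b dot_cross_self)
  have nb: "cross3 ?n b = - a" unfolding b Lagrange by (simp add: an nn)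
  have "(norm b)\<^sup>2 = (norm a)\<^sup>2" using norm_cross_dot[of ?n a] by (simp add: b n an)
  then have bb: "b \<bullet> b = a \<bullet> a" by (simp add: power2_norm_eq_inner)
  have "shape \<eta> (snd q) 0 0 = 0" by (simp add: shape_def)
  then have "a \<noteq> 0" using D D2 by (auto simp: b)
  then have aa: "a \<bullet> a > 0" by simp
  define \<alpha> where "\<alpha> = D + R"
  have R2: "R\<^sup>2 = D\<^sup>2 + h\<^sup>2" by (simp add: R_def)
  have "R > 0" using D by (simp add: R_def add_pos_nonneg)
  then have \<alpha>: "\<alpha> > 0" using D by (simp add: \<alpha>_def)
  have X: "X = \<alpha> *\<^sub>R a + h *\<^sub>R b"
    by (simp add: X_def pvec_def \<alpha>_def R_def D_def h_def a_def b_def)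
  have XX: "X \<bullet> X = (\<alpha>\<^sup>2 + h\<^sup>2) * (a \<bullet> a)"
    by (simp add: X inner_simps bn bb power2_eq_square algebra_simps)
  show pos: "pvec \<eta> q \<bullet> pvec \<eta> q > 0"
    unfolding X_def[symmetric] XX using \<alpha> aa by (simp add: add_pos_nonneg)
  define s where "s = 1 / sqrt (X \<bullet> X)"
  have s: "s > 0" using pos by (simp add: s_def X_def)
  have pd: "pdir \<eta> q = s *\<^sub>R X" by (simp add: pdir_def s_def X_def)
  have "norm X = sqrt (X \<bullet> X)" by (rule norm_eq_sqrt_inner)
  then have nX: "norm (pdir \<eta> q) = 1" using s pos unfolding pd by (simp add: s_def X_def)
  have cX: "cross3 ?n X = \<alpha> *\<^sub>R b - h *\<^sub>R a"
    unfolding X cross_add_right cross_mult_right nb b[symmetric] by simp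
  then have Y: "cross3 ?n (pdir \<eta> q) = (- (s * h)) *\<^sub>R a + (s * \<alpha>) *\<^sub>R b"
    unfolding pd cross_mult_right cX by (simp add: algebra_simps)
  have X': "pdir \<eta> q = (s * \<alpha>) *\<^sub>R a + (s * h) *\<^sub>R b" by (simp add: pd X algebra_simps)
  \<comment> \<open>\<alpha> is the positive root of
    \<open>\<alpha>\<^sup>2 - 2 * D * \<alpha> - h\<^sup>2 = 0\<close>. The identity annihilates the
    off-diagonal term and turns the diagonal gap into a positive multiple of
    \<open>2 * \<alpha> * R\<^sup>2\<close>.\<close>
  have id1: "\<alpha>\<^sup>2 - h\<^sup>2 = 2 * D * \<alpha>"
    using R2 by (simp add: \<alpha>_def power2_eq_square algebra_simps)
  have "?B (pdir \<eta> q) (cross3 ?n (pdir \<eta> q)) + ?B (cross3 ?n (pdir \<eta> q)) (pdir \<eta> q)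
     = s\<^sup>2 * ((\<alpha>\<^sup>2 - h\<^sup>2) * h - 2 * \<alpha> * h * D)"
    unfolding Y unfolding X' shape_bilinear[OF d] unfolding D2 h2 by (simp add: power2_eq_square algebra_simps)
  also have "\<dots> = 0" unfolding id1 by simp
  finally have off: "?B (pdir \<eta> q) (cross3 ?n (pdir \<eta> q)) + ?B (cross3 ?n (pdir \<eta> q)) (pdir \<eta> q) = 0" .
  have "?B (pdir \<eta> q) (pdir \<eta> q) - ?B (cross3 ?n (pdir \<eta> q)) (cross3 ?n (pdir \<eta> q))
     = s\<^sup>2 * ((\<alpha>\<^sup>2 - h\<^sup>2) * D + 2 * \<alpha> * h * h)"
    unfolding Y unfolding X' shape_bilinear[OF d] unfolding D2 h2 by (simp add: power2_eq_square algebra_simps)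
  also have "\<dots> = s\<^sup>2 * (2 * \<alpha> * R\<^sup>2)" unfolding id1 R2 by (simp add: power2_eq_square algebra_simps)
  also have "\<dots> > 0" using s \<alpha> \<open>R > 0\<close> by simp
  finally show "principal_frame \<eta> (snd q) (pdir \<eta> q)"
    using nX off by (simp add: principal_frame_def X' inner_simps an bn)
  have fq: "fst q = a + (fst q \<bullet> ?n) *\<^sub>R ?n" by (simp add: a_def dproj_def)
  have "a \<bullet> fst q = a \<bullet> a" "b \<bullet> fst q = 0"
    using arg_cong[OF fq, of "\<lambda>v. a \<bullet> v"] arg_cong[OF fq, of "\<lambda>v. b \<bullet> v"]
    unfolding inner_add_right inner_scaleR_right an bn by auto
  then show "pdir \<eta> q \<bullet> fst q > 0" using s \<alpha> aa by (simp add: X' inner_simps)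
qed

lemma pdir_eqI:
  assumes "\<eta> differentiable (at (snd q))" "norm (\<eta> (snd q)) = 1" "q \<in> pdom \<eta>"
    and "principal_frame \<eta> (snd q) X" "X \<bullet> fst q > 0"
  shows "pdir \<eta> q = X"
  using principal_frame_unique[OF assms(1,2,4) pdir_frame(1)[OF assms(1-3)]] pdir_frame(2)[OF assms(1-3)] assms(5)
  by auto

lemma pdir_self:
  assumes "\<eta> differentiable (at x)" "norm (\<eta> x) = 1" "principal_frame \<eta> x X"
  shows "(X, x) \<in> pdom \<eta>" "pdir \<eta> (X, x) = X"
proof -
  show p: "(X, x) \<in> pdom \<eta>"
    using assms(3) by (simp add: pdom_def ddiag_def dcross_def dproj_def principal_frame_def)
  show "pdir \<eta> (X, x) = X"
    by (rule pdir_eqI) (use assms p in \<open>auto simp: principal_frame_def norm_eq_1\<close>)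
qed

lemma smooth_on_pdir:
  assumes \<eta>: "smooth_on UNIV \<eta>" and n: "\<And>p. norm (\<eta> p) = 1"
  shows "open (pdom \<eta>)" "smooth_on (pdom \<eta>) (pdir \<eta>)"
proof -
  have comp: "smooth_on UNIV (\<lambda>q::E3 \<times> E3. \<eta> (snd q))"
    by (rule smooth_on_compose[OF _ \<eta> smooth_on_snd]) auto
  have a: "smooth_on UNIV (dproj \<eta>)"
    unfolding dproj_def by (intro smooth_intros comp open_UNIV)
  have b: "smooth_on UNIV (dcross \<eta>)"
    unfolding dcross_def by (intro smooth_intros comp a open_UNIV)
  have fd: "smooth_on UNIV (\<lambda>q::E3 \<times> E3. frechet_derivative \<eta> (at (snd q)) (w q))" if "smooth_on UNIV w" for w
    by (rule smooth_on_frechet_comp[OF _ \<eta> smooth_on_snd _ that]) auto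
  have D: "smooth_on UNIV (ddiag \<eta>)" and h: "smooth_on UNIV (doff \<eta>)"
    unfolding ddiag_def doff_def shape_def by (intro smooth_intros a b fd open_UNIV)+
  show op: "open (pdom \<eta>)"
    unfolding pdom_def by (intro open_Collect_less continuous_intros smooth_on_continuous_on[OF D])
  note sub = smooth_on_subset[of UNIV _ "pdom \<eta>", OF _ subset_UNIV]
  have X: "smooth_on (pdom \<eta>) (pvec \<eta>)"
    unfolding pvec_def
    by (intro smooth_intros op sub[OF D] sub[OF h] sub[OF a] sub[OF b]) (auto simp: pdom_def add_pos_nonneg)
  have "pvec \<eta> q \<bullet> pvec \<eta> q > 0" if "q \<in> pdom \<eta>" for q
    by (rule pdir_frame(3)[OF smooth_on_differentiable[OF \<eta>] n that]) simp
  then show "smooth_on (pdom \<eta>) (pdir \<eta>)"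
    unfolding pdir_def
    by (intro smooth_intros op X) (auto dest: less_imp_neq)
qed

section \<open>Hyperbolicity from the variational equation\<close>

text \<open>Passes from the existentially given velocity of \<open>principal_line\<close> to
  \<open>vector_derivative\<close> and to frames. The velocity is periodic because \<gamma> is
  parametrised and periodic on the whole line, so its orientation cannot flip after one
  turn.\<close>

lemma principal_cycleD:
  assumes \<eta>: "smooth_on UNIV \<eta>" and n: "\<And>p. norm (\<eta> p) = 1"
    and cyc: "principal_cycle \<eta> (k_min \<eta>) \<gamma> L"
  shows "(\<gamma> has_vector_derivative vector_derivative \<gamma> (at t)) (at t)"
    and "continuous_on UNIV (\<lambda>t. vector_derivative \<gamma> (at t))"
    and "principal_frame \<eta> (\<gamma> t) (vector_derivative \<gamma> (at t))"
    and "vector_derivative \<gamma> (at (t + L)) = vector_derivative \<gamma> (at t)"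
proof -
  obtain c' where c': "continuous_on UNIV c'" "\<And>t. (\<gamma> has_vector_derivative c' t) (at t)"
    "\<And>t. norm (c' t) = 1" "\<And>t. \<gamma> t \<notin> partially_umbilic \<eta>" "\<And>t. principal_direction \<eta> (k_min \<eta>) (\<gamma> t) (c' t)"
    using cyc unfolding principal_cycle_def principal_line_def by auto
  have eq: "vector_derivative \<gamma> (at t) = c' t" for t
    by (rule vector_derivative_at) (rule c'(2))
  show "(\<gamma> has_vector_derivative vector_derivative \<gamma> (at t)) (at t)"
    and "continuous_on UNIV (\<lambda>t. vector_derivative \<gamma> (at t))"
    using c' by (simp_all add: eq)
  show "principal_frame \<eta> (\<gamma> t) (vector_derivative \<gamma> (at t))"
    unfolding eq by (intro principal_direction_frame smooth_on_differentiable[OF \<eta>] n c') simp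
  have per: "\<gamma> (s + L) = \<gamma> s" for s using cyc by (simp add: principal_cycle_def)
  have "((\<lambda>s. \<gamma> (s + L)) has_vector_derivative c' (t + L)) (at t)"
    using vector_diff_chain_at[of "\<lambda>s. s + L" 1 t \<gamma> "c' (t + L)"] c'(2)
    by (simp add: o_def has_vector_derivative_add_const)
  then have "(\<gamma> has_vector_derivative c' (t + L)) (at t)" by (simp add: per)
  then have "c' (t + L) = c' t" using c'(2) vector_derivative_unique_at by blast
  then show "vector_derivative \<gamma> (at (t + L)) = vector_derivative \<gamma> (at t)" by (simp add: eq)
qed

definition vfield :: "(E3 \<Rightarrow> E3) \<Rightarrow> (real \<Rightarrow> E3) \<Rightarrow> real \<Rightarrow> E3 \<Rightarrow> E3" where
  "vfield \<eta> \<gamma> t x = pdir \<eta> (vector_derivative \<gamma> (at t), x)"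

text \<open>Taken as a partial derivative of the joint map \<open>pdir \<eta>\<close>, so that
  continuity in \<open>t\<close> follows from joint smoothness and the mere continuity of velocity
  and position.\<close>

definition variation :: "(E3 \<Rightarrow> E3) \<Rightarrow> (real \<Rightarrow> E3) \<Rightarrow> real \<Rightarrow> E3 \<Rightarrow> E3" where
  "variation \<eta> \<gamma> t v = frechet_derivative (pdir \<eta>) (at (vector_derivative \<gamma> (at t), \<gamma> t)) (0, v)"

text \<open>Kept polymorphic because it is applied both to \<gamma> and to the pair of position and
  velocity.\<close>

lemma periodic_representative:
  fixes \<gamma> :: "real \<Rightarrow> 'a"
  assumes "\<And>s. \<gamma> (s + L) = \<gamma> s" "L > 0"
  obtains s where "s \<in> {0..<L}" "\<gamma> s = \<gamma> t"
proof -
  have nat: "\<gamma> (s + real n * L) = \<gamma> s" for s n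
  proof (induction n)
    case (Suc n)
    have "\<gamma> (s + real (Suc n) * L) = \<gamma> ((s + real n * L) + L)" by (simp add: algebra_simps)
    then show ?case using Suc assms(1) by simp
  qed simp
  have int: "\<gamma> (s + of_int k * L) = \<gamma> s" for s k
  proof (cases "k \<ge> 0")
    case True then show ?thesis using nat[of s "nat k"] by simp
  next
    case False
    then show ?thesis using nat[of "s + of_int k * L" "nat (- k)"] by (simp add: algebra_simps)
  qed
  define s where "s = t + of_int (- \<lfloor>t / L\<rfloor>) * L"
  have "s \<in> {0..<L}"
    using floor_divide_lower[OF assms(2), of t] floor_divide_upper[OF assms(2), of t]
    by (auto simp: s_def algebra_simps)
  moreover have "\<gamma> s = \<gamma> t" unfolding s_def by (rule int)
  ultimately show ?thesis using that by blast
qed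

lemma matrix_vector_derivative2:
  fixes e2 e3 :: "real ^ 3"
  assumes "P' = (\<lambda>u :: real ^ 2. vector [e2 \<bullet> (u $ 1 *\<^sub>R a + u $ 2 *\<^sub>R b), e3 \<bullet> (u $ 1 *\<^sub>R a + u $ 2 *\<^sub>R b)] :: real ^ 2)"
  shows "matrix P' = vector [vector [e2 \<bullet> a, e2 \<bullet> b], vector [e3 \<bullet> a, e3 \<bullet> b]]"
  unfolding assms by (simp add: matrix_def vec_eq_iff forall_2 axis_def)

lemma variation_derivative:
  assumes \<eta>: "smooth_on UNIV \<eta>" and n: "\<And>p. norm (\<eta> p) = 1"
    and cyc: "principal_cycle \<eta> (k_min \<eta>) \<gamma> L"
  shows "linear (variation \<eta> \<gamma> t)" and "continuous_on UNIV (\<lambda>t. variation \<eta> \<gamma> t v)"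
    and "((\<lambda>x. vfield \<eta> \<gamma> t x) has_derivative variation \<eta> \<gamma> t) (at (\<gamma> t))"
    and "vfield \<eta> \<gamma> t (\<gamma> t) = vector_derivative \<gamma> (at t)"
    and "(vector_derivative \<gamma> (at t), \<gamma> t) \<in> pdom \<eta>"
proof -
  note cd = principal_cycleD[OF \<eta> n cyc]
  note ps = smooth_on_pdir[OF \<eta> n]
  let ?q = "\<lambda>t. (vector_derivative \<gamma> (at t), \<gamma> t)"
  have q: "?q t \<in> pdom \<eta>" "pdir \<eta> (?q t) = vector_derivative \<gamma> (at t)" for t
    by (rule pdir_self[OF smooth_on_differentiable[OF \<eta>] n cd(3)], simp)+
  show "?q t \<in> pdom \<eta>" "vfield \<eta> \<gamma> t (\<gamma> t) = vector_derivative \<gamma> (at t)"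
    by (auto simp: q vfield_def)
  have cq: "continuous_on UNIV ?q"
    by (intro continuous_intros cd(2) has_vector_derivative_continuous_on[OF cd(1)])
  have d: "(pdir \<eta> has_derivative frechet_derivative (pdir \<eta>) (at (?q t))) (at (?q t))" for t
    by (rule smooth_on_has_derivative[OF ps(2) q(1)])
  then show der: "((\<lambda>x. vfield \<eta> \<gamma> t x) has_derivative variation \<eta> \<gamma> t) (at (\<gamma> t))"
    unfolding vfield_def variation_def[abs_def]
    by (rule has_derivative_compose[where f = "\<lambda>x. (vector_derivative \<gamma> (at t), x)", rotated])
       (auto intro!: derivative_eq_intros)
  then show "linear (variation \<eta> \<gamma> t)" by (rule has_derivative_linear)
  show "continuous_on UNIV (\<lambda>t. variation \<eta> \<gamma> t v)"
    unfolding variation_def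
    by (rule continuous_on_compose2[OF smooth_on_continuous_on[OF smooth_on_frechet[OF ps(2)]] cq])
       (use q in auto)
qed

text \<open>The section is a flat disc in the plane normal to the cycle. Joint smoothness of
  \<open>pdir\<close> near the compact curve of velocity-position pairs yields the uniform estimates
  for the return map, and the orbits found there are leaves because all values of
  \<open>pdir\<close> on its domain are principal frames.\<close>

lemma hyperbolic_principal_cycleI:
  assumes \<eta>: "smooth_on UNIV \<eta>" and n: "\<And>p. norm (\<eta> p) = 1"
    and cyc: "principal_cycle \<eta> (k_min \<eta>) \<gamma> L"
    and on: "norm e2 = 1" "norm e3 = 1" "vector_derivative \<gamma> (at 0) \<bullet> e2 = 0"
      "vector_derivative \<gamma> (at 0) \<bullet> e3 = 0" "e2 \<bullet> e3 = 0"
    and y: "\<And>t. t \<in> {0..L} \<Longrightarrow> (y2 has_vector_derivative variation \<eta> \<gamma> t (y2 t)) (at t within {0..L})"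
      "\<And>t. t \<in> {0..L} \<Longrightarrow> (y3 has_vector_derivative variation \<eta> \<gamma> t (y3 t)) (at t within {0..L})"
      "y2 0 = e2" "y3 0 = e3"
    and hyp: "\<And>z. complex_eigenvalue (vector [vector [e2 \<bullet> y2 L, e2 \<bullet> y3 L], vector [e3 \<bullet> y2 L, e3 \<bullet> y3 L]] :: real ^ 2 ^ 2) z
        \<Longrightarrow> z \<notin> sphere 0 1"
  shows "hyperbolic_principal_cycle \<eta> (k_min \<eta>) \<gamma> L"
proof -
  note cd = principal_cycleD[OF \<eta> n cyc]
  note vb = variation_derivative[OF \<eta> n cyc]
  note ps = smooth_on_pdir[OF \<eta> n]
  have L: "L > 0" "\<gamma> L = \<gamma> 0" "inj_on \<gamma> {0..<L}" and per: "\<And>s. \<gamma> (s + L) = \<gamma> s"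
    using cyc unfolding principal_cycle_def by (auto dest: spec[of _ 0])
  let ?\<gamma>' = "\<lambda>t. vector_derivative \<gamma> (at t)"
  let ?q = "\<lambda>t. (?\<gamma>' t, \<gamma> t)"
  have c\<gamma>: "continuous_on X \<gamma>" for X
    by (rule has_vector_derivative_continuous_on) (rule has_vector_derivative_at_within[OF cd(1)])
  have cq: "continuous_on X ?q" for X
    by (intro continuous_intros continuous_on_subset[OF cd(2)] c\<gamma>) auto
  \<comment> \<open>The compact curve on which uniform estimates are taken; time runs to
    \<open>L + 1\<close> because nearby leaves may return after the period.\<close>
  define C where "C = ?q ` {0..L + 1}"
  have C: "compact C" "C \<subseteq> pdom \<eta>" "C \<noteq> {}"
    using L vb(5) by (auto simp: C_def intro!: compact_continuous_image cq)
  obtain \<rho> K where \<rho>: "\<rho> > 0" and K: "K \<ge> 0"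
    and dom: "\<And>q z. q \<in> C \<Longrightarrow> norm z \<le> \<rho> \<Longrightarrow> q + z \<in> pdom \<eta>"
    and lip: "\<And>q z z'. q \<in> C \<Longrightarrow> norm z \<le> \<rho> \<Longrightarrow> norm z' \<le> \<rho> \<Longrightarrow>
           norm (pdir \<eta> (q + z) - pdir \<eta> (q + z')) \<le> K * norm (z - z')"
    and bd: "\<And>q z. q \<in> C \<Longrightarrow> norm (frechet_derivative (pdir \<eta>) (at q) z) \<le> K * norm z"
    and lin: "\<And>\<omega>. \<omega> > 0 \<Longrightarrow> \<exists>r>0. \<forall>q\<in>C. \<forall>z. norm z \<le> r \<longrightarrow>
           norm (pdir \<eta> (q + z) - pdir \<eta> q - frechet_derivative (pdir \<eta>) (at q) z) \<le> \<omega> * norm z"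
    by (rule C1_uniform[OF smooth_on_Ck[OF ps(2)] ps(1) C], rule that)
  define F where "F t z = vfield \<eta> \<gamma> t (\<gamma> t + z)" for t z
  have F: "F t z = pdir \<eta> (?q t + (0, z))" for t z by (simp add: F_def vfield_def)
  have qC: "?q t \<in> C" if "t \<in> {0..L + 1}" for t using that by (auto simp: C_def)
  define e1 where "e1 = ?\<gamma>' 0"
  have ne1: "norm e1 = 1" using cd(3)[of 0] by (simp add: e1_def principal_frame_def)
  have F0: "F t 0 = ?\<gamma>' t" for t using vb(4) by (simp add: F_def)
  have e1F: "F 0 0 = e1" "F L 0 = e1" using cd(4)[of 0] by (simp_all add: F0 e1_def)
  have contF: "continuous_on ({0..L + 1} \<times> cball 0 \<rho>) (\<lambda>(t, z). F t z)"
    unfolding F case_prod_unfold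
  proof (rule continuous_on_compose2[OF smooth_on_continuous_on[OF ps(2)]])
    show "continuous_on ({0..L + 1} \<times> cball 0 \<rho>) (\<lambda>p. ?q (fst p) + (0, snd p))"
      by (intro continuous_on_add continuous_on_compose2[OF cq[of UNIV]] continuous_intros) auto
    show "(\<lambda>p. ?q (fst p) + (0, snd p)) ` ({0..L + 1} \<times> cball 0 \<rho>) \<subseteq> pdom \<eta>"
    proof (rule image_subsetI)
      fix p assume "p \<in> {0..L + 1} \<times> cball (0::E3) \<rho>"
      then show "?q (fst p) + (0, snd p) \<in> pdom \<eta>"
        by (intro dom qC) (auto simp: norm_Pair)
    qed
  qed
  have lipF: "norm (F t z - F t z') \<le> K * norm (z - z')"
    if "t \<in> {0..L + 1}" "norm z \<le> \<rho>" "norm z' \<le> \<rho>" for t z z'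
    using lip[OF qC[OF that(1)], of "(0, z)" "(0, z')"] that unfolding F by (simp add: norm_Pair)
  have linF: "\<exists>r>0. \<forall>t\<in>{0..L}. \<forall>x. norm x \<le> r \<longrightarrow> norm (F t x - F t 0 - variation \<eta> \<gamma> t x) \<le> \<omega> * norm x"
    if "\<omega> > 0" for \<omega>
  proof -
    obtain r where r: "r > 0" "\<And>q z. q \<in> C \<Longrightarrow> norm z \<le> r \<Longrightarrow>
        norm (pdir \<eta> (q + z) - pdir \<eta> q - frechet_derivative (pdir \<eta>) (at q) z) \<le> \<omega> * norm z"
      using lin[OF \<open>\<omega> > 0\<close>] by blast
    have "norm (F t x - F t 0 - variation \<eta> \<gamma> t x) \<le> \<omega> * norm x" if "t \<in> {0..L}" "norm x \<le> r" for t x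
      using r(2)[OF qC, of t "(0, x)"] that by (simp add: F variation_def norm_Pair)
    then show ?thesis using r(1) by blast
  qed
  have bdA: "norm (variation \<eta> \<gamma> t x) \<le> K * norm x" if "t \<in> {0..L}" for t x
    using bd[OF qC, of t "(0, x)"] that by (simp add: variation_def norm_Pair)
  have d\<gamma>: "(\<gamma> has_vector_derivative F t 0) (at t)" for t using cd(1) by (simp add: F0)
  define pr where "pr = (\<lambda>x. vector [e2 \<bullet> x, e3 \<bullet> x] :: real ^ 2)"
  define \<sigma> where "\<sigma> = (\<lambda>u :: real ^ 2. \<gamma> 0 + (u $ 1 *\<^sub>R e2 + u $ 2 *\<^sub>R e3))"
  obtain R V P where R: "R > 0" and V: "open V" "0 \<in> V" "V \<subseteq> ball 0 R"
    and sec: "\<forall>t\<in>{0<..<L}. \<gamma> t \<notin> \<sigma> ` ball 0 R"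
    and P: "\<forall>u\<in>V. P u \<in> ball 0 R \<and> (\<exists>c T. 0 < T \<and> T \<le> L + 1 \<and> c 0 = \<sigma> u \<and> c T = \<sigma> (P u) \<and>
        (\<forall>t\<in>{0<..<T}. c t \<notin> \<sigma> ` ball 0 R) \<and> F 0 (c 0 - \<gamma> 0) \<bullet> e1 > 0 \<and>
        (\<forall>t\<in>{0..T}. norm (c t - \<gamma> t) \<le> \<rho> \<and>
           (c has_vector_derivative F t (c t - \<gamma> t)) (at t within {0..T})))"
    and P': "(P has_derivative (\<lambda>u. pr (u $ 1 *\<^sub>R y2 L + u $ 2 *\<^sub>R y3 L))) (at 0)"
    by (rule return_map_derivative[OF pr_def \<sigma>_def L d\<gamma> e1F ne1 on(1,2) on(3,4)[folded e1_def] on(5)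
          \<rho> K contF lipF linF vb(1) bdA y])
  let ?U = "ball (0 :: real ^ 2) R"
  define s where "s u = u $ 1 *\<^sub>R e2 + u $ 2 *\<^sub>R e3" for u :: "real ^ 2"
  have \<sigma>s: "\<sigma> = (\<lambda>u. \<gamma> 0 + s u)" by (simp add: \<sigma>_def s_def)
  have prs: "pr (s u) = u" for u
    using on(1,2,5) by (simp add: pr_def s_def vec_eq_iff forall_2 inner_simps norm_eq_1 inner_commute)
  have "bounded_linear s"
    unfolding s_def by (intro bounded_linear_add bounded_linear_compose[OF bounded_linear_scaleR_left] bounded_linear_vec_nth)
  then have d\<sigma>: "(\<sigma> has_derivative s) (at u)" for u
    unfolding \<sigma>s by (auto intro!: derivative_eq_intros bounded_linear_imp_has_derivative)
  have fd\<sigma>: "frechet_derivative \<sigma> (at u) = s" for u by (rule frechet_derivativeI[OF d\<sigma>])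
  have cpr: "continuous_on X pr" for X
  proof -
    have "pr = (\<lambda>x. (e2 \<bullet> x) *\<^sub>R axis 1 1 + (e3 \<bullet> x) *\<^sub>R axis 2 1)"
      by (auto simp: pr_def vec_eq_iff forall_2 axis_def)
    then show ?thesis by (auto intro!: continuous_intros)
  qed
  have "transversal_section \<gamma> ?U \<sigma>"
    unfolding transversal_section_def
  proof (intro conjI ballI exI[of _ "\<lambda>x. pr (x - \<gamma> 0)"])
    show "Ck_on 1 ?U \<sigma>"
      unfolding \<sigma>s by (intro smooth_on_Ck smooth_on_add smooth_on_const smooth_on_bounded_linear \<open>bounded_linear s\<close>) simp
    show "homeomorphism ?U (\<sigma> ` ?U) \<sigma> (\<lambda>x. pr (x - \<gamma> 0))"
    proof (rule homeomorphismI)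
      show "continuous_on ?U \<sigma>"
        by (rule has_derivative_continuous_on) (rule has_derivative_at_withinI[OF d\<sigma>])
      show "continuous_on (\<sigma> ` ?U) (\<lambda>x. pr (x - \<gamma> 0))"
        by (rule continuous_on_compose2[OF cpr[of UNIV]]) (auto intro!: continuous_intros)
    qed (auto simp: \<sigma>s prs)
    show "inj (frechet_derivative \<sigma> (at u))" for u
      unfolding fd\<sigma> by (metis injI prs)
    show "\<sigma> 0 = \<gamma> 0" by (simp add: \<sigma>_def)
    \<comment> \<open>On one period only the parameter 0 leads into the disc. Other parameters
      reduce to it by periodicity, so the whole cycle meets the disc in a single point.\<close>
    have "t0 = 0" if t0: "t0 \<in> {0..<L}" "\<gamma> t0 \<in> \<sigma> ` ?U" for t0
      using sec t0 by (cases "t0 = 0") auto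
    then have eq: "\<gamma> t = \<gamma> 0" if "\<gamma> t \<in> \<sigma> ` ?U" for t
      using periodic_representative[where \<gamma> = \<gamma> and L = L and t = t, OF per L(1)] that by metis
    have "0 \<in> ?U" using R by simp
    then have "\<gamma> 0 \<in> \<sigma> ` ?U" by (rule rev_image_eqI) (simp add: \<open>\<sigma> 0 = \<gamma> 0\<close>)
    then have "{\<gamma> 0} \<subseteq> \<sigma> ` ?U \<inter> range \<gamma>" by simp
    moreover have "x = \<gamma> 0" if x: "x \<in> \<sigma> ` ?U \<inter> range \<gamma>" for x
    proof -
      obtain t where "x = \<gamma> t" using x by fast
      then show ?thesis using eq[of t] x by simp
    qed
    ultimately show "\<sigma> ` ?U \<inter> range \<gamma> = {\<gamma> 0}" by fast
    have "?\<gamma>' 0 \<bullet> s u = 0" for u using on by (simp add: s_def inner_simps)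
    moreover have "?\<gamma>' 0 \<bullet> ?\<gamma>' 0 = 1" using ne1 by (simp add: e1_def norm_eq_1)
    ultimately show "?\<gamma>' 0 \<notin> range (frechet_derivative \<sigma> (at 0))"
      unfolding fd\<sigma> by (metis imageE zero_neq_one)
  qed (use R in auto)
  moreover have "poincare_map \<eta> (k_min \<eta>) \<gamma> ?U \<sigma> P"
    unfolding poincare_map_def
  proof (intro exI[of _ V] conjI ballI V)
    fix u assume "u \<in> V"
    from bspec[OF P this] obtain c T where PU: "P u \<in> ?U" and T: "0 < T" "T \<le> L + 1" and c0: "c 0 = \<sigma> u" "c T = \<sigma> (P u)"
      and first: "\<forall>t\<in>{0<..<T}. c t \<notin> \<sigma> ` ?U" and pos: "F 0 (c 0 - \<gamma> 0) \<bullet> e1 > 0"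
      and near: "\<And>t. t \<in> {0..T} \<Longrightarrow> norm (c t - \<gamma> t) \<le> \<rho>"
      and vd: "\<And>t. t \<in> {0..T} \<Longrightarrow> (c has_vector_derivative F t (c t - \<gamma> t)) (at t within {0..T})"
      by auto
    show "P u \<in> ?U" by fact
    have cc: "continuous_on {0..T} c" by (rule has_vector_derivative_continuous_on[OF vd])
    have "vector_derivative c (at 0 within {0..T}) = F 0 (c 0 - \<gamma> 0)"
      using vector_derivative_within_cbox[of 0 T 0 c] vd[of 0] T by (simp add: cbox_interval)
    moreover have "principal_line \<eta> (k_min \<eta>) {0..T} c"
      unfolding principal_line_def
    proof (intro exI[of _ "\<lambda>t. F t (c t - \<gamma> t)"] conjI ballI vd)
      have "continuous_on {0..T} (\<lambda>t. (\<lambda>(t, z). F t z) (t, c t - \<gamma> t))"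
        by (rule continuous_on_compose2[OF contF]) (use T near in \<open>auto intro!: continuous_intros cc c\<gamma>\<close>)
      then show "continuous_on {0..T} (\<lambda>t. F t (c t - \<gamma> t))" by simp
      fix t assume t: "t \<in> {0..T}"
      have qd: "?q t + (0, c t - \<gamma> t) \<in> pdom \<eta>"
        by (rule dom[OF qC]) (use t T near[OF t] in \<open>auto simp: norm_Pair\<close>)
      have fr: "principal_frame \<eta> (c t) (F t (c t - \<gamma> t))"
        using pdir_frame(1)[OF smooth_on_differentiable[OF \<eta>] n qd] by (simp add: F)
      show "norm (F t (c t - \<gamma> t)) = 1" using fr by (simp add: principal_frame_def)
      note pf = principal_frame_direction[OF smooth_on_differentiable[OF \<eta>] n fr]
      show "c t \<notin> partially_umbilic \<eta>" "principal_direction \<eta> (k_min \<eta>) (c t) (F t (c t - \<gamma> t))"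
        by (rule pf, simp)+
    qed
    ultimately show "first_return \<eta> (k_min \<eta>) \<gamma> (\<sigma> ` ?U) (\<sigma> u) (\<sigma> (P u))"
      unfolding first_return_def using T c0 first pos PU by (intro exI[of _ c] exI[of _ T]) (auto simp: e1_def)
  qed
  moreover have "matrix (\<lambda>u :: real ^ 2. pr (u $ 1 *\<^sub>R y2 L + u $ 2 *\<^sub>R y3 L)) =
      (vector [vector [e2 \<bullet> y2 L, e2 \<bullet> y3 L], vector [e3 \<bullet> y2 L, e3 \<bullet> y3 L]] :: real ^ 2 ^ 2)"
    by (rule matrix_vector_derivative2) (simp add: pr_def)
  ultimately show ?thesis
    unfolding hyperbolic_principal_cycle_def using cyc P' hyp
    by (intro conjI exI[of _ ?U] exI[of _ \<sigma>] exI[of _ P] exI[of _ "\<lambda>u. pr (u $ 1 *\<^sub>R y2 L + u $ 2 *\<^sub>R y3 L)"]) auto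
qed

section \<open>Rotating a field about a curve\<close>

text \<open>The function \<open>\<theta>\<close> vanishes on \<open>Z\<close>; its first derivative there is prescribed, and the quadratic
  terms adjust the derivative of \<open>D\<theta> \<cdot> \<tau>\<close> without affecting the first derivative.\<close>

lemma angle_function:
  fixes B V Z :: "E3 set" and \<xi> \<eta> y \<tau> :: "E3 \<Rightarrow> E3" and \<mu> \<kappa> m :: "E3 \<Rightarrow> real"
  assumes B: "open B" and sm: "smooth_on B \<xi>" "smooth_on B \<eta>" "smooth_on B y" "smooth_on B \<tau>"
      "smooth_on B \<mu>" "smooth_on B \<kappa>" "smooth_on B m"
    and V: "open V" "\<And>p. p \<in> B \<inter> V \<Longrightarrow> \<mu> p = 0"
    and Z: "Z \<subseteq> B" "\<And>p. p \<in> Z \<Longrightarrow> norm (\<eta> p) = 1 \<and> norm (\<xi> p) = 1 \<and> \<xi> p \<bullet> \<eta> p = 0 \<and> \<tau> p = cross3 (\<eta> p) (\<xi> p)"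
    and y: "\<And>p. p \<in> Z \<Longrightarrow> y p = 0"
      "\<And>p v. p \<in> Z \<Longrightarrow> \<exists>l. frechet_derivative y (at p) v = v - l *\<^sub>R \<xi> p"
    and curve: "\<And>p. p \<in> Z \<Longrightarrow> \<exists>c. c 0 = p \<and> (c has_vector_derivative \<xi> p) (at 0) \<and> (\<forall>\<^sub>F t in nhds 0. c t \<in> Z)"
  obtains \<theta> where "smooth_on B \<theta>" "\<And>p. p \<in> B \<inter> V \<Longrightarrow> \<theta> p = 0" "\<And>p. p \<in> Z \<Longrightarrow> \<theta> p = 0"
    "\<And>p v. p \<in> Z \<Longrightarrow> frechet_derivative \<theta> (at p) v = - \<mu> p * (v \<bullet> \<eta> p)"
    "\<And>p v. p \<in> Z \<Longrightarrow> frechet_derivative (\<lambda>x. frechet_derivative \<theta> (at x) (\<tau> x)) (at p) v =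
        2 * \<kappa> p * \<mu> p * (v \<bullet> \<tau> p) + m p * \<mu> p * (v \<bullet> \<eta> p)"
proof -
  note sd = smooth_on_has_derivative
  \<comment> \<open>On \<open>Z\<close> the differential of \<open>y\<close> is the identity modulo
    \<xi>, so \<open>w\<close> and \<open>u\<close> are, to first order there, the coordinates along
    \<eta> and \<tau>.\<close>
  define w where "w x = y x \<bullet> \<eta> x" for x
  define u where "u x = y x \<bullet> \<tau> x" for x
  define \<theta>1 where "\<theta>1 x = - \<mu> x * w x" for x
  define G where "G x = frechet_derivative \<theta>1 (at x) (\<tau> x)" for x
  \<comment> \<open>Prescribed derivative minus what \<theta>1 already contributes: \<open>a\<close>
    and \<open>b\<close> are the second-order corrections still missing in the directions \<tau> and
    \<eta>.\<close>
  define a where "a x = 2 * \<kappa> x * \<mu> x - frechet_derivative G (at x) (\<tau> x)" for x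
  define b where "b x = m x * \<mu> x - frechet_derivative G (at x) (\<eta> x)" for x
  define \<theta> where "\<theta> x = \<theta>1 x + (1/2 * a x * (u x * u x) + b x * (u x * w x))" for x
  have sw: "smooth_on B w" and su: "smooth_on B u"
    unfolding w_def u_def by (intro smooth_intros B sm)+
  have s\<theta>1: "smooth_on B \<theta>1" unfolding \<theta>1_def by (intro smooth_intros B sm sw)
  have sG: "smooth_on B G" unfolding G_def by (intro smooth_intros B sm s\<theta>1)
  have sa: "smooth_on B a" and sb: "smooth_on B b"
    unfolding a_def b_def by (intro smooth_intros B sm sG)+
  have s\<theta>: "smooth_on B \<theta>" unfolding \<theta>_def by (intro smooth_intros B s\<theta>1 sa sb su sw)
  let ?D = "\<lambda>f x. frechet_derivative f (at x)"
  have zero: "\<theta> p = 0" if p: "p \<in> B \<inter> V" for p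
  proof -
    have o: "open (B \<inter> V)" using B V by blast
    have f0: "?D f x v = 0" if "\<And>x. x \<in> B \<inter> V \<Longrightarrow> f x = 0" "x \<in> B \<inter> V" for f :: "E3 \<Rightarrow> real" and x v
      using frechet_derivative_cong_open(1)[OF o that(2), of f "\<lambda>_. 0"] that(1) by (simp add: frechet_derivative_const)
    have 1: "\<theta>1 x = 0" if "x \<in> B \<inter> V" for x using V(2)[OF that] by (simp add: \<theta>1_def)
    have 2: "G x = 0" if "x \<in> B \<inter> V" for x unfolding G_def by (rule f0[OF 1 that])
    have "a p = 0" "b p = 0" using f0[OF 2 p] V(2)[OF p] by (simp_all add: a_def b_def)
    then show ?thesis using 1[OF p] by (simp add: \<theta>_def)
  qed
  have at_Z: "w p = 0" "u p = 0" "\<theta>1 p = 0" "\<theta> p = 0" if "p \<in> Z" for p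
    using y(1)[OF that] by (simp_all add: w_def u_def \<theta>1_def \<theta>_def)
  have Zp: "\<eta> p \<bullet> \<eta> p = 1" "\<tau> p \<bullet> \<tau> p = 1" "\<tau> p \<bullet> \<eta> p = 0" "\<xi> p \<bullet> \<tau> p = 0" "\<xi> p \<bullet> \<eta> p = 0" if "p \<in> Z" for p
    using Z(2)[OF that] cross3_orthonormal[of "\<eta> p" "\<xi> p"] by (auto simp: norm_eq_1)
  have Dw: "?D w p v = v \<bullet> \<eta> p" and Du: "?D u p v = v \<bullet> \<tau> p" if p: "p \<in> Z" for p v
  proof -
    have pB: "p \<in> B" using Z p by blast
    obtain l where l: "?D y p v = v - l *\<^sub>R \<xi> p" using y(2)[OF p] by blast
    have "(w has_derivative (\<lambda>v. y p \<bullet> ?D \<eta> p v + ?D y p v \<bullet> \<eta> p)) (at p)"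
      unfolding w_def by (intro has_derivative_inner sd[OF sm(2) pB] sd[OF sm(3) pB])
    from frechet_derivativeI[OF this] show "?D w p v = v \<bullet> \<eta> p"
      using y(1)[OF p] l Zp[OF p] by (simp add: inner_simps)
    have "(u has_derivative (\<lambda>v. y p \<bullet> ?D \<tau> p v + ?D y p v \<bullet> \<tau> p)) (at p)"
      unfolding u_def by (intro has_derivative_inner sd[OF sm(4) pB] sd[OF sm(3) pB])
    from frechet_derivativeI[OF this] show "?D u p v = v \<bullet> \<tau> p"
      using y(1)[OF p] l Zp[OF p] by (simp add: inner_simps)
  qed
  have D\<theta>1: "?D \<theta>1 p v = - \<mu> p * (v \<bullet> \<eta> p)" if p: "p \<in> Z" for p v
  proof -
    have pB: "p \<in> B" using Z p by blast
    have "(\<theta>1 has_derivative (\<lambda>v. - \<mu> p * ?D w p v + (- ?D \<mu> p v) * w p)) (at p)"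
      unfolding \<theta>1_def by (intro has_derivative_mult has_derivative_minus sd[OF sm(5) pB] sd[OF sw pB])
    from frechet_derivativeI[OF this] show ?thesis
      using at_Z[OF p] Dw[OF p] by simp
  qed
  have GZ: "G p = 0" if "p \<in> Z" for p using D\<theta>1[OF that] Zp[OF that] by (simp add: G_def)
  \<comment> \<open>\<open>G\<close> vanishes on \<open>Z\<close>, and \<open>Z\<close> contains a
    curve with velocity \<xi>. The tangential derivative is therefore zero automatically, which
    matches a prescription without a term along \<xi>.\<close>
  have DG\<xi>: "?D G p (\<xi> p) = 0" if p: "p \<in> Z" for p
  proof -
    have pB: "p \<in> B" using Z p by blast
    obtain c where c: "c 0 = p" "(c has_vector_derivative \<xi> p) (at 0)" "\<forall>\<^sub>F t in nhds 0. c t \<in> Z"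
      using curve[OF p] by blast
    have "((\<lambda>t. G (c t)) has_derivative (\<lambda>h. ?D G p (h *\<^sub>R \<xi> p))) (at 0)"
      using has_derivative_compose[of c "\<lambda>h. h *\<^sub>R \<xi> p" 0 UNIV G "?D G p"] c(1,2) sd[OF sG pB]
      by (simp add: has_vector_derivative_def)
    moreover have "((\<lambda>t. G (c t)) has_derivative (\<lambda>h. 0)) (at 0)"
    proof -
      have "\<forall>\<^sub>F t in nhds 0. 0 = G (c t)" using c(3) by eventually_elim (simp add: GZ)
      then obtain S where "open S" "0 \<in> S" "\<And>t. t \<in> S \<Longrightarrow> 0 = G (c t)"
        unfolding eventually_nhds by blast
      then show ?thesis by (intro has_derivative_transform_within_open[OF has_derivative_const[of 0]]) auto
    qed
    ultimately have "(\<lambda>h. ?D G p (h *\<^sub>R \<xi> p)) = (\<lambda>h. 0)" by (rule has_derivative_unique)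
    then have "?D G p (1 *\<^sub>R \<xi> p) = 0" by meson
    then show ?thesis by simp
  qed
  have D\<theta>: "(\<theta> has_derivative (\<lambda>v. ?D \<theta>1 x v + ((1/2 * a x * (u x * ?D u x v + ?D u x v * u x) + 1/2 * ?D a x v * (u x * u x))
      + (b x * (u x * ?D w x v + ?D u x v * w x) + ?D b x v * (u x * w x))))) (at x)" if "x \<in> B" for x
    unfolding \<theta>_def
    by (intro has_derivative_add has_derivative_mult has_derivative_mult_right sd[OF s\<theta>1 that] sd[OF sa that]
        sd[OF sb that] sd[OF su that] sd[OF sw that])
  have first: "?D \<theta> p v = - \<mu> p * (v \<bullet> \<eta> p)" if p: "p \<in> Z" for p v
    using frechet_derivativeI[OF D\<theta>, of p] p Z(1) at_Z[OF p] D\<theta>1[OF p] by auto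
  define p1 where "p1 x = ?D u x (\<tau> x)" for x
  define q1 where "q1 x = ?D w x (\<tau> x)" for x
  define a1 where "a1 x = ?D a x (\<tau> x)" for x
  define b1 where "b1 x = ?D b x (\<tau> x)" for x
  have s1: "smooth_on B p1" "smooth_on B q1" "smooth_on B a1" "smooth_on B b1"
    unfolding p1_def q1_def a1_def b1_def by (intro smooth_intros B sm sw su sa sb)+
  \<comment> \<open>The derivative of \<theta> along \<tau> is regrouped as \<open>G\<close> plus
    multiples of \<open>u\<close> and \<open>w\<close>. On \<open>Z\<close> both vanish, so
    differentiating once more involves only the values of their cofactors.\<close>
  define E where "E x = G x + (u x * (a x * p1 x + 1/2 * (a1 x * u x) + b x * q1 x + b1 x * w x) + w x * (b x * p1 x))" for x
  have Eeq: "?D \<theta> x (\<tau> x) = E x" if "x \<in> B" for x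
    using frechet_derivativeI[OF D\<theta>[OF that]]
    by (simp add: E_def G_def p1_def q1_def a1_def b1_def algebra_simps)
  have second: "?D (\<lambda>x. ?D \<theta> x (\<tau> x)) p v = 2 * \<kappa> p * \<mu> p * (v \<bullet> \<tau> p) + m p * \<mu> p * (v \<bullet> \<eta> p)" if p: "p \<in> Z" for p v
  proof -
    have pB: "p \<in> B" using Z p by blast
    define f where "f x = a x * p1 x + 1/2 * (a1 x * u x) + b x * q1 x + b1 x * w x" for x
    define g where "g x = b x * p1 x" for x
    have sf: "smooth_on B f" and sg: "smooth_on B g"
      unfolding f_def g_def by (intro smooth_intros B s1 sa sb su sw)+
    have "(E has_derivative (\<lambda>v. ?D G p v + ((u p * ?D f p v + ?D u p v * f p) + (w p * ?D g p v + ?D w p v * g p)))) (at p)"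
      unfolding E_def f_def[symmetric] g_def[symmetric]
      by (intro has_derivative_add has_derivative_mult sd[OF sG pB] sd[OF sf pB] sd[OF sg pB] sd[OF su pB] sd[OF sw pB])
    from frechet_derivativeI[OF this] have "?D E p v = ?D G p v + (v \<bullet> \<tau> p) * f p + (v \<bullet> \<eta> p) * g p"
      using at_Z[OF p] Du[OF p] Dw[OF p] by simp
    moreover have "p1 p = 1" "q1 p = 0" using Du[OF p] Dw[OF p] Zp[OF p] by (simp_all add: p1_def q1_def)
    then have "f p = a p" "g p = b p" using at_Z[OF p] by (simp_all add: f_def g_def)
    moreover have "?D G p v = (v \<bullet> \<tau> p) * ?D G p (\<tau> p) + (v \<bullet> \<eta> p) * ?D G p (\<eta> p)"
    proof -
      have lin: "linear (?D G p)" using sd[OF sG pB] has_derivative_linear by blast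
      have "?D G p v = ?D G p ((v \<bullet> \<xi> p) *\<^sub>R \<xi> p + (v \<bullet> \<tau> p) *\<^sub>R \<tau> p + (v \<bullet> \<eta> p) *\<^sub>R \<eta> p)"
        using orthonormal_expand_frame[of "\<eta> p" "\<xi> p" v] Z(2)[OF p] by simp
      then show ?thesis by (simp add: linear_add[OF lin] linear_cmul[OF lin] DG\<xi>[OF p])
    qed
    ultimately have "?D E p v = 2 * \<kappa> p * \<mu> p * (v \<bullet> \<tau> p) + m p * \<mu> p * (v \<bullet> \<eta> p)"
      by (simp add: a_def b_def algebra_simps)
    then show ?thesis using frechet_derivative_cong_open(1)[OF B pB Eeq] by simp
  qed
  show ?thesis by (rule that[OF s\<theta> zero at_Z(4) first second])
qed

text \<open>Instead of a formula for the eigenvector, its defining equation is differentiated: in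
  the rotated frame \<open>xr\<close>, \<tau> the direction \<open>g\<close> has coordinates
  \<alpha>, \<beta> with \<open>(\<alpha>\<^sup>2 - \<beta>\<^sup>2) * H = 2 * \<alpha> * \<beta> *
  Q\<close>. At \<open>p\<close> this determines the derivative of \<beta>, while \<alpha> is
  stationary.\<close>

lemma rotated_principal_derivative:
  fixes \<xi> \<eta> \<eta>s g :: "E3 \<Rightarrow> E3" and \<theta> :: "E3 \<Rightarrow> real" and s \<mu> :: real
  defines "\<tau> \<equiv> \<lambda>x. cross3 (\<eta> x) (\<xi> x)"
  assumes B: "open B" "p \<in> B" and sm: "smooth_on B \<xi>" "smooth_on B \<eta>" "smooth_on B \<theta>"
    and n: "\<And>x. x \<in> B \<Longrightarrow> norm (\<eta> x) = 1" and fr: "\<And>x. x \<in> B \<Longrightarrow> principal_frame \<eta> x (\<xi> x)"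
    and \<eta>s: "\<And>x. x \<in> B \<Longrightarrow> \<eta>s x = cos (s * \<theta> x) *\<^sub>R \<eta> x + sin (s * \<theta> x) *\<^sub>R \<xi> x"
    and \<theta>0: "\<theta> p = 0" "\<And>v. frechet_derivative \<theta> (at p) v = - \<mu> * (v \<bullet> \<eta> p)"
    and \<theta>2: "\<And>v. frechet_derivative (\<lambda>x. frechet_derivative \<theta> (at x) (\<tau> x)) (at p) v =
        2 * (shape \<eta> p (\<xi> p) (\<xi> p) - shape \<eta> p (\<tau> p) (\<tau> p)) * \<mu> * (v \<bullet> \<tau> p)
        + (shape \<xi> p (\<xi> p) (\<tau> p) - shape \<eta> p (\<eta> p) (\<tau> p)) * \<mu> * (v \<bullet> \<eta> p)"
    and g: "g differentiable (at p)" "g p = \<xi> p" "open N" "p \<in> N" "\<And>x. x \<in> N \<Longrightarrow> principal_frame \<eta>s x (g x)"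
  shows "frechet_derivative g (at p) v = frechet_derivative \<xi> (at p) v + (s * \<mu>) *\<^sub>R (v - (v \<bullet> \<xi> p) *\<^sub>R \<xi> p)"
proof -
  note sd = smooth_on_has_derivative
  let ?D = "\<lambda>f x. frechet_derivative f (at x)"
  define cs where "cs x = cos (s * \<theta> x)" for x
  define sn where "sn x = sin (s * \<theta> x)" for x
  \<comment> \<open>The vector \<xi> rotated along with \<eta>; together with the unrotated \<tau>
    it is an orthonormal frame of the plane orthogonal to \<open>\<eta>s\<close>.\<close>
  define xr where "xr x = cs x *\<^sub>R \<xi> x - sn x *\<^sub>R \<eta> x" for x
  have s\<tau>: "smooth_on B \<tau>" unfolding \<tau>_def by (intro smooth_intros B sm)
  have scs: "smooth_on B cs" and ssn: "smooth_on B sn"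
    unfolding cs_def sn_def by (intro smooth_intros B sm)+
  have sxr: "smooth_on B xr" unfolding xr_def by (intro smooth_intros B sm scs ssn)
  have "smooth_on B (\<lambda>x. cs x *\<^sub>R \<eta> x + sn x *\<^sub>R \<xi> x)" by (intro smooth_intros B sm scs ssn)
  then have s\<eta>s: "smooth_on B \<eta>s"
    by (rule smooth_on_cong[OF B(1), rotated]) (simp add: \<eta>s cs_def sn_def)
  have cs2: "cs x * cs x + sn x * sn x = 1" for x
    using sin_cos_squared_add[of "s * \<theta> x"] by (simp add: cs_def sn_def power2_eq_square)
  have on: "\<xi> x \<bullet> \<xi> x = 1" "\<eta> x \<bullet> \<eta> x = 1" "\<tau> x \<bullet> \<tau> x = 1" "\<xi> x \<bullet> \<eta> x = 0" "\<eta> x \<bullet> \<xi> x = 0"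
    "\<tau> x \<bullet> \<xi> x = 0" "\<xi> x \<bullet> \<tau> x = 0" "\<tau> x \<bullet> \<eta> x = 0" "\<eta> x \<bullet> \<tau> x = 0" "cross3 (\<eta> x) (\<tau> x) = - \<xi> x" if "x \<in> B" for x
    using fr[OF that] n[OF that] cross3_orthonormal[of "\<eta> x" "\<xi> x"]
    by (auto simp: principal_frame_def \<tau>_def norm_eq_1 inner_commute)
  have lin: "linear (?D f x)" if "smooth_on B f" "x \<in> B" for f :: "E3 \<Rightarrow> E3" and x
    using sd[OF that] has_derivative_linear by blast
  have lin\<theta>: "linear (?D \<theta> x)" if "x \<in> B" for x
    using sd[OF sm(3) that] has_derivative_linear by blast
  have self: "?D f x v \<bullet> f x = 0" if f: "smooth_on B f" "\<And>x. x \<in> B \<Longrightarrow> f x \<bullet> f x = 1" "x \<in> B" for f :: "E3 \<Rightarrow> E3" and x v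
  proof -
    have "((\<lambda>x. f x \<bullet> f x) has_derivative (\<lambda>v. f x \<bullet> ?D f x v + ?D f x v \<bullet> f x)) (at x)"
      by (intro has_derivative_inner sd[OF f(1,3)])
    moreover have "((\<lambda>x. f x \<bullet> f x) has_derivative (\<lambda>v. 0)) (at x)"
      by (rule has_derivative_transform_within_open[OF has_derivative_const[of 1] B(1) f(3)]) (simp add: f(2))
    ultimately have "(\<lambda>v. f x \<bullet> ?D f x v + ?D f x v \<bullet> f x) = (\<lambda>v. 0)" by (rule has_derivative_unique)
    from fun_cong[OF this, of v] show ?thesis by (simp add: inner_commute)
  qed
  have D\<eta>s: "?D \<eta>s x v = cs x *\<^sub>R ?D \<eta> x v + sn x *\<^sub>R ?D \<xi> x v + (s * ?D \<theta> x v) *\<^sub>R xr x" if x: "x \<in> B" for x v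
  proof -
    have "((\<lambda>x. cos (s * \<theta> x) *\<^sub>R \<eta> x + sin (s * \<theta> x) *\<^sub>R \<xi> x) has_derivative
        (\<lambda>v. cs x *\<^sub>R ?D \<eta> x v + sn x *\<^sub>R ?D \<xi> x v + (s * ?D \<theta> x v) *\<^sub>R xr x)) (at x)"
      by (auto intro!: derivative_eq_intros sd[OF sm(1) x] sd[OF sm(2) x] sd[OF sm(3) x]
          simp: fun_eq_iff cs_def sn_def xr_def algebra_simps)
    then have "(\<eta>s has_derivative (\<lambda>v. cs x *\<^sub>R ?D \<eta> x v + sn x *\<^sub>R ?D \<xi> x v + (s * ?D \<theta> x v) *\<^sub>R xr x)) (at x)"
      by (rule has_derivative_transform_within_open[OF _ B(1) x]) (simp add: \<eta>s)
    from frechet_derivativeI[OF this] show ?thesis by simp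
  qed
  have xr_on: "xr x \<bullet> xr x = 1" "xr x \<bullet> \<tau> x = 0" "\<tau> x \<bullet> xr x = 0" "cross3 (\<eta>s x) (xr x) = \<tau> x"
    "cross3 (\<eta>s x) (\<tau> x) = - xr x" "norm (\<eta>s x) = 1" "xr x \<bullet> \<eta>s x = 0" if x: "x \<in> B" for x
  proof -
    show "xr x \<bullet> xr x = 1" "xr x \<bullet> \<tau> x = 0" "\<tau> x \<bullet> xr x = 0"
      using cs2[of x] by (simp_all add: xr_def inner_simps on[OF x])
    have e: "\<eta>s x = cs x *\<^sub>R \<eta> x + sn x *\<^sub>R \<xi> x" using \<eta>s[OF x] by (simp add: cs_def sn_def)
    have "\<eta>s x \<bullet> \<eta>s x = 1" using cs2[of x] by (simp add: e inner_simps on[OF x])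
    then show "norm (\<eta>s x) = 1" by (simp add: norm_eq_1)
    show "xr x \<bullet> \<eta>s x = 0" by (simp add: e xr_def inner_simps on[OF x])
    have c\<tau>: "cross3 (\<xi> x) (\<tau> x) = \<eta> x" unfolding \<tau>_def Lagrange using on[OF x] by simp
    have sk: "cross3 (\<xi> x) (\<eta> x) = - \<tau> x" unfolding \<tau>_def by (rule cross_skew)
    have "cross3 (\<eta>s x) (xr x) = (cs x * cs x + sn x * sn x) *\<^sub>R \<tau> x"
      unfolding e xr_def by (simp add: Cross3.left_diff_distrib Cross3.right_diff_distrib cross_add_left cross_mult_left cross_mult_right sk
          flip: \<tau>_def) (simp add: \<tau>_def algebra_simps)
    then show "cross3 (\<eta>s x) (xr x) = \<tau> x" by (simp add: cs2)
    show "cross3 (\<eta>s x) (\<tau> x) = - xr x"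
      unfolding e xr_def by (simp add: cross_add_left cross_mult_left on(10)[OF x] c\<tau>)
  qed
  define H where "H x = shape \<eta>s x (xr x) (\<tau> x) + shape \<eta>s x (\<tau> x) (xr x)" for x
  define m1 where "m1 x = shape \<xi> x (\<xi> x) (\<tau> x) - shape \<eta> x (\<eta> x) (\<tau> x)" for x
  define m2 where "m2 x = shape \<xi> x (\<eta> x) (\<tau> x) + shape \<xi> x (\<tau> x) (\<eta> x)" for x
  \<comment> \<open>The off-diagonal entry belonging to \<eta> drops out because \<xi> is principal
    for it. What remains is the derivative of the angle along \<tau>, plus terms with the factor
    \<open>sn\<close>, which vanish at \<open>p\<close>.\<close>
  have Heq: "H x = s * ?D \<theta> x (\<tau> x) + sn x * (cs x * m1 x - sn x * m2 x)" if x: "x \<in> B" for x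
  proof -
    have off: "?D \<eta> x (\<xi> x) \<bullet> \<tau> x + ?D \<eta> x (\<tau> x) \<bullet> \<xi> x = 0"
      using fr[OF x] by (simp add: principal_frame_def shape_def \<tau>_def)
    have 1: "shape \<eta>s x (xr x) (\<tau> x) = cs x * (cs x * (?D \<eta> x (\<xi> x) \<bullet> \<tau> x) - sn x * (?D \<eta> x (\<eta> x) \<bullet> \<tau> x))
        + sn x * (cs x * (?D \<xi> x (\<xi> x) \<bullet> \<tau> x) - sn x * (?D \<xi> x (\<eta> x) \<bullet> \<tau> x))"
    proof -
      have e: "?D f x (xr x) = cs x *\<^sub>R ?D f x (\<xi> x) - sn x *\<^sub>R ?D f x (\<eta> x)" if "smooth_on B f" for f :: "E3 \<Rightarrow> E3"
        using lin[OF that x] by (simp add: xr_def linear_diff linear_cmul)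
      show ?thesis
        unfolding shape_def D\<eta>s[OF x] e[OF sm(1)] e[OF sm(2)] by (simp add: inner_simps xr_on[OF x])
    qed
    have 2: "shape \<eta>s x (\<tau> x) (xr x) = s * ?D \<theta> x (\<tau> x) + cs x * (cs x * (?D \<eta> x (\<tau> x) \<bullet> \<xi> x)) - sn x * (sn x * (?D \<xi> x (\<tau> x) \<bullet> \<eta> x))"
    proof -
      have e: "a \<bullet> xr x = cs x * (a \<bullet> \<xi> x) - sn x * (a \<bullet> \<eta> x)" for a by (simp add: xr_def inner_simps)
      have z: "?D \<eta> x (\<tau> x) \<bullet> \<eta> x = 0" "?D \<xi> x (\<tau> x) \<bullet> \<xi> x = 0"
        by (rule self[OF sm(2) on(2) x] self[OF sm(1) on(1) x]; assumption)+
      show ?thesis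
        unfolding shape_def D\<eta>s[OF x] inner_add_left inner_scaleR_left xr_on(1)[OF x]
        by (simp add: e z)
    qed
    have "cs x * (cs x * (?D \<eta> x (\<xi> x) \<bullet> \<tau> x)) = - (cs x * (cs x * (?D \<eta> x (\<tau> x) \<bullet> \<xi> x)))"
      using off by (simp add: eq_neg_iff_add_eq_0 flip: distrib_left)
    then show ?thesis unfolding H_def 1 2 unfolding m1_def m2_def shape_def by (simp add: algebra_simps)
  qed
  have sm1: "smooth_on B m1" and sm2: "smooth_on B m2"
    unfolding m1_def m2_def shape_def by (intro smooth_intros B sm s\<tau>)+
  have sH: "smooth_on B H"
    unfolding H_def shape_def by (intro smooth_intros B s\<eta>s sxr s\<tau>)
  have p0: "cs p = 1" "sn p = 0" "xr p = \<xi> p" by (simp_all add: cs_def sn_def xr_def \<theta>0)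
  have Hp: "H p = 0" using Heq[OF B(2)] \<theta>0(2) on[OF B(2)] by (simp add: p0)
  define \<kappa> where "\<kappa> = shape \<eta> p (\<xi> p) (\<xi> p) - shape \<eta> p (\<tau> p) (\<tau> p)"
  have \<kappa>: "\<kappa> > 0" using fr[OF B(2)] by (simp add: \<kappa>_def principal_frame_def \<tau>_def)
  \<comment> \<open>The component along \<eta> prescribed for the second derivative of \<theta>
    cancels the contribution of \<open>m1\<close>; only the component along \<tau>, scaled by the
    gap \<kappa>, survives.\<close>
  have DH: "?D H p v = 2 * s * \<kappa> * \<mu> * (v \<bullet> \<tau> p)" for v
  proof -
    define E where "E x = ?D \<theta> x (\<tau> x)" for x
    define k where "k x = cs x * m1 x - sn x * m2 x" for x
    have sE: "smooth_on B E" unfolding E_def by (intro smooth_intros B sm s\<tau>)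
    have sk: "smooth_on B k" unfolding k_def by (intro smooth_intros B sm1 sm2 scs ssn)
    have dsn: "(sn has_derivative (\<lambda>v. s * ?D \<theta> p v)) (at p)"
      unfolding sn_def using \<theta>0(1) by (auto intro!: derivative_eq_intros sd[OF sm(3) B(2)])
    have "((\<lambda>x. s * E x + sn x * k x) has_derivative (\<lambda>v. s * ?D E p v + (sn p * ?D k p v + s * ?D \<theta> p v * k p))) (at p)"
      by (intro has_derivative_add has_derivative_mult has_derivative_mult_right dsn sd[OF sE B(2)] sd[OF sk B(2)])
    then have "(H has_derivative (\<lambda>v. s * ?D E p v + (sn p * ?D k p v + s * ?D \<theta> p v * k p))) (at p)"
      by (rule has_derivative_transform_within_open[OF _ B]) (simp add: Heq E_def k_def)
    from frechet_derivativeI[OF this] have "?D H p v = s * ?D E p v + s * ?D \<theta> p v * m1 p"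
      by (simp add: p0 k_def)
    then show ?thesis
      unfolding E_def[abs_def] \<theta>2 \<theta>0(2) by (simp add: \<kappa>_def m1_def algebra_simps)
  qed
  define Q where "Q x = shape \<eta>s x (xr x) (xr x) - shape \<eta>s x (\<tau> x) (\<tau> x)" for x
  have sQ: "smooth_on B Q"
    unfolding Q_def shape_def by (intro smooth_intros B s\<eta>s sxr s\<tau>)
  have Qp: "Q p = \<kappa>"
    unfolding Q_def \<kappa>_def shape_def D\<eta>s[OF B(2)] p0 \<theta>0(2) by (simp add: inner_simps on[OF B(2)])
  define \<alpha> where "\<alpha> x = g x \<bullet> xr x" for x
  define \<beta> where "\<beta> x = g x \<bullet> \<tau> x" for x
  have NB: "open (N \<inter> B)" "p \<in> N \<inter> B" using g B by auto
  have geq: "g x = \<alpha> x *\<^sub>R xr x + \<beta> x *\<^sub>R \<tau> x" "\<alpha> x * \<alpha> x + \<beta> x * \<beta> x = 1"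
    "(\<alpha> x * \<alpha> x - \<beta> x * \<beta> x) * H x - 2 * (\<alpha> x * (\<beta> x * Q x)) = 0" if x: "x \<in> N \<inter> B" for x
  proof -
    have xB: "x \<in> B" and gf: "principal_frame \<eta>s x (g x)" using x g by auto
    have nx: "norm (xr x) = 1" using xr_on[OF xB] by (simp add: norm_eq_1)
    show ge: "g x = \<alpha> x *\<^sub>R xr x + \<beta> x *\<^sub>R \<tau> x"
      using orthonormal_expand_frame[OF xr_on(6)[OF xB] nx xr_on(7)[OF xB], of "g x"] gf
      by (simp add: \<alpha>_def \<beta>_def xr_on[OF xB] principal_frame_def)
    have "g x \<bullet> g x = \<alpha> x * \<alpha> x + \<beta> x * \<beta> x"
      unfolding ge by (simp add: inner_simps xr_on[OF xB] on[OF xB])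
    then show "\<alpha> x * \<alpha> x + \<beta> x * \<beta> x = 1" using gf by (simp add: principal_frame_def norm_eq_1)
    have ce: "cross3 (\<eta>s x) (g x) = (- \<beta> x) *\<^sub>R xr x + \<alpha> x *\<^sub>R \<tau> x"
      unfolding ge by (simp add: cross_add_right cross_mult_right xr_on[OF xB])
    have "shape \<eta>s x (g x) (cross3 (\<eta>s x) (g x)) + shape \<eta>s x (cross3 (\<eta>s x) (g x)) (g x) = 0"
      using gf by (simp add: principal_frame_def)
    then show "(\<alpha> x * \<alpha> x - \<beta> x * \<beta> x) * H x - 2 * (\<alpha> x * (\<beta> x * Q x)) = 0"
      unfolding ce unfolding ge shape_bilinear[OF smooth_on_differentiable[OF s\<eta>s xB]]
      by (simp add: H_def Q_def algebra_simps)
  qed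
  have dg: "(g has_derivative ?D g p) (at p)" using g(1) by (rule has_derivative_frechet)
  have \<alpha>p: "\<alpha> p = 1" and \<beta>p: "\<beta> p = 0"
    using g(2) on[OF B(2)] by (simp_all add: \<alpha>_def \<beta>_def p0)
  define D\<alpha> where "D\<alpha> v = g p \<bullet> ?D xr p v + ?D g p v \<bullet> xr p" for v
  define D\<beta> where "D\<beta> v = g p \<bullet> ?D \<tau> p v + ?D g p v \<bullet> \<tau> p" for v
  have d\<alpha>: "(\<alpha> has_derivative D\<alpha>) (at p)"
    unfolding \<alpha>_def D\<alpha>_def by (intro has_derivative_inner dg sd[OF sxr B(2)])
  have d\<beta>: "(\<beta> has_derivative D\<beta>) (at p)"
    unfolding \<beta>_def D\<beta>_def by (intro has_derivative_inner dg sd[OF s\<tau> B(2)])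
  have const: "f' v = 0" if "(f has_derivative f') (at p)" "\<And>x. x \<in> N \<inter> B \<Longrightarrow> f x = c" for f f' c and v :: E3
  proof -
    have "(f has_derivative (\<lambda>v. 0)) (at p)"
      by (rule has_derivative_transform_within_open[OF has_derivative_const[of c] NB]) (simp add: that(2))
    then have "f' = (\<lambda>v. 0)" using that(1) has_derivative_unique by blast
    then show ?thesis by simp
  qed
  \<comment> \<open>Unit length is differentiated at the point where \<alpha> is 1 and \<beta> is
    0.\<close>
  have D\<alpha>0: "D\<alpha> v = 0" for v
    using const[OF has_derivative_add[OF has_derivative_mult[OF d\<alpha> d\<alpha>] has_derivative_mult[OF d\<beta> d\<beta>]] geq(2), of v]
    by (simp add: \<alpha>p \<beta>p)
  \<comment> \<open>At \<open>p\<close> both \<beta> and \<open>H\<close> vanish, so the eigenvector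
    equation linearizes: the derivative of \<open>H\<close> is \<open>2 * \<kappa>\<close> times
    that of \<beta>, and the positive gap \<kappa> can be divided out.\<close>
  have D\<beta>v: "D\<beta> v = s * \<mu> * (v \<bullet> \<tau> p)" for v
  proof -
    have "((\<lambda>x. (\<alpha> x * \<alpha> x - \<beta> x * \<beta> x) * H x - 2 * (\<alpha> x * (\<beta> x * Q x))) has_derivative
       (\<lambda>v. ((\<alpha> p * \<alpha> p - \<beta> p * \<beta> p) * ?D H p v + ((\<alpha> p * D\<alpha> v + D\<alpha> v * \<alpha> p) - (\<beta> p * D\<beta> v + D\<beta> v * \<beta> p)) * H p)
          - 2 * (\<alpha> p * (\<beta> p * ?D Q p v + D\<beta> v * Q p) + D\<alpha> v * (\<beta> p * Q p)))) (at p)"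
      by (intro has_derivative_diff has_derivative_mult has_derivative_mult_right d\<alpha> d\<beta> sd[OF sH B(2)] sd[OF sQ B(2)])
    from const[OF this geq(3), of v] have "?D H p v = 2 * (D\<beta> v * \<kappa>)"
      by (simp add: \<alpha>p \<beta>p Hp Qp)
    then show ?thesis using \<kappa> by (simp add: DH)
  qed
  \<comment> \<open>The component along \<eta> arises here, from the turning of the frame vector
    itself; \<beta> supplies the one along \<tau>.\<close>
  have dxr: "?D xr p v = ?D \<xi> p v + (s * \<mu> * (v \<bullet> \<eta> p)) *\<^sub>R \<eta> p" for v
  proof -
    have "(xr has_derivative (\<lambda>v. ?D \<xi> p v - (s * ?D \<theta> p v) *\<^sub>R \<eta> p)) (at p)"
      unfolding xr_def cs_def sn_def using \<theta>0(1)
      by (auto intro!: derivative_eq_intros sd[OF sm(1) B(2)] sd[OF sm(2) B(2)] sd[OF sm(3) B(2)])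
    from frechet_derivativeI[OF this] show ?thesis
      by (simp add: \<theta>0(2) algebra_simps)
  qed
  have "((\<lambda>x. \<alpha> x *\<^sub>R xr x + \<beta> x *\<^sub>R \<tau> x) has_derivative
      (\<lambda>v. (\<alpha> p *\<^sub>R ?D xr p v + D\<alpha> v *\<^sub>R xr p) + (\<beta> p *\<^sub>R ?D \<tau> p v + D\<beta> v *\<^sub>R \<tau> p))) (at p)"
    by (intro has_derivative_add has_derivative_scaleR d\<alpha> d\<beta> sd[OF sxr B(2)] sd[OF s\<tau> B(2)])
  then have "(g has_derivative (\<lambda>v. (\<alpha> p *\<^sub>R ?D xr p v + D\<alpha> v *\<^sub>R xr p) + (\<beta> p *\<^sub>R ?D \<tau> p v + D\<beta> v *\<^sub>R \<tau> p))) (at p)"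
    by (rule has_derivative_transform_within_open[OF _ NB]) (simp add: geq(1)[symmetric])
  from frechet_derivativeI[OF this] have "?D g p v = ?D xr p v + D\<beta> v *\<^sub>R \<tau> p"
      by (simp add: \<alpha>p \<beta>p D\<alpha>0)
  moreover have "v - (v \<bullet> \<xi> p) *\<^sub>R \<xi> p = (v \<bullet> \<tau> p) *\<^sub>R \<tau> p + (v \<bullet> \<eta> p) *\<^sub>R \<eta> p"
  proof -
    have cancel: "x - a = b + c" if "x = a + b + c" for x a b c :: E3 using that by simp
    show ?thesis
      by (rule cancel) (use orthonormal_expand_frame[of "\<eta> p" "\<xi> p" v] n[OF B(2)] fr[OF B(2)] in
          \<open>simp add: principal_frame_def \<tau>_def\<close>)
  qed
  ultimately show ?thesis by (simp add: dxr D\<beta>v scaleR_add_right)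
qed

section \<open>Straightening an integral curve\<close>

text \<open>Near \<open>\<gamma> t0\<close> the curve is the graph of \<open>\<Gamma>\<close> over its tangent line, and \<open>\<Gamma>\<close> is smooth
  because it is an integral curve of a multiple of \<open>\<xi>\<close>; then \<open>y p = p - \<Gamma> (x p)\<close>, where \<open>x\<close> is the
  tangential coordinate.\<close>

lemma straighten_integral_curve:
  fixes \<gamma> :: "real \<Rightarrow> E3" and \<xi> :: "E3 \<Rightarrow> E3"
  assumes W: "open W" "smooth_on W \<xi>" and \<delta>0: "\<delta>0 > 0"
    and \<gamma>: "\<And>t. \<bar>t - t0\<bar> < \<delta>0 \<Longrightarrow> \<gamma> t \<in> W \<and> (\<gamma> has_vector_derivative \<xi> (\<gamma> t)) (at t)"
    and n: "norm (\<xi> (\<gamma> t0)) = 1"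
  obtains O' y \<delta> where "open O'" "\<gamma> t0 \<in> O'" "smooth_on O' y" "0 < \<delta>" "\<delta> \<le> \<delta>0"
    "\<And>t. \<bar>t - t0\<bar> < \<delta> \<Longrightarrow> y (\<gamma> t) = 0"
    "\<And>t v. \<bar>t - t0\<bar> < \<delta> \<Longrightarrow> \<gamma> t \<in> O' \<Longrightarrow> \<exists>l. frechet_derivative y (at (\<gamma> t)) v = v - l *\<^sub>R \<xi> (\<gamma> t)"
proof -
  define e where "e = \<xi> (\<gamma> t0)"
  define x where "x t = e \<bullet> (\<gamma> t - \<gamma> t0)" for t
  define x' where "x' t = e \<bullet> \<xi> (\<gamma> t)" for t
  have dx: "(x has_real_derivative x' t) (at t)" if "\<bar>t - t0\<bar> < \<delta>0" for t
    using \<gamma>[OF that] unfolding x_def x'_def has_vector_derivative_def has_field_derivative_def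
    by (auto intro!: derivative_eq_intros simp: mult.commute)
  have t0: "\<bar>t0 - t0\<bar> < \<delta>0" using \<delta>0 by simp
  have "isCont \<gamma> t0" using \<gamma>[OF t0] has_vector_derivative_continuous by blast
  moreover have "isCont \<xi> (\<gamma> t0)"
    using smooth_on_continuous_on[OF W(2)] \<gamma>[OF t0] continuous_on_eq_continuous_at[OF W(1)] by auto
  ultimately have "isCont (\<lambda>t. \<xi> (\<gamma> t)) t0" by (rule isCont_o2)
  then have "isCont x' t0" unfolding x'_def by (intro continuous_intros)
  moreover have "x' t0 = 1" using n by (simp add: x'_def e_def norm_eq_1)
  moreover from calculation have "(x' \<longlongrightarrow> x' t0) (nhds t0)"
    unfolding isCont_def by (subst (asm) tendsto_at_iff_tendsto_nhds)
  ultimately have "(x' \<longlongrightarrow> 1) (nhds t0)" by simp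
  then have "\<forall>\<^sub>F t in nhds t0. x' t > 0" by (rule order_tendstoD) simp
  then obtain \<delta>1 where \<delta>1: "\<delta>1 > 0" "\<And>t. \<bar>t - t0\<bar> < \<delta>1 \<Longrightarrow> x' t > 0"
    unfolding eventually_nhds_metric by (auto simp: dist_real_def)
  \<comment> \<open>Halving puts the closed interval \<open>?I\<close> inside both open windows, so
    the coordinate \<open>x\<close> is strictly increasing up to its ends.\<close>
  define \<delta> where "\<delta> = min \<delta>0 \<delta>1 / 2"
  have \<delta>: "\<delta> > 0" "\<delta> < \<delta>0" "\<delta> < \<delta>1" using \<delta>0 \<delta>1 by (auto simp: \<delta>_def)
  let ?I = "{t0 - \<delta>..t0 + \<delta>}"
  have inI: "\<bar>t - t0\<bar> < \<delta>0" "x' t > 0" if "t \<in> ?I" for t using that \<delta> \<delta>1(2)[of t] by auto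
  have mono: "x s < x t" if "s \<in> ?I" "t \<in> ?I" "s < t" for s t
  proof (rule DERIV_pos_imp_increasing[OF that(3)])
    fix u assume "s \<le> u" "u \<le> t"
    then have "u \<in> ?I" using that by auto
    then show "\<exists>y. (x has_real_derivative y) (at u) \<and> 0 < y" using dx inI by blast
  qed
  then have inj: "inj_on x ?I" by (intro inj_onI) (metis less_irrefl linorder_neqE_linordered_idom)
  define T where "T = inv_into ?I x"
  have Tx: "T (x t) = t" if "t \<in> ?I" for t unfolding T_def by (rule inv_into_f_f[OF inj that])
  have cx: "continuous_on ?I x"
    by (intro continuous_at_imp_continuous_on ballI DERIV_isCont[OF dx]) (use inI in auto)
  define J where "J = {x (t0 - \<delta>)<..<x (t0 + \<delta>)}"
  have J: "\<exists>t. t \<in> {t0 - \<delta><..<t0 + \<delta>} \<and> x t = s" if sJ: "s \<in> J" for s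
  proof -
    obtain t where "t0 - \<delta> \<le> t" "t \<le> t0 + \<delta>" "x t = s"
      using IVT'[of x "t0 - \<delta>" s "t0 + \<delta>"] cx sJ \<delta> by (auto simp: J_def)
    then show ?thesis using sJ by (intro exI[of _ t]) (auto simp: J_def less_le)
  qed
  have xJ: "x t \<in> J" if "\<bar>t - t0\<bar> < \<delta>" for t
    using mono[of "t0 - \<delta>" t] mono[of t "t0 + \<delta>"] that by (auto simp: J_def)
  \<comment> \<open>The field \<xi> rescaled to have component 1 along \<open>e\<close>, as a
    parametrisation by the tangential coordinate demands.\<close>
  define \<zeta> where "\<zeta> p = (1 / (e \<bullet> \<xi> p)) *\<^sub>R \<xi> p" for p
  define W' where "W' = {p \<in> W. e \<bullet> \<xi> p > 0}"
  have oW': "open W'"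
  proof -
    have "continuous_on W (\<lambda>p. e \<bullet> \<xi> p)" by (intro continuous_intros smooth_on_continuous_on[OF W(2)])
    then have "open (W \<inter> (\<lambda>p. e \<bullet> \<xi> p) -` {0<..})" by (rule continuous_open_preimage[OF _ W(1)]) simp
    then show ?thesis by (simp add: W'_def vimage_def Int_def)
  qed
  have s\<zeta>: "smooth_on W' \<zeta>"
    unfolding \<zeta>_def by (intro smooth_intros oW' smooth_on_subset[OF W(2)]) (auto simp: W'_def)
  define \<Gamma> where "\<Gamma> s = \<gamma> (T s)" for s
  have \<Gamma>: "(\<Gamma> has_vector_derivative \<zeta> (\<Gamma> s)) (at s)" "\<Gamma> s \<in> W'" if s: "s \<in> J" for s
  proof -
    obtain t where t: "t \<in> {t0 - \<delta><..<t0 + \<delta>}" "x t = s" using J[OF s] by blast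
    have tI: "t \<in> ?I" and Ts: "T s = t" using t Tx[of t] by auto
    have "isCont T (x t)"
      by (rule isCont_inverse_function2[where a = "t0 - \<delta>" and b = "t0 + \<delta>"])
         (use t Tx inI DERIV_isCont[OF dx] in auto)
    then have cT: "isCont T s" by (simp add: t)
    have "(T has_real_derivative inverse (x' t)) (at s)"
    proof (rule DERIV_inverse_function[where f = x and a = "x (t0 - \<delta>)" and b = "x (t0 + \<delta>)"])
      show "(x has_real_derivative x' t) (at (T s))" unfolding Ts by (rule dx) (use inI tI in auto)
      show "x' t \<noteq> 0" using inI[OF tI] by simp
      show "x (T u) = u" if u: "x (t0 - \<delta>) < u" "u < x (t0 + \<delta>)" for u
      proof -
        obtain t where "t \<in> {t0 - \<delta><..<t0 + \<delta>}" "x t = u" using J[of u] u by (auto simp: J_def)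
        then show ?thesis using Tx[of t] by auto
      qed
    qed (use s cT in \<open>auto simp: J_def\<close>)
    then have "(T has_vector_derivative inverse (x' t)) (at s)"
      by (simp add: has_real_derivative_iff_has_vector_derivative)
    moreover have "(\<gamma> has_vector_derivative \<xi> (\<gamma> t)) (at (T s))"
      unfolding Ts using \<gamma>[OF inI(1)[OF tI]] by blast
    ultimately have "((\<gamma> \<circ> T) has_vector_derivative inverse (x' t) *\<^sub>R \<xi> (\<gamma> t)) (at s)"
      by (rule vector_diff_chain_at)
    moreover have "\<gamma> \<circ> T = \<Gamma>" by (simp add: \<Gamma>_def fun_eq_iff)
    ultimately show "(\<Gamma> has_vector_derivative \<zeta> (\<Gamma> s)) (at s)"
      by (simp add: \<zeta>_def \<Gamma>_def Ts x'_def inverse_eq_divide)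
    show "\<Gamma> s \<in> W'" using \<gamma>[OF inI(1)[OF tI]] inI(2)[OF tI] by (simp add: \<Gamma>_def W'_def Ts x'_def)
  qed
  have oJ: "open J" by (simp add: J_def)
  \<comment> \<open>The curve is given only as a differentiable solution; its smoothness comes from
    the equation, whose right-hand side is as regular as \<Gamma>.\<close>
  have s\<Gamma>: "smooth_on J \<Gamma>"
  proof (rule smooth_on_realI[OF oJ \<Gamma>(1)])
    show "Ck_on k J (\<lambda>s. \<zeta> (\<Gamma> s))" if "Ck_on k J \<Gamma>" for k
      by (rule Ck_on_compose[OF oJ smooth_on_Ck[OF s\<zeta>] that]) (use \<Gamma>(2) in auto)
  qed
  define O' where "O' = {p. e \<bullet> (p - \<gamma> t0) \<in> J}"
  define y where "y p = p - \<Gamma> (e \<bullet> (p - \<gamma> t0))" for p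
  have oO: "open O'"
  proof -
    have "open ((\<lambda>p. e \<bullet> (p - \<gamma> t0)) -` J)" by (intro open_vimage oJ continuous_intros)
    then show ?thesis by (simp add: O'_def vimage_def)
  qed
  have "smooth_on O' (\<lambda>p. e \<bullet> (p - \<gamma> t0))" by (intro smooth_intros oO)
  then have sy: "smooth_on O' y"
    unfolding y_def
    by (intro smooth_on_diff smooth_on_ident oO smooth_on_compose[OF oO s\<Gamma>]) (auto simp: O'_def)
  show ?thesis
  proof (rule that[OF oO _ sy \<open>\<delta> > 0\<close>])
    show "\<gamma> t0 \<in> O'" using xJ[of t0] \<delta> by (simp add: O'_def x_def)
    show "\<delta> \<le> \<delta>0" using \<delta> by simp
    fix t assume t: "\<bar>t - t0\<bar> < \<delta>"
    have tI: "t \<in> ?I" using t by auto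
    have \<Gamma>x: "\<Gamma> (x t) = \<gamma> t" by (simp add: \<Gamma>_def Tx[OF tI])
    then show "y (\<gamma> t) = 0" by (simp add: y_def x_def)
    fix v
    have "(\<Gamma> has_derivative (\<lambda>h. h *\<^sub>R \<zeta> (\<gamma> t))) (at (e \<bullet> (\<gamma> t - \<gamma> t0)))"
      using \<Gamma>(1)[OF xJ[OF t]] \<Gamma>x by (simp add: has_vector_derivative_def x_def)
    moreover have "((\<lambda>p. e \<bullet> (p - \<gamma> t0)) has_derivative (\<lambda>v. e \<bullet> v)) (at (\<gamma> t))"
      by (auto intro!: derivative_eq_intros)
    ultimately have "((\<lambda>p. \<Gamma> (e \<bullet> (p - \<gamma> t0))) has_derivative (\<lambda>v. (e \<bullet> v) *\<^sub>R \<zeta> (\<gamma> t))) (at (\<gamma> t))"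
      using has_derivative_compose[of "\<lambda>p. e \<bullet> (p - \<gamma> t0)" "\<lambda>v. e \<bullet> v" "\<gamma> t" UNIV \<Gamma> "\<lambda>h. h *\<^sub>R \<zeta> (\<gamma> t)"] by blast
    then have "(y has_derivative (\<lambda>v. v - (e \<bullet> v) *\<^sub>R \<zeta> (\<gamma> t))) (at (\<gamma> t))"
      unfolding y_def by (intro has_derivative_diff has_derivative_ident)
    from frechet_derivativeI[OF this]
    show "\<exists>l. frechet_derivative y (at (\<gamma> t)) v = v - l *\<^sub>R \<xi> (\<gamma> t)"
      by (auto simp: \<zeta>_def)
  qed
qed

section \<open>Closeness in the Whitney topology\<close>

lemma iter_deriv_cong_open:
  assumes "open U" "x \<in> U" "\<And>y. y \<in> U \<Longrightarrow> f y = g y"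
  shows "iter_deriv f vs x = iter_deriv g vs x"
  using assms(3)
proof (induction vs arbitrary: f g)
  case Nil
  then show ?case using assms(2) by simp
next
  case (Cons v vs)
  have "iter_deriv (\<lambda>x. frechet_derivative f (at x) v) vs x = iter_deriv (\<lambda>x. frechet_derivative g (at x) v) vs x"
  proof (rule Cons.IH)
    show "frechet_derivative f (at y) v = frechet_derivative g (at y) v" if "y \<in> U" for y
      by (rule fun_cong[OF frechet_derivative_cong_open(1)[OF assms(1) that Cons.prems]])
  qed
  then show ?case by simp
qed

lemma smooth_on_iter_deriv: "smooth_on U f \<Longrightarrow> smooth_on U (iter_deriv f vs)"
  by (induction vs arbitrary: f) (auto intro: smooth_on_frechet)

text \<open>Expresses the derivatives at fixed \<open>s\<close> through derivatives of the joint
  map, so that they depend continuously on \<open>s\<close> and \<open>x\<close> together.\<close>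

lemma iter_deriv_partial:
  fixes F :: "real \<times> 'a::real_normed_vector \<Rightarrow> 'b::real_normed_vector"
  assumes "smooth_on UNIV F"
  shows "iter_deriv (\<lambda>x. F (s, x)) vs x = iter_deriv F (map (\<lambda>v. (0, v)) vs) (s, x)"
  using assms
proof (induction vs arbitrary: F)
  case (Cons v vs)
  have "frechet_derivative (\<lambda>x. F (s, x)) (at x) v = frechet_derivative F (at (s, x)) (0, v)" for x
  proof -
    have "((\<lambda>x. F (s, x)) has_derivative (\<lambda>v. frechet_derivative F (at (s, x)) (0, v))) (at x)"
      by (rule has_derivative_compose[where f = "\<lambda>x. (s, x)"])
         (auto intro!: derivative_eq_intros smooth_on_has_derivative[OF Cons.prems])
    from frechet_derivativeI[OF this] show ?thesis by simp
  qed
  then show ?case using Cons.IH[OF smooth_on_frechet[OF Cons.prems, of "(0, v)"]] by simp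
qed simp

text \<open>Uniform continuity on \<open>{-1..1} \<times> S\<close> controls each iterated
  derivative over \<open>S\<close>; on the open complement the fields agree, and so do their
  derivatives. Only finitely many lists \<open>vs\<close> occur, hence a common bound on
  \<open>s\<close> exists.\<close>

lemma compactly_supported_family_close:
  fixes F :: "real \<times> E3 \<Rightarrow> E3"
  assumes F: "smooth_on UNIV F" and S: "compact S" "\<And>s x. x \<notin> S \<Longrightarrow> F (s, x) = F (0, x)" and "\<epsilon> > 0"
  obtains s0 where "s0 > 0" "\<And>s vs x. \<lbrakk>\<bar>s\<bar> < s0; length vs \<le> r; set vs \<subseteq> Basis\<rbrakk> \<Longrightarrow>
      norm (iter_deriv (\<lambda>x. F (0, x)) vs x - iter_deriv (\<lambda>x. F (s, x)) vs x) \<le> \<epsilon>"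
proof -
  define VS where "VS = {vs :: E3 list. set vs \<subseteq> Basis \<and> length vs \<le> r}"
  have "finite VS" unfolding VS_def by (rule finite_lists_length_le) simp
  have ex: "\<exists>d>0. \<forall>s x. \<bar>s\<bar> < d \<longrightarrow> norm (iter_deriv (\<lambda>x. F (0, x)) vs x - iter_deriv (\<lambda>x. F (s, x)) vs x) \<le> \<epsilon>" for vs
  proof -
    define h where "h = iter_deriv F (map (\<lambda>v. (0, v)) vs)"
    have "continuous_on UNIV h" unfolding h_def by (intro smooth_on_continuous_on smooth_on_iter_deriv F)
    then have "continuous_on ({-1..1} \<times> S) h" by (rule continuous_on_subset) (rule subset_UNIV)
    moreover have "compact ({-1..1::real} \<times> S)" by (rule compact_Times[OF compact_Icc S(1)])
    ultimately have "uniformly_continuous_on ({-1..1} \<times> S) h" by (rule compact_uniformly_continuous)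
    from this[unfolded uniformly_continuous_on_def, rule_format, OF \<open>\<epsilon> > 0\<close>]
    obtain d where d: "d > 0"
      "\<forall>p\<in>{-1..1} \<times> S. \<forall>p'\<in>{-1..1} \<times> S. dist p' p < d \<longrightarrow> dist (h p') (h p) < \<epsilon>"
      by (elim exE conjE) (rule that)
    have "norm (iter_deriv (\<lambda>x. F (0, x)) vs x - iter_deriv (\<lambda>x. F (s, x)) vs x) \<le> \<epsilon>" if s: "\<bar>s\<bar> < min d 1" for s x
    proof (cases "x \<in> S")
      case True
      have "dist (h (0, x)) (h (s, x)) < \<epsilon>"
        by (rule d(2)[rule_format]) (use True s in \<open>auto simp: dist_Pair_Pair dist_real_def\<close>)
      then show ?thesis by (simp add: dist_norm h_def iter_deriv_partial[OF F])
    next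
      case False
      have "iter_deriv (\<lambda>x. F (s, x)) vs x = iter_deriv (\<lambda>x. F (0, x)) vs x"
      proof (rule iter_deriv_cong_open[of "- S"])
        show "open (- S)" using S(1) by (simp add: compact_imp_closed open_Compl)
        show "F (s, y) = F (0, y)" if "y \<in> - S" for y using that by (intro S(2)) simp
      qed (use False in simp)
      then show ?thesis using \<open>\<epsilon> > 0\<close> by simp
    qed
    then show ?thesis using d(1) by (intro exI[of _ "min d 1"]) auto
  qed
  then obtain d where d: "\<And>vs. d vs > 0"
    "\<And>vs s x. \<bar>s\<bar> < d vs \<Longrightarrow> norm (iter_deriv (\<lambda>x. F (0, x)) vs x - iter_deriv (\<lambda>x. F (s, x)) vs x) \<le> \<epsilon>"
    by metis
  have ne: "d ` VS \<noteq> {}" "finite (d ` VS)" using \<open>finite VS\<close> by (auto simp: VS_def intro: exI[of _ "[]"])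
  show ?thesis
  proof (rule that[of "Min (d ` VS)"])
    show "Min (d ` VS) > 0" using ne d(1) by (subst Min_gr_iff) auto
    fix s vs x assume "\<bar>s\<bar> < Min (d ` VS)" "length vs \<le> r" "set vs \<subseteq> (Basis :: E3 set)"
    then have "\<bar>s\<bar> < d vs" using ne by (auto simp: VS_def)
    then show "norm (iter_deriv (\<lambda>x. F (0, x)) vs x - iter_deriv (\<lambda>x. F (s, x)) vs x) \<le> \<epsilon>" by (rule d(2))
  qed
qed

text \<open>An empty shell would make \<open>K i\<close> clopen, hence empty or the whole space, and
  both are excluded. Nonemptiness is what gives meaning to the infimum and the supremum over a
  shell.\<close>

lemma shell_nonempty:
  assumes K: "compact_exhaustion K"
  shows "shell K i \<noteq> {}"
proof
  assume "shell K i = {}"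
  then have sub: "K (Suc i) \<subseteq> interior (K i)" by (auto simp: shell_def)
  moreover have "K i \<subseteq> interior (K (Suc i))" "compact (K i)" using K by (auto simp: compact_exhaustion_def)
  moreover have "interior (K i) \<subseteq> K i" "interior (K (Suc i)) \<subseteq> K (Suc i)" by (rule interior_subset)+
  ultimately have "K i = interior (K i)" by blast
  then have "open (K i)" "closed (K i)" using \<open>compact (K i)\<close> by (metis open_interior, auto intro: compact_imp_closed)
  then have "K i = {} \<or> K i = UNIV" using clopen by blast
  moreover have "K i \<noteq> UNIV" using \<open>compact (K i)\<close> not_compact_UNIV by metis
  moreover have "K i \<noteq> {}"
  proof
    assume "K i = {}"
    then have "K (Suc i) = {}" using sub by auto
    then have "interior (K (Suc i)) = {}" by simp
    then show False using K unfolding compact_exhaustion_def by (metis le_add1 plus_1_eq_Suc)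
  qed
  ultimately show False by blast
qed

text \<open>A uniform bound passes to the supremum only as a weak inequality, so the strict one in
  the neighbourhood needs the margin between \<open>\<epsilon>'\<close> and \<epsilon>. One bound
  serves all shells because the tolerance is constant.\<close>

lemma Cr_closeI:
  assumes K: "compact_exhaustion K" and Y: "Ck_on r UNIV Y" and "\<epsilon>' < \<epsilon>"
    and le: "\<And>vs x. length vs \<le> r \<Longrightarrow> set vs \<subseteq> Basis \<Longrightarrow> norm (iter_deriv X vs x - iter_deriv Y vs x) \<le> \<epsilon>'"
  shows "Cr_close r K \<epsilon> X Y"
proof -
  have "Cr_dist r X Y (shell K i) < (INF x\<in>shell K i. \<epsilon>)" for i
  proof -
    let ?I = "{vs. length vs \<le> r \<and> set vs \<subseteq> (Basis :: E3 set)} \<times> shell K i"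
    obtain x where "x \<in> shell K i" using shell_nonempty[OF K] by blast
    then have "([], x) \<in> ?I" by simp
    then have "?I \<noteq> {}" by blast
    then have "Cr_dist r X Y (shell K i) \<le> \<epsilon>'"
      unfolding Cr_dist_def by (rule cSUP_least) (auto intro: le)
    also have "\<epsilon>' < (INF x\<in>shell K i. \<epsilon>)" using shell_nonempty[OF K, of i] \<open>\<epsilon>' < \<epsilon>\<close> by simp
    finally show ?thesis .
  qed
  then show ?thesis using Y by (simp add: Cr_close_def whitney_nbhd_def)
qed

section \<open>Eigenvalues of scaled matrices\<close>

lemma complex_eigenvalue_scaled:
  fixes A A' :: "real ^ 'n ^ 'n"
  assumes "\<And>i j. A' $ i $ j = c * A $ i $ j" "c \<noteq> 0" "complex_eigenvalue A' z"
  shows "complex_eigenvalue A (z / of_real c)"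
proof -
  obtain v where v: "v \<noteq> 0" "(\<chi> i j. complex_of_real (A' $ i $ j)) *v v = z *s v"
    using assms(3) unfolding complex_eigenvalue_def by blast
  have "(\<chi> i j. complex_of_real (A $ i $ j)) *v v = (z / of_real c) *s v"
  proof (rule vec_eq_iff[THEN iffD2], rule allI)
    fix i
    have "of_real c * (\<Sum>j\<in>UNIV. complex_of_real (A $ i $ j) * v $ j) = z * v $ i"
      using arg_cong[OF v(2), of "\<lambda>w. w $ i"]
      by (simp add: matrix_vector_mult_def assms(1) sum_distrib_left mult.assoc)
    then show "((\<chi> i j. complex_of_real (A $ i $ j)) *v v) $ i = ((z / of_real c) *s v) $ i"
      using assms(2) by (simp add: matrix_vector_mult_def field_simps)
  qed
  then show ?thesis using v(1) unfolding complex_eigenvalue_def by blast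
qed

text \<open>Eigenvalues satisfy the quadratic characteristic equation. Two different roots sum to
  the trace, so one eigenvalue leaves at most one other candidate.\<close>

lemma finite_complex_eigenvalues2:
  fixes A :: "real ^ 2 ^ 2"
  shows "finite {z. complex_eigenvalue A z}"
proof -
  define a b c d where "a = complex_of_real (A $ 1 $ 1)" and "b = complex_of_real (A $ 1 $ 2)"
    and "c = complex_of_real (A $ 2 $ 1)" and "d = complex_of_real (A $ 2 $ 2)"
  have char: "(a - z) * (d - z) = b * c" if z: "complex_eigenvalue A z" for z
  proof -
    obtain v where v: "v \<noteq> 0" "(\<chi> i j. complex_of_real (A $ i $ j)) *v v = z *s v"
      using z unfolding complex_eigenvalue_def by blast
    have 1: "a * v $ 1 + b * v $ 2 = z * v $ 1" and 2: "c * v $ 1 + d * v $ 2 = z * v $ 2"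
      using arg_cong[OF v(2), of "\<lambda>w. w $ 1"] arg_cong[OF v(2), of "\<lambda>w. w $ 2"]
      by (simp_all add: matrix_vector_mult_def sum_2 a_def b_def c_def d_def)
    have "((a - z) * (d - z) - b * c) * v $ 1 = 0" "((a - z) * (d - z) - b * c) * v $ 2 = 0"
      using 1 2 by algebra+
    moreover have "v $ 1 \<noteq> 0 \<or> v $ 2 \<noteq> 0" using v(1) by (simp add: vec_eq_iff forall_2)
    ultimately show ?thesis by auto
  qed
  show ?thesis
  proof (cases "\<exists>z. complex_eigenvalue A z")
    case True
    then obtain z0 where z0: "complex_eigenvalue A z0" by blast
    have "{z. complex_eigenvalue A z} \<subseteq> {z0, a + d - z0}"
    proof
      fix z assume "z \<in> {z. complex_eigenvalue A z}"
      then have "(z - z0) * (z - (a + d - z0)) = 0" using char[of z] char[OF z0] by algebra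
      then show "z \<in> {z0, a + d - z0}" by auto
    qed
    then show ?thesis by (rule finite_subset) simp
  qed simp
qed

section \<open>Perturbation of a principal cycle\<close>

lemma principal_frame_cong:
  assumes "open V" "x \<in> V" "\<And>y. y \<in> V \<Longrightarrow> \<eta>1 y = \<eta>2 y"
  shows "principal_frame \<eta>1 x X \<longleftrightarrow> principal_frame \<eta>2 x X" and "pdir \<eta>1 (d, x) = pdir \<eta>2 (d, x)"
proof -
  have "shape \<eta>1 x = shape \<eta>2 x"
    by (simp add: fun_eq_iff shape_def frechet_derivative_cong_open(1)[OF assms])
  then show "principal_frame \<eta>1 x X \<longleftrightarrow> principal_frame \<eta>2 x X" "pdir \<eta>1 (d, x) = pdir \<eta>2 (d, x)"
    using assms(3)[OF assms(2)]
    by (simp_all add: principal_frame_def pdir_def pvec_def ddiag_def doff_def dcross_def dproj_def)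
qed

lemma principal_cycleI:
  assumes \<eta>: "smooth_on UNIV \<eta>" and n: "\<And>p. norm (\<eta> p) = 1" and L: "0 < L"
    and per: "\<And>s. \<gamma> (s + L) = \<gamma> s" and inj: "inj_on \<gamma> {0..<L}"
    and \<gamma>: "\<And>t. (\<gamma> has_vector_derivative \<gamma>' t) (at t)" "continuous_on UNIV \<gamma>'"
    and fr: "\<And>t. principal_frame \<eta> (\<gamma> t) (\<gamma>' t)"
  shows "principal_cycle \<eta> (k_min \<eta>) \<gamma> L"
  unfolding principal_cycle_def principal_line_def
proof (intro conjI exI[of _ \<gamma>'] ballI allI L per inj \<gamma>(2))
  fix t
  note pd = principal_frame_direction[OF smooth_on_differentiable[OF \<eta>] n fr]
  show "(\<gamma> has_vector_derivative \<gamma>' t) (at t within UNIV)" using \<gamma>(1) by simp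
  show "norm (\<gamma>' t) = 1" using fr by (simp add: principal_frame_def)
  show "\<gamma> t \<notin> partially_umbilic \<eta>" "principal_direction \<eta> (k_min \<eta>) (\<gamma> t) (\<gamma>' t)"
    by (rule pd, simp)+
qed

lemma open_vimage_Pair:
  fixes A :: "('a::topological_space \<times> 'b::topological_space) set"
  assumes "open A"
  shows "open (Pair d -` A)"
proof (rule open_vimage[OF assms])
  have "continuous_on UNIV (\<lambda>x. (d, x :: 'b))" by (intro continuous_intros)
  then show "continuous_on UNIV (Pair d :: 'b \<Rightarrow> 'a \<times> 'b)" .
qed

text \<open>With the reference direction frozen at time \<open>t\<close>, the field
  \<open>vfield \<eta> \<gamma> t\<close> takes the value \<open>\<gamma>' u\<close> at
  \<open>\<gamma> u\<close> for all \<open>u\<close> near \<open>t\<close>; differentiating in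
  \<open>u\<close> gives the claim. Thus the tangent direction is invariant under the linear
  flow.\<close>

lemma velocity_variation:
  assumes \<eta>: "smooth_on UNIV \<eta>" and n: "\<And>p. norm (\<eta> p) = 1"
    and cyc: "principal_cycle \<eta> (k_min \<eta>) \<gamma> L"
  defines "\<gamma>' \<equiv> \<lambda>t. vector_derivative \<gamma> (at t)"
  shows "(\<gamma>' has_vector_derivative variation \<eta> \<gamma> t (\<gamma>' t)) (at t)"
proof -
  have \<gamma>'_app: "vector_derivative \<gamma> (at t) = \<gamma>' t" for t by (simp add: \<gamma>'_def)
  note cd = principal_cycleD[OF \<eta> n cyc, unfolded \<gamma>'_app]
  note vb = variation_derivative[OF \<eta> n cyc, unfolded \<gamma>'_app]
  have \<gamma>1: "\<gamma>' t \<bullet> \<gamma>' t = 1" using cd(3)[of t] by (simp add: principal_frame_def norm_eq_1)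
  have c\<gamma>: "continuous_on UNIV \<gamma>"
    by (rule has_vector_derivative_continuous_on) (use cd(1) in simp)
  have "open ((\<lambda>u. (\<gamma>' t, \<gamma> u)) -` pdom \<eta> \<inter> {u. \<gamma>' u \<bullet> \<gamma>' t > 0})"
    by (intro open_Int open_vimage smooth_on_pdir(1)[OF \<eta> n] open_Collect_less continuous_intros cd(2) c\<gamma>)
  moreover have "t \<in> (\<lambda>u. (\<gamma>' t, \<gamma> u)) -` pdom \<eta> \<inter> {u. \<gamma>' u \<bullet> \<gamma>' t > 0}"
    using vb(5)[of t] \<gamma>1 by simp
  moreover have "vfield \<eta> \<gamma> t (\<gamma> u) = \<gamma>' u" if "u \<in> (\<lambda>u. (\<gamma>' t, \<gamma> u)) -` pdom \<eta> \<inter> {u. \<gamma>' u \<bullet> \<gamma>' t > 0}" for u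
    unfolding vfield_def \<gamma>'_app
    by (rule pdir_eqI) (use that cd(3) n smooth_on_differentiable[OF \<eta>] in auto)
  moreover have "((\<lambda>u. vfield \<eta> \<gamma> t (\<gamma> u)) has_vector_derivative variation \<eta> \<gamma> t (\<gamma>' t)) (at t)"
  proof -
    have "((\<lambda>u. vfield \<eta> \<gamma> t (\<gamma> u)) has_derivative (\<lambda>h. variation \<eta> \<gamma> t (h *\<^sub>R \<gamma>' t))) (at t)"
      by (rule has_derivative_compose[where f = \<gamma>])
         (use cd(1)[of t] vb(3)[of t] in \<open>auto simp: has_vector_derivative_def\<close>)
    then show ?thesis using vb(1)[of t] by (simp add: has_vector_derivative_def linear_cmul)
  qed
  ultimately show ?thesis
    unfolding has_vector_derivative_def by (rule has_derivative_transform_within_open[rotated])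
qed

section \<open>Linear differential equations along the cycle\<close>

lemma linear_ode_exists:
  fixes A :: "real \<Rightarrow> 'a::euclidean_space \<Rightarrow> 'a"
  assumes lin: "\<And>t. t \<in> {0..T} \<Longrightarrow> linear (A t)" and cont: "\<And>v. continuous_on {0..T} (\<lambda>t. A t v)" and T: "T \<ge> 0"
  shows "\<exists>y. y 0 = y0 \<and> (\<forall>t\<in>{0..T}. (y has_vector_derivative A t (y t)) (at t within {0..T}))"
proof -
  have A: "A t v = (\<Sum>b\<in>Basis. (v \<bullet> b) *\<^sub>R A t b)" if "t \<in> {0..T}" for t v
    by (rule linear_eq_sum_Basis[OF lin[OF that]])
  have "continuous_on {0..T} (\<lambda>t. \<Sum>b\<in>Basis. norm (A t b))" by (intro continuous_intros cont)
  then have "bounded ((\<lambda>t. \<Sum>b\<in>Basis. norm (A t b)) ` {0..T})"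
    by (intro compact_imp_bounded compact_continuous_image) auto
  then obtain K where K: "\<forall>x\<in>(\<lambda>t. \<Sum>b\<in>Basis. norm (A t b)) ` {0..T}. \<bar>x\<bar> \<le> K"
    unfolding bounded_real by blast
  show ?thesis
  proof (rule picard_global[OF _ _ T])
    have c1: "continuous_on ({0..T} \<times> UNIV) (\<lambda>p::real \<times> 'a. A (fst p) b)" for b
      by (rule continuous_on_compose2[OF cont]) (auto intro!: continuous_intros)
    have "continuous_on ({0..T} \<times> UNIV) (\<lambda>p. \<Sum>b\<in>Basis. (snd p \<bullet> b) *\<^sub>R A (fst p) b)"
      by (intro continuous_intros c1)
    then show "continuous_on ({0..T} \<times> UNIV) (\<lambda>(t, x). A t x)"
      by (rule continuous_on_eq) (auto simp: A[symmetric])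
    fix t and x y :: 'a assume t: "t \<in> {0..T}"
    have "norm (A t x - A t y) = norm (A t (x - y))" using lin[OF t] by (simp add: linear_diff)
    also have "\<dots> \<le> (\<Sum>b\<in>Basis. norm (A t b)) * norm (x - y)"
      by (rule norm_linear_le_sum_Basis[OF lin[OF t]])
    also have "\<dots> \<le> K * norm (x - y)"
      using bspec[OF K imageI[OF t]] by (intro mult_right_mono) auto
    finally show "norm (A t x - A t y) \<le> K * norm (x - y)" .
  qed
qed

text \<open>Variation of constants: multiplying \<open>y\<close> by the exponential of
  \<open>s\<close> times the integral of \<open>m\<close> produces the new term, and adding a
  multiple of \<open>\<gamma>'\<close>, itself a solution, removes its tangential part. Components
  normal to the cycle at time \<open>L\<close> are thus scaled by one factor.\<close>

lemma scaled_solution: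
  fixes A :: "real \<Rightarrow> 'a::euclidean_space \<Rightarrow> 'a" and \<gamma>' y :: "real \<Rightarrow> 'a" and m :: "real \<Rightarrow> real"
  assumes L: "L \<ge> 0" and lin: "\<And>t. linear (A t)"
    and \<gamma>': "\<And>t. (\<gamma>' has_vector_derivative A t (\<gamma>' t)) (at t)" "\<And>t. norm (\<gamma>' t) = 1"
    and m: "continuous_on {0..L} m"
    and y: "\<And>t. t \<in> {0..L} \<Longrightarrow> (y has_vector_derivative A t (y t)) (at t within {0..L})"
  obtains y1 l where "y1 0 = y 0" "y1 L = exp (s * integral {0..L} m) *\<^sub>R y L + l *\<^sub>R \<gamma>' L"
    "\<And>t. t \<in> {0..L} \<Longrightarrow> (y1 has_vector_derivative A t (y1 t) + (s * m t) *\<^sub>R (y1 t - (y1 t \<bullet> \<gamma>' t) *\<^sub>R \<gamma>' t))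
        (at t within {0..L})"
proof -
  define M where "M t = integral {0..t} m" for t
  define f where "f t = - (s * m t * exp (s * M t) * (y t \<bullet> \<gamma>' t))" for t
  define l where "l t = integral {0..t} f" for t
  define y1 where "y1 t = exp (s * M t) *\<^sub>R y t + l t *\<^sub>R \<gamma>' t" for t
  have dM: "(M has_real_derivative m t) (at t within {0..L})" if "t \<in> {0..L}" for t
    unfolding M_def has_real_derivative_iff_has_vector_derivative
    by (rule integral_has_vector_derivative[OF m that])
  have cM: "continuous_on {0..L} M"
    by (rule has_vector_derivative_continuous_on) (use dM in \<open>simp add: has_real_derivative_iff_has_vector_derivative\<close>)
  have cy: "continuous_on {0..L} y" by (rule has_vector_derivative_continuous_on[OF y])
  have c\<gamma>: "continuous_on {0..L} \<gamma>'"
    by (rule has_vector_derivative_continuous_on) (rule has_vector_derivative_at_within[OF \<gamma>'(1)])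
  have "continuous_on {0..L} f"
    unfolding f_def by (intro continuous_intros m cM cy c\<gamma>)
  then have dl: "(l has_real_derivative f t) (at t within {0..L})" if "t \<in> {0..L}" for t
    unfolding l_def has_real_derivative_iff_has_vector_derivative
    by (rule integral_has_vector_derivative) (rule that)
  show ?thesis
  proof (rule that[of y1 "l L"])
    show "y1 0 = y 0" by (simp add: y1_def M_def l_def)
    show "y1 L = exp (s * integral {0..L} m) *\<^sub>R y L + l L *\<^sub>R \<gamma>' L" by (simp add: y1_def M_def)
    fix t assume t: "t \<in> {0..L}"
    have gg: "\<gamma>' t \<bullet> \<gamma>' t = 1" using \<gamma>'(2) by (simp add: norm_eq_1)
    have "((\<lambda>t. exp (s * M t)) has_real_derivative exp (s * M t) * (s * m t)) (at t within {0..L})"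
      by (auto intro!: derivative_eq_intros dM t)
    then have "(y1 has_vector_derivative
        (exp (s * M t) *\<^sub>R A t (y t) + (exp (s * M t) * (s * m t)) *\<^sub>R y t) + (l t *\<^sub>R A t (\<gamma>' t) + f t *\<^sub>R \<gamma>' t)) (at t within {0..L})"
      unfolding y1_def[abs_def]
      by (intro has_vector_derivative_add has_vector_derivative_scaleR y t dl
          has_vector_derivative_at_within[OF \<gamma>'(1)])
    moreover have "(exp (s * M t) *\<^sub>R A t (y t) + (exp (s * M t) * (s * m t)) *\<^sub>R y t) + (l t *\<^sub>R A t (\<gamma>' t) + f t *\<^sub>R \<gamma>' t)
        = A t (y1 t) + (s * m t) *\<^sub>R (y1 t - (y1 t \<bullet> \<gamma>' t) *\<^sub>R \<gamma>' t)"
      by (simp add: y1_def f_def linear_add[OF lin] linear_cmul[OF lin] inner_simps gg algebra_simps)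
    ultimately show "(y1 has_vector_derivative A t (y1 t) + (s * m t) *\<^sub>R (y1 t - (y1 t \<bullet> \<gamma>' t) *\<^sub>R \<gamma>' t)) (at t within {0..L})"
      by simp
  qed
qed

text \<open>The parameter \<open>s\<close> is a variable of one jointly smooth map \<open>F\<close>,
  so that closeness to \<eta> for small \<open>s\<close> becomes a matter of uniform continuity. The
  angle \<theta> and the compact set \<open>S\<close> are the same for all \<open>s\<close>.\<close>

lemma perturbation_family:
  fixes \<gamma> :: "real \<Rightarrow> E3"
  assumes \<eta>: "smooth_on UNIV \<eta>" and n: "\<And>p. norm (\<eta> p) = 1"
    and cyc: "principal_cycle \<eta> (k_min \<eta>) \<gamma> L"
  defines "\<gamma>' \<equiv> \<lambda>t. vector_derivative \<gamma> (at t)"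
  obtains F :: "real \<times> E3 \<Rightarrow> E3" and \<mu> :: "E3 \<Rightarrow> real" and S :: "E3 set" where
    "smooth_on UNIV F" "\<And>s x. norm (F (s, x)) = 1" "\<And>x. F (0, x) = \<eta> x"
    "compact S" "\<And>s x. x \<notin> S \<Longrightarrow> F (s, x) = \<eta> x"
    "continuous_on UNIV \<mu>" "\<And>x. \<mu> x \<ge> 0" "\<mu> (\<gamma> (L / 2)) > 0"
    "\<And>s. principal_cycle (\<lambda>x. F (s, x)) (k_min (\<lambda>x. F (s, x))) \<gamma> L"
    "\<And>s t v. t \<in> {0..L} \<Longrightarrow> variation (\<lambda>x. F (s, x)) \<gamma> t v =
        variation \<eta> \<gamma> t v + (s * \<mu> (\<gamma> t)) *\<^sub>R (v - (v \<bullet> \<gamma>' t) *\<^sub>R \<gamma>' t)"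
proof -
  have \<gamma>'_app: "vector_derivative \<gamma> (at t) = \<gamma>' t" for t by (simp add: \<gamma>'_def)
  note cd = principal_cycleD[OF \<eta> n cyc, unfolded \<gamma>'_app]
  note vb = variation_derivative[OF \<eta> n cyc, unfolded \<gamma>'_app]
  note ps = smooth_on_pdir[OF \<eta> n]
  have L: "L > 0" "\<gamma> L = \<gamma> 0" "inj_on \<gamma> {0..<L}" and per: "\<And>s. \<gamma> (s + L) = \<gamma> s"
    using cyc unfolding principal_cycle_def by (auto dest: spec[of _ 0])
  have c\<gamma>: "continuous_on X \<gamma>" for X
    by (rule has_vector_derivative_continuous_on) (rule has_vector_derivative_at_within[OF cd(1)])
  \<comment> \<open>The midpoint keeps the perturbation away from the base point
    \<open>\<gamma> 0\<close>, and a window of radius at most \<open>t0\<close> around it stays in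
    \<open>{0..L}\<close>.\<close>
  define t0 where "t0 = L / 2"
  define p0 where "p0 = \<gamma> t0"
  define e where "e = \<gamma>' t0"
  define W where "W = (\<lambda>x. (e, x)) -` pdom \<eta>"
  define \<xi> where "\<xi> x = pdir \<eta> (e, x)" for x
  have oW: "open W" unfolding W_def by (rule open_vimage_Pair[OF ps(1)])
  have "smooth_on W (\<lambda>x. (e, x))" by (intro smooth_intros oW)
  then have s\<xi>: "smooth_on W \<xi>"
    unfolding \<xi>_def by (rule smooth_on_compose[OF oW ps(2)]) (auto simp: W_def)
  have fr: "principal_frame \<eta> x (\<xi> x)" if "x \<in> W" for x
    using pdir_frame(1)[OF smooth_on_differentiable[OF \<eta>] n, of "(e, x)"] that by (simp add: W_def \<xi>_def)
  have \<xi>I: "\<xi> x = X" if "x \<in> W" "principal_frame \<eta> x X" "X \<bullet> e > 0" for x X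
    unfolding \<xi>_def by (rule pdir_eqI) (use that n smooth_on_differentiable[OF \<eta>] in \<open>auto simp: W_def\<close>)
  have p0W: "p0 \<in> W" using vb(5)[of t0] by (simp add: W_def p0_def e_def)
  have ee: "e \<bullet> e = 1" using cd(3)[of t0] by (simp add: principal_frame_def norm_eq_1 e_def)
  have "open (\<gamma> -` W \<inter> {t. \<gamma>' t \<bullet> e > 0})"
    by (intro open_Int open_vimage oW c\<gamma> open_Collect_less continuous_intros cd(2))
  moreover have "t0 \<in> \<gamma> -` W \<inter> {t. \<gamma>' t \<bullet> e > 0}" using p0W ee by (simp add: p0_def e_def)
  ultimately obtain \<delta>' where \<delta>': "\<delta>' > 0" "ball t0 \<delta>' \<subseteq> \<gamma> -` W \<inter> {t. \<gamma>' t \<bullet> e > 0}"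
    using open_contains_ball_eq by metis
  define \<delta>0 where "\<delta>0 = min \<delta>' t0"
  have \<delta>0: "\<delta>0 > 0" "\<delta>0 \<le> t0" using \<delta>' L by (auto simp: \<delta>0_def t0_def)
  have near: "\<gamma> t \<in> W" "\<xi> (\<gamma> t) = \<gamma>' t" if "\<bar>t - t0\<bar> < \<delta>0" for t
  proof -
    have "t \<in> ball t0 \<delta>'" using that by (auto simp: \<delta>0_def dist_real_def)
    then have "\<gamma> t \<in> W" "\<gamma>' t \<bullet> e > 0" using \<delta>'(2) by auto
    then show "\<gamma> t \<in> W" "\<xi> (\<gamma> t) = \<gamma>' t" using \<xi>I cd(3) by auto
  qed
  have near\<gamma>: "\<gamma> t \<in> W \<and> (\<gamma> has_vector_derivative \<xi> (\<gamma> t)) (at t)" if "\<bar>t - t0\<bar> < \<delta>0" for t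
    using near[OF that] cd(1)[of t] by simp
  have n\<xi>: "norm (\<xi> (\<gamma> t0)) = 1" using near(2)[of t0] \<delta>0 ee by (simp add: e_def norm_eq_1)
  obtain O' y \<delta> where oO: "open O'" "p0 \<in> O'" and sy: "smooth_on O' y" and \<delta>: "0 < \<delta>" "\<delta> \<le> \<delta>0"
    and y0: "\<And>t. \<bar>t - t0\<bar> < \<delta> \<Longrightarrow> y (\<gamma> t) = 0"
    and dy: "\<And>t v. \<bar>t - t0\<bar> < \<delta> \<Longrightarrow> \<gamma> t \<in> O' \<Longrightarrow> \<exists>l. frechet_derivative y (at (\<gamma> t)) v = v - l *\<^sub>R \<xi> (\<gamma> t)"
    unfolding p0_def using straighten_integral_curve[of W \<xi> \<delta>0 t0 \<gamma>, OF oW s\<xi> \<delta>0(1) near\<gamma> n\<xi>] by metis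
  \<comment> \<open>All times of one closed period outside the window. The end \<open>L\<close> lies
    beyond the range of injectivity and is handled through
    \<open>\<gamma> L = \<gamma> 0\<close>.\<close>
  define D where "D = {0..t0 - \<delta>} \<union> {t0 + \<delta>..L}"
  have "\<exists>d>0. \<forall>t\<in>D. d \<le> norm (\<gamma> t - p0)"
  proof -
    have "compact D" "D \<noteq> {}" using \<delta> \<delta>0 by (auto simp: D_def)
    moreover have "continuous_on D (\<lambda>t. norm (\<gamma> t - p0))" by (intro continuous_intros c\<gamma>)
    ultimately obtain u where u: "u \<in> D" "\<forall>t\<in>D. norm (\<gamma> u - p0) \<le> norm (\<gamma> t - p0)"
      using continuous_attains_inf by metis
    have "\<gamma> u \<noteq> \<gamma> t0"
    proof (cases "u = L")
      case True
      then show ?thesis using inj_onD[OF L(3), of 0 t0] L by (auto simp: t0_def)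
    next
      case False
      then show ?thesis using inj_onD[OF L(3), of u t0] L u(1) \<delta> by (auto simp: t0_def D_def)
    qed
    then show ?thesis using u by (intro exI[of _ "norm (\<gamma> u - p0)"]) (auto simp: p0_def)
  qed
  then obtain d where d: "d > 0" "\<And>t. t \<in> D \<Longrightarrow> d \<le> norm (\<gamma> t - p0)" by blast
  obtain \<rho>' where \<rho>': "\<rho>' > 0" "ball p0 \<rho>' \<subseteq> W \<inter> O'"
    using oW oO p0W open_contains_ball_eq[of "W \<inter> O'"] by (metis Int_iff open_Int)
  \<comment> \<open>The ball is so small that, within one period, \<gamma> is in it only at times of
    the window, where the straightening applies.\<close>
  define \<rho> where "\<rho> = min \<rho>' d"
  have \<rho>: "\<rho> > 0" using d \<rho>' by (simp add: \<rho>_def)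
  define B where "B = ball p0 \<rho>"
  \<comment> \<open>\<open>B\<close> and \<open>V\<close> are open and cover the space. Since
    \<theta> vanishes on the overlap, the rotated field on \<open>B\<close> can be glued to \<eta>
    on \<open>V\<close>.\<close>
  define V where "V = - cball p0 (\<rho> / 2)"
  have oB: "open B" and oV: "open V" by (auto simp: B_def V_def)
  have BW: "B \<subseteq> W" and BO: "B \<subseteq> O'" using \<rho>' by (auto simp: B_def \<rho>_def)
  have BV: "x \<in> V" if "x \<notin> B" for x using that \<rho> by (auto simp: B_def V_def)
  have inB: "\<bar>t - t0\<bar> < \<delta>" if "t \<in> {0..L}" "\<gamma> t \<in> B" for t
  proof (rule ccontr)
    assume "\<not> \<bar>t - t0\<bar> < \<delta>"
    then have "t \<in> D" using that by (auto simp: D_def)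
    then have "\<rho> \<le> norm (\<gamma> t - p0)" using d(2)[of t] by (simp add: \<rho>_def)
    then show False using that(2) by (simp add: B_def dist_norm norm_minus_commute)
  qed
  define \<mu> where "\<mu> = bump p0 (\<rho> / 2)"
  define Z where "Z = {\<gamma> t |t. \<bar>t - t0\<bar> < \<delta> \<and> \<gamma> t \<in> B}"
  define \<tau> where "\<tau> x = cross3 (\<eta> x) (\<xi> x)" for x
  define \<kappa> where "\<kappa> x = shape \<eta> x (\<xi> x) (\<xi> x) - shape \<eta> x (\<tau> x) (\<tau> x)" for x
  define m where "m x = shape \<xi> x (\<xi> x) (\<tau> x) - shape \<eta> x (\<eta> x) (\<tau> x)" for x
  have sB: "smooth_on B \<xi>" "smooth_on B \<eta>" "smooth_on B y"
    using smooth_on_subset[OF s\<xi> BW] smooth_on_subset[OF \<eta>] smooth_on_subset[OF sy BO] by auto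
  have sB\<tau>: "smooth_on B \<tau>" unfolding \<tau>_def by (intro smooth_intros oB sB)
  have sB\<mu>: "smooth_on B \<mu>" unfolding \<mu>_def by (rule smooth_on_bump[OF oB])
  have sB\<kappa>: "smooth_on B \<kappa>" and sBm: "smooth_on B m"
    unfolding \<kappa>_def m_def shape_def by (intro smooth_intros oB sB sB\<tau>)+
  have \<mu>V: "\<mu> p = 0" if "p \<in> V" for p
    unfolding \<mu>_def by (rule bump_eq_0) (use that \<rho> in \<open>auto simp: V_def\<close>)
  have Zfr: "norm (\<eta> p) = 1 \<and> norm (\<xi> p) = 1 \<and> \<xi> p \<bullet> \<eta> p = 0 \<and> \<tau> p = cross3 (\<eta> p) (\<xi> p)" if "p \<in> Z" for p
  proof -
    have "p \<in> W" using that BW by (auto simp: Z_def)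
    then show ?thesis using fr[of p] n by (simp add: principal_frame_def \<tau>_def)
  qed
  have Zcurve: "\<exists>c. c 0 = p \<and> (c has_vector_derivative \<xi> p) (at 0) \<and> (\<forall>\<^sub>F t in nhds 0. c t \<in> Z)" if pZ: "p \<in> Z" for p
  proof -
    obtain t where t: "p = \<gamma> t" "\<bar>t - t0\<bar> < \<delta>" "\<gamma> t \<in> B" using pZ by (auto simp: Z_def)
    define c where "c h = \<gamma> (t + h)" for h
    have dg: "(\<gamma> has_vector_derivative \<xi> p) (at (t + 0))"
      using near\<gamma>[of t] t \<delta> by simp
    have "((\<gamma> \<circ> (\<lambda>h. t + h)) has_vector_derivative 1 *\<^sub>R \<xi> p) (at 0)"
      using dg by (intro vector_diff_chain_at) (auto intro!: derivative_eq_intros)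
    then have "(c has_vector_derivative \<xi> p) (at 0)" by (simp add: o_def c_def[abs_def])
    moreover have "\<forall>\<^sub>F h in nhds 0. c h \<in> Z"
      unfolding eventually_nhds
    proof (intro exI[of _ "{h. \<bar>t + h - t0\<bar> < \<delta>} \<inter> (\<lambda>h. \<gamma> (t + h)) -` B"] conjI ballI)
      show "open ({h. \<bar>t + h - t0\<bar> < \<delta>} \<inter> (\<lambda>h. \<gamma> (t + h)) -` B)"
        by (intro open_Int open_vimage oB open_Collect_less continuous_intros continuous_on_compose2[OF c\<gamma>[of UNIV]]) auto
    qed (use t in \<open>auto simp: c_def Z_def\<close>)
    ultimately show ?thesis using t by (intro exI[of _ c]) (simp add: c_def)
  qed
  obtain \<theta> where s\<theta>: "smooth_on B \<theta>" and \<theta>V: "\<And>p. p \<in> B \<inter> V \<Longrightarrow> \<theta> p = 0" and \<theta>Z: "\<And>p. p \<in> Z \<Longrightarrow> \<theta> p = 0"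
    and d\<theta>: "\<And>p v. p \<in> Z \<Longrightarrow> frechet_derivative \<theta> (at p) v = - \<mu> p * (v \<bullet> \<eta> p)"
    and dd\<theta>: "\<And>p v. p \<in> Z \<Longrightarrow> frechet_derivative (\<lambda>x. frechet_derivative \<theta> (at x) (\<tau> x)) (at p) v =
        2 * \<kappa> p * \<mu> p * (v \<bullet> \<tau> p) + m p * \<mu> p * (v \<bullet> \<eta> p)"
  proof (rule angle_function[where Z = Z, OF oB sB sB\<tau> sB\<mu> sB\<kappa> sBm oV _ _ Zfr _ _ Zcurve])
    show "\<mu> p = 0" if "p \<in> B \<inter> V" for p using that \<mu>V by simp
    show "Z \<subseteq> B" by (auto simp: Z_def)
    show "y p = 0" if "p \<in> Z" for p using that y0 by (auto simp: Z_def)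
    show "\<exists>l. frechet_derivative y (at p) v = v - l *\<^sub>R \<xi> p" if "p \<in> Z" for p v
      using that dy BO by (auto simp: Z_def)
  qed (assumption | rule that)+
  define F where "F q = (if snd q \<in> B then cos (fst q * \<theta> (snd q)) *\<^sub>R \<eta> (snd q) + sin (fst q * \<theta> (snd q)) *\<^sub>R \<xi> (snd q)
      else \<eta> (snd q))" for q :: "real \<times> E3"
  have FV: "F (s, x) = \<eta> x" if "x \<in> V" for s x
    using \<theta>V[of x] that by (auto simp: F_def)
  have FB: "F (s, x) = cos (s * \<theta> x) *\<^sub>R \<eta> x + sin (s * \<theta> x) *\<^sub>R \<xi> x" if "x \<in> B" for s x
    using that by (simp add: F_def)
  have sF: "smooth_on UNIV F"
  proof (rule smooth_on_local)
    fix q :: "real \<times> E3"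
    let ?UB = "(UNIV :: real set) \<times> B" and ?UV = "(UNIV :: real set) \<times> V"
    have o: "open ?UB" "open ?UV" using oB oV by (auto intro: open_Times)
    have pull: "smooth_on ?UB (\<lambda>q. f (snd q))" if "smooth_on B f" for f :: "E3 \<Rightarrow> 'z::real_normed_vector"
      by (rule smooth_on_compose[OF o(1) that smooth_on_snd]) auto
    have "smooth_on ?UB (\<lambda>q. cos (fst q * \<theta> (snd q)) *\<^sub>R \<eta> (snd q) + sin (fst q * \<theta> (snd q)) *\<^sub>R \<xi> (snd q))"
      by (intro smooth_intros o pull s\<theta> sB)
    then have 1: "smooth_on ?UB F" by (rule smooth_on_cong[OF o(1), rotated]) (auto simp: F_def)
    have "smooth_on ?UV (\<lambda>q. \<eta> (snd q))"
      by (rule smooth_on_compose[OF o(2) \<eta> smooth_on_snd]) auto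
    then have 2: "smooth_on ?UV F" by (rule smooth_on_cong[OF o(2), rotated]) (auto simp: FV)
    show "\<exists>N. open N \<and> q \<in> N \<and> smooth_on N F"
    proof (cases "snd q \<in> B")
      case True
      then show ?thesis using o 1 by (intro exI[of _ ?UB]) (auto simp: mem_Times_iff)
    next
      case False
      then show ?thesis using o 2 BV by (intro exI[of _ ?UV]) (auto simp: mem_Times_iff)
    qed
  qed
  have nF: "norm (F (s, x)) = 1" for s x
  proof (cases "x \<in> B")
    case True
    have on: "\<eta> x \<bullet> \<eta> x = 1" "\<xi> x \<bullet> \<xi> x = 1" "\<xi> x \<bullet> \<eta> x = 0" "\<eta> x \<bullet> \<xi> x = 0"
      using fr[of x] n[of x] True BW by (auto simp: principal_frame_def norm_eq_1 inner_commute)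
    have "F (s, x) \<bullet> F (s, x) = 1"
      using sin_cos_squared_add[of "s * \<theta> x"] by (simp add: FB[OF True] inner_simps on power2_eq_square)
    then show ?thesis by (simp add: norm_eq_1)
  qed (simp add: F_def n)
  have sFs: "smooth_on UNIV (\<lambda>x. F (s, x))" for s
    by (rule smooth_on_compose[OF _ sF]) (auto intro!: smooth_intros)
  \<comment> \<open>On the cycle \<theta> vanishes and its differential annihilates the plane
    orthogonal to \<eta>, so the rotation leaves the form \<open>shape\<close> on that plane
    unchanged.\<close>
  have frs: "principal_frame (\<lambda>x. F (s, x)) (\<gamma> t) (\<gamma>' t)" if t: "t \<in> {0..L}" for s t
  proof (cases "\<gamma> t \<in> B")
    case False
    have "principal_frame (\<lambda>x. F (s, x)) (\<gamma> t) (\<gamma>' t) \<longleftrightarrow> principal_frame \<eta> (\<gamma> t) (\<gamma>' t)"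
      by (rule principal_frame_cong(1)[OF oV BV[OF False]]) (rule FV)
    then show ?thesis using cd(3) by simp
  next
    case True
    define p where "p = \<gamma> t"
    have pB: "p \<in> B" using True by (simp add: p_def)
    have pZ: "p \<in> Z" using inB[OF t True] True by (auto simp: Z_def p_def)
    have Fp: "F (s, p) = \<eta> p" using \<theta>Z[OF pZ] by (simp add: FB[OF pB])
    have "((\<lambda>x. cos (s * \<theta> x) *\<^sub>R \<eta> x + sin (s * \<theta> x) *\<^sub>R \<xi> x) has_derivative
        (\<lambda>v. frechet_derivative \<eta> (at p) v + (s * frechet_derivative \<theta> (at p) v) *\<^sub>R \<xi> p)) (at p)"
      using \<theta>Z[OF pZ]
      by (auto intro!: derivative_eq_intros smooth_on_has_derivative[OF sB(1) pB] smooth_on_has_derivative[OF sB(2) pB]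
          smooth_on_has_derivative[OF s\<theta> pB] simp: fun_eq_iff)
    then have "((\<lambda>x. F (s, x)) has_derivative
        (\<lambda>v. frechet_derivative \<eta> (at p) v + (s * frechet_derivative \<theta> (at p) v) *\<^sub>R \<xi> p)) (at p)"
      by (rule has_derivative_transform_within_open[OF _ oB pB]) (simp add: FB)
    then have "frechet_derivative (\<lambda>x. F (s, x)) (at p) =
        (\<lambda>v. frechet_derivative \<eta> (at p) v + (s * frechet_derivative \<theta> (at p) v) *\<^sub>R \<xi> p)"
      by (rule frechet_derivativeI)
    then have shape: "shape (\<lambda>x. F (s, x)) p X Y = shape \<eta> p X Y" if "X \<bullet> \<eta> p = 0" for X Y
      unfolding shape_def by (simp add: d\<theta>[OF pZ] that)
    have fr': "principal_frame \<eta> p (\<gamma>' t)" using cd(3) by (simp add: p_def)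
    then have X: "\<gamma>' t \<bullet> \<eta> p = 0" "cross3 (\<eta> p) (\<gamma>' t) \<bullet> \<eta> p = 0"
      by (auto simp: principal_frame_def dot_cross_self)
    show ?thesis
      using fr' unfolding p_def[symmetric] principal_frame_def Fp shape[OF X(1)] shape[OF X(2)] .
  qed
  have cycs: "principal_cycle (\<lambda>x. F (s, x)) (k_min (\<lambda>x. F (s, x))) \<gamma> L" for s
  proof (rule principal_cycleI[OF sFs nF L(1) per L(3) cd(1,2)])
    fix t
    \<comment> \<open>Position and velocity are reduced to one period together, since the frame
      property involves both.\<close>
    have "(\<gamma> (u + L), \<gamma>' (u + L)) = (\<gamma> u, \<gamma>' u)" for u by (simp add: per cd(4))
    then obtain u where u: "u \<in> {0..<L}" "(\<gamma> u, \<gamma>' u) = (\<gamma> t, \<gamma>' t)"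
      using periodic_representative[where \<gamma> = "\<lambda>t. (\<gamma> t, \<gamma>' t)" and L = L and t = t, OF _ L(1)] by blast
    then show "principal_frame (\<lambda>x. F (s, x)) (\<gamma> t) (\<gamma>' t)" using frs[of u s] by simp
  qed
  have var: "variation (\<lambda>x. F (s, x)) \<gamma> t v = variation \<eta> \<gamma> t v + (s * \<mu> (\<gamma> t)) *\<^sub>R (v - (v \<bullet> \<gamma>' t) *\<^sub>R \<gamma>' t)"
    if t: "t \<in> {0..L}" for s t v
  proof -
    note vbs = variation_derivative[OF sFs[of s] nF cycs[of s], unfolded \<gamma>'_app]
    show ?thesis
    proof (cases "\<gamma> t \<in> B")
      case False
      then have V: "\<gamma> t \<in> V" by (rule BV)
      have "((\<lambda>x. vfield (\<lambda>x. F (s, x)) \<gamma> t x) has_derivative variation \<eta> \<gamma> t) (at (\<gamma> t))"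
        by (rule has_derivative_transform_within_open[OF vb(3) oV V])
           (use principal_frame_cong(2)[OF oV, of _ "\<lambda>x. F (s, x)" \<eta>] FV in \<open>simp add: vfield_def\<close>)
      then have "variation (\<lambda>x. F (s, x)) \<gamma> t = variation \<eta> \<gamma> t"
        using vbs(3) has_derivative_unique by blast
      then show ?thesis by (simp add: \<mu>V[OF V])
    next
      case True
      define p where "p = \<gamma> t"
      have pB: "p \<in> B" using True by (simp add: p_def)
      have tt: "\<bar>t - t0\<bar> < \<delta>" using inB[OF t True] .
      then have pZ: "p \<in> Z" using True by (auto simp: Z_def p_def)
      have \<xi>p: "\<xi> p = \<gamma>' t" using near(2)[of t] tt \<delta> by (simp add: p_def)
      define g where "g = vfield (\<lambda>x. F (s, x)) \<gamma> t"
      define N where "N = (\<lambda>x. (\<gamma>' t, x)) -` pdom (\<lambda>x. F (s, x))"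
      have oN: "open N" unfolding N_def by (rule open_vimage_Pair[OF smooth_on_pdir(1)[OF sFs nF]])
      have pN: "p \<in> N" using vbs(5)[of t] by (simp add: N_def p_def)
      have gfr: "principal_frame (\<lambda>x. F (s, x)) x (g x)" if "x \<in> N" for x
        using pdir_frame(1)[of "\<lambda>x. F (s, x)" "(\<gamma>' t, x)"] smooth_on_differentiable[OF sFs[of s]] nF that
        by (simp add: N_def g_def vfield_def \<gamma>'_app)
      have dg: "(g has_derivative variation (\<lambda>x. F (s, x)) \<gamma> t) (at p)" using vbs(3)[of t] by (simp add: g_def p_def)
      have "frechet_derivative g (at p) v = frechet_derivative \<xi> (at p) v + (s * \<mu> p) *\<^sub>R (v - (v \<bullet> \<xi> p) *\<^sub>R \<xi> p)"
      proof (rule rotated_principal_derivative[OF oB pB sB(1,2) s\<theta> n, where \<eta>s = "\<lambda>x. F (s, x)" and N = N])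
        show "principal_frame \<eta> x (\<xi> x)" if "x \<in> B" for x using fr that BW by blast
        show "frechet_derivative (\<lambda>x. frechet_derivative \<theta> (at x) (cross3 (\<eta> x) (\<xi> x))) (at p) v =
          2 * (shape \<eta> p (\<xi> p) (\<xi> p) - shape \<eta> p (cross3 (\<eta> p) (\<xi> p)) (cross3 (\<eta> p) (\<xi> p))) * \<mu> p * (v \<bullet> cross3 (\<eta> p) (\<xi> p))
          + (shape \<xi> p (\<xi> p) (cross3 (\<eta> p) (\<xi> p)) - shape \<eta> p (\<eta> p) (cross3 (\<eta> p) (\<xi> p))) * \<mu> p * (v \<bullet> \<eta> p)" for v
          using dd\<theta>[OF pZ, of v] unfolding \<kappa>_def m_def \<tau>_def by simp
        show "g differentiable (at p)" using dg by (auto simp: differentiable_def)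
        show "g p = \<xi> p" using vbs(4)[of t] by (simp add: g_def p_def \<xi>p[unfolded p_def])
      qed (use FB \<theta>Z[OF pZ] d\<theta>[OF pZ] oN pN gfr in auto)
      moreover have "frechet_derivative g (at p) = variation (\<lambda>x. F (s, x)) \<gamma> t" by (rule frechet_derivativeI[OF dg])
      \<comment> \<open>\<xi> uses the fixed reference \<open>e\<close> and \<open>vfield\<close>
        the reference \<open>\<gamma>' t\<close>. Near \<open>p\<close> both select the same sign,
        so they have the same derivative there.\<close>
      moreover have "frechet_derivative \<xi> (at p) = variation \<eta> \<gamma> t"
      proof -
        define N2 where "N2 = (\<lambda>x. (\<gamma>' t, x)) -` pdom \<eta> \<inter> (B \<inter> \<xi> -` {z. z \<bullet> \<gamma>' t > 0})"
        have o: "open (B \<inter> \<xi> -` {z. z \<bullet> \<gamma>' t > 0})"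
          by (rule continuous_open_preimage[OF smooth_on_continuous_on[OF sB(1)] oB])
             (intro open_Collect_less continuous_intros)
        have oN2: "open N2" unfolding N2_def by (rule open_Int[OF open_vimage_Pair[OF ps(1)] o])
        have "\<gamma>' t \<bullet> \<gamma>' t = 1" using cd(3)[of t] by (simp add: principal_frame_def norm_eq_1)
        then have pN2: "p \<in> N2" using pB vb(5)[of t] by (simp add: N2_def \<xi>p) (simp add: p_def)
        have "vfield \<eta> \<gamma> t x = \<xi> x" if "x \<in> N2" for x
          unfolding vfield_def \<gamma>'_app
          by (rule pdir_eqI) (use that fr[of x] BW n smooth_on_differentiable[OF \<eta>] in \<open>auto simp: N2_def\<close>)
        then have "(\<xi> has_derivative variation \<eta> \<gamma> t) (at p)"
          using has_derivative_transform_within_open[OF vb(3)[of t, folded p_def] oN2 pN2] by blast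
        then show ?thesis by (rule frechet_derivativeI)
      qed
      ultimately show ?thesis by (simp add: \<xi>p p_def[symmetric])
    qed
  qed
  show ?thesis
  proof (rule that[of F "cball p0 (\<rho> / 2)" \<mu>])
    show "F (0, x) = \<eta> x" for x by (simp add: F_def)
    show "F (s, x) = \<eta> x" if "x \<notin> cball p0 (\<rho> / 2)" for s x using that by (intro FV) (simp add: V_def)
    show "continuous_on UNIV \<mu>" unfolding \<mu>_def by (rule smooth_on_continuous_on[OF smooth_on_bump]) simp
    show "\<mu> x \<ge> 0" for x unfolding \<mu>_def by (rule bump_nonneg)
    show "\<mu> (\<gamma> (L / 2)) > 0" using bump_pos[of "\<rho> / 2" p0] \<rho> by (simp add: \<mu>_def p0_def t0_def)
  qed (use sF nF cycs var in auto)
qed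

theorem theorem1:
  fixes \<eta> :: "real ^ 3 \<Rightarrow> real ^ 3" and \<gamma> :: "real \<Rightarrow> real ^ 3" and L \<epsilon> :: real
    and r :: nat and K :: "nat \<Rightarrow> (real ^ 3) set"
  assumes "r \<ge> 2"
    and "compact_exhaustion K"
    and "smooth_on UNIV \<eta>" and "\<forall>p. norm (\<eta> p) = 1"
    and "principal_cycle \<eta> (k_min \<eta>) \<gamma> L"
    and "\<epsilon> > 0"
  shows "\<exists>\<eta>\<^sub>\<epsilon>. smooth_on UNIV \<eta>\<^sub>\<epsilon> \<and> \<eta>\<^sub>\<epsilon> \<in> unit_fields r \<and> Cr_close r K \<epsilon> \<eta> \<eta>\<^sub>\<epsilon> \<and>
           hyperbolic_principal_cycle \<eta>\<^sub>\<epsilon> (k_min \<eta>\<^sub>\<epsilon>) \<gamma> L"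
proof -
  note \<eta> = \<open>smooth_on UNIV \<eta>\<close> and cyc = \<open>principal_cycle \<eta> (k_min \<eta>) \<gamma> L\<close>
  have n: "norm (\<eta> p) = 1" for p using assms(4) by simp
  define \<gamma>' where "\<gamma>' = (\<lambda>t. vector_derivative \<gamma> (at t))"
  have \<gamma>'_app: "vector_derivative \<gamma> (at t) = \<gamma>' t" for t by (simp add: \<gamma>'_def)
  note cd = principal_cycleD[OF \<eta> n cyc, unfolded \<gamma>'_app]
  note vb = variation_derivative[OF \<eta> n cyc, unfolded \<gamma>'_app]
  have L: "L > 0" using cyc by (simp add: principal_cycle_def)
  obtain F :: "real \<times> E3 \<Rightarrow> E3" and \<mu> S where sF: "smooth_on UNIV F" and nF: "\<And>s x. norm (F (s, x)) = 1"
    and F0: "\<And>x. F (0, x) = \<eta> x" and S: "compact S" "\<And>s x. x \<notin> S \<Longrightarrow> F (s, x) = \<eta> x"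
    and \<mu>: "continuous_on UNIV \<mu>" "\<And>x. \<mu> x \<ge> 0" "\<mu> (\<gamma> (L / 2)) > 0"
    and cycs: "\<And>s. principal_cycle (\<lambda>x. F (s, x)) (k_min (\<lambda>x. F (s, x))) \<gamma> L"
    and var: "\<And>s t v. t \<in> {0..L} \<Longrightarrow> variation (\<lambda>x. F (s, x)) \<gamma> t v =
        variation \<eta> \<gamma> t v + (s * \<mu> (\<gamma> t)) *\<^sub>R (v - (v \<bullet> \<gamma>' t) *\<^sub>R \<gamma>' t)"
    by (rule perturbation_family[OF \<eta> n cyc, unfolded \<gamma>'_app], rule that)
  have sFs: "smooth_on UNIV (\<lambda>x. F (s, x))" for s
    by (rule smooth_on_compose[OF _ sF]) (auto intro!: smooth_intros)
  have n1: "norm (\<gamma>' t) = 1" for t using cd(3) by (simp add: principal_frame_def)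
  have m: "continuous_on {0..L} (\<lambda>t. \<mu> (\<gamma> t))"
    by (rule continuous_on_compose2[OF \<mu>(1) has_vector_derivative_continuous_on[OF has_vector_derivative_at_within[OF cd(1)]]])
       simp
  define M where "M = integral {0..L} (\<lambda>t. \<mu> (\<gamma> t))"
  have "M \<ge> 0" unfolding M_def by (intro integral_nonneg integrable_continuous_real m \<mu>(2))
  \<comment> \<open>A continuous nonnegative function with integral zero vanishes on the interval,
    but \<mu> is positive at the midpoint of the cycle.\<close>
  moreover have "M \<noteq> 0"
    using integral_eq_0_iff[OF m L] \<mu>(2,3) L by (auto simp: M_def intro!: bexI[of _ "L / 2"])
  ultimately have M: "M > 0" by simp
  define e2 where "e2 = cross3 (\<eta> (\<gamma> 0)) (\<gamma>' 0)"
  define e3 where "e3 = \<eta> (\<gamma> 0)"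
  have on: "norm e2 = 1" "norm e3 = 1" "\<gamma>' 0 \<bullet> e2 = 0" "\<gamma>' 0 \<bullet> e3 = 0" "e2 \<bullet> e3 = 0"
    using cd(3)[of 0] n cross3_orthonormal[of "\<eta> (\<gamma> 0)" "\<gamma>' 0"]
    by (auto simp: principal_frame_def e2_def e3_def)
  have "\<exists>y. y 0 = e \<and> (\<forall>t\<in>{0..L}. (y has_vector_derivative variation \<eta> \<gamma> t (y t)) (at t within {0..L}))" for e
    by (rule linear_ode_exists) (use vb L in \<open>auto intro: continuous_on_subset\<close>)
  then obtain y2 y3 where y: "y2 0 = e2" "y3 0 = e3"
    and y2: "\<And>t. t \<in> {0..L} \<Longrightarrow> (y2 has_vector_derivative variation \<eta> \<gamma> t (y2 t)) (at t within {0..L})"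
    and y3: "\<And>t. t \<in> {0..L} \<Longrightarrow> (y3 has_vector_derivative variation \<eta> \<gamma> t (y3 t)) (at t within {0..L})"
    by meson
  define N :: "real ^ 2 ^ 2" where "N = vector [vector [e2 \<bullet> y2 L, e2 \<bullet> y3 L], vector [e3 \<bullet> y2 L, e3 \<bullet> y3 L]]"
  obtain s0 where s0: "s0 > 0" "\<And>s vs x. \<lbrakk>\<bar>s\<bar> < s0; length vs \<le> r; set vs \<subseteq> Basis\<rbrakk> \<Longrightarrow>
      norm (iter_deriv (\<lambda>x. F (0, x)) vs x - iter_deriv (\<lambda>x. F (s, x)) vs x) \<le> \<epsilon> / 2"
  proof (rule compactly_supported_family_close[OF sF S(1)])
    show "F (s, x) = F (0, x)" if "x \<notin> S" for s x using S(2)[OF that] by simp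
    show "\<epsilon> / 2 > 0" using \<open>\<epsilon> > 0\<close> by simp
  qed (rule that)
  \<comment> \<open>Multiplication by \<open>exp (s * M)\<close> can move a nonzero eigenvalue
    \<open>z\<close> onto the unit circle only for \<open>s = - ln (norm z) / M\<close>, so each of
    the finitely many eigenvalues forbids at most one \<open>s\<close>.\<close>
  define Bad where "Bad = (\<lambda>z. - ln (norm z) / M) ` {z. complex_eigenvalue N z}"
  have "finite Bad" unfolding Bad_def by (intro finite_imageI finite_complex_eigenvalues2)
  moreover have "infinite {0<..<s0}" using s0(1) by simp
  ultimately have "{0<..<s0} - Bad \<noteq> {}" by (metis Diff_infinite_finite finite.emptyI)
  then obtain s where "s \<in> {0<..<s0} - Bad" by blast
  then have s: "0 < s" "s < s0" "s \<notin> Bad" by auto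
  let ?\<eta> = "\<lambda>x. F (s, x)"
  define c where "c = exp (s * M)"
  have c: "c > 0" by (simp add: c_def)
  note scaled = scaled_solution[OF less_imp_le[OF L] vb(1) velocity_variation[OF \<eta> n cyc, unfolded \<gamma>'_app] n1 m,
      folded M_def, where s = s, folded c_def]
  obtain y2s l2 where y2s: "y2s 0 = y2 0" "y2s L = c *\<^sub>R y2 L + l2 *\<^sub>R \<gamma>' L"
    "\<And>t. t \<in> {0..L} \<Longrightarrow> (y2s has_vector_derivative variation \<eta> \<gamma> t (y2s t) +
        (s * \<mu> (\<gamma> t)) *\<^sub>R (y2s t - (y2s t \<bullet> \<gamma>' t) *\<^sub>R \<gamma>' t)) (at t within {0..L})"
    using scaled[OF y2] by metis
  obtain y3s l3 where y3s: "y3s 0 = y3 0" "y3s L = c *\<^sub>R y3 L + l3 *\<^sub>R \<gamma>' L"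
    "\<And>t. t \<in> {0..L} \<Longrightarrow> (y3s has_vector_derivative variation \<eta> \<gamma> t (y3s t) +
        (s * \<mu> (\<gamma> t)) *\<^sub>R (y3s t - (y3s t \<bullet> \<gamma>' t) *\<^sub>R \<gamma>' t)) (at t within {0..L})"
    using scaled[OF y3] by metis
  define Ns :: "real ^ 2 ^ 2" where "Ns = vector [vector [e2 \<bullet> y2s L, e2 \<bullet> y3s L], vector [e3 \<bullet> y2s L, e3 \<bullet> y3s L]]"
  \<comment> \<open>The tangential corrections with \<open>l2\<close> and \<open>l3\<close> are
    invisible in the section because \<open>\<gamma>' L = \<gamma>' 0\<close> is orthogonal to
    it.\<close>
  have "e2 \<bullet> \<gamma>' L = 0" "e3 \<bullet> \<gamma>' L = 0"
    using on cd(4)[of 0] by (simp_all add: inner_commute)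
  then have Ns: "Ns $ i $ j = c * N $ i $ j" for i j
    using exhaust_2[of i] exhaust_2[of j] by (auto simp: Ns_def N_def y2s y3s inner_simps)
  have "hyperbolic_principal_cycle ?\<eta> (k_min ?\<eta>) \<gamma> L"
  proof (rule hyperbolic_principal_cycleI[where ?y2.0 = y2s and ?y3.0 = y3s, OF sFs nF cycs on[folded \<gamma>'_app]])
    show "(y2s has_vector_derivative variation ?\<eta> \<gamma> t (y2s t)) (at t within {0..L})"
      "(y3s has_vector_derivative variation ?\<eta> \<gamma> t (y3s t)) (at t within {0..L})" if "t \<in> {0..L}" for t
      using y2s(3)[OF that] y3s(3)[OF that] by (simp_all add: var[OF that])
    show "y2s 0 = e2" "y3s 0 = e3" using y2s(1) y3s(1) y by simp_all
    fix z assume "complex_eigenvalue (vector [vector [e2 \<bullet> y2s L, e2 \<bullet> y3s L], vector [e3 \<bullet> y2s L, e3 \<bullet> y3s L]] :: real ^ 2 ^ 2) z"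
    then have ev: "complex_eigenvalue N (z / of_real c)"
      using complex_eigenvalue_scaled[OF Ns] c unfolding Ns_def by simp
    show "z \<notin> sphere 0 1"
    proof
      assume "z \<in> sphere 0 1"
      then have "norm (z / of_real c) = exp (- (s * M))"
        using c by (simp add: norm_divide c_def exp_minus inverse_eq_divide)
      then have "s = - ln (norm (z / of_real c)) / M" using M by simp
      then show False using s(3) ev by (auto simp: Bad_def)
    qed
  qed
  moreover have "Cr_close r K \<epsilon> \<eta> ?\<eta>"
  proof (rule Cr_closeI[OF \<open>compact_exhaustion K\<close> smooth_on_Ck[OF sFs], of "\<epsilon> / 2"])
    show "\<epsilon> / 2 < \<epsilon>" using \<open>\<epsilon> > 0\<close> by simp
    show "norm (iter_deriv \<eta> vs x - iter_deriv ?\<eta> vs x) \<le> \<epsilon> / 2" if "length vs \<le> r" "set vs \<subseteq> Basis" for vs x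
      using s0(2)[of s vs x] s that by (simp add: F0)
  qed
  ultimately show ?thesis
    using sFs nF smooth_on_Ck[OF sFs] by (intro exI[of _ ?\<eta>]) (simp add: unit_fields_def)
qed

end
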